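(* There exists a real rational map $f:\widehat{\mathbb{C}}\to\widehat{\mathbb{C}}$ (i.e. a rational map with real coefficients) of degree $6$ satisfying the following properties. (1) $f$ is postcritically finite and its postcritical set is a four-element set $P_f=\{0,v_0,v_1,v_2\}$. The point $0$ is a superattracting fixed point of $f$ of local degree $3$, and $f^{-1}(0)=P_f$. (2) $f$ admits two characteristic curves $\beta$ and $\beta'$: $f^{-1}(\beta)$ (resp. $f^{-1}(\beta')$) consists of two essential Jordan curves, each homotopic to $\beta$ (resp. $\beta'$) rel $P_f$, and these two curves map onto $\beta$ (resp. $\beta'$) with degrees $4$ and $2$. (3) $\beta$ and $\beta'$ are not homotopic rel $P_f$. More precisely, the curve $\beta$ separates $\{0,v_0\}$ from $\{v_1,v_2\}$, whereas $\beta'$ separates $\{0,v_1\}$ from $\{v_0,v_2\}$. (4) The orbifold of $f$ has signature $(2,2,3,\infty)$. In particular $f$ is not a Lattès map.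
   Context: $\widehat{\mathbb{C}}$ is the Riemann sphere. For a rational map $f$ of degree at least two, $\operatorname{Crit}(f)$ is its set of critical points and $P_f=\overline{\bigcup_{n\ge1}f^{\circ n}(\operatorname{Crit}(f))}$ is its postcritical set; $f$ is postcritically finite if $P_f$ is finite. A Jordan curve $\gamma\subset\widehat{\mathbb{C}}\setminus P_f$ is essential if each of the two components of $\widehat{\mathbb{C}}\setminus\gamma$ contains at least two points of $P_f$. Two Jordan curves in $\widehat{\mathbb{C}}\setminus P_f$ are homotopic rel $P_f$ if they are (freely, as unoriented curves) homotopic in $\widehat{\mathbb{C}}\setminus P_f$. A characteristic curve of a postcritically finite rational map $f$ is an essential Jordan curve $\beta\subset\widehat{\mathbb{C}}\setminus P_f$ such that every component of $f^{-1}(\beta)$ is homotopic to $\beta$ rel $P_f$ and $f^{-1}(\beta)$ has at least two components. The orbifold of $f$ is the pair $(\widehat{\mathbb{C}},\nu_f)$, where for $p\in P_f$ the value $\nu_f(p)\in\mathbb{Z}_{\ge2}\cup\{\infty\}$ is the least common multiple of the local degrees $\deg(f^{\circ n},z)$ over all $n\ge1$ and all $z$ with $f^{\circ n}(z)=p$ ($\infty$ if these are unbounded). The signature is the list of values of $\nu_f$ on $P_f$ (with multiplicity). A Lattès map is a rational map obtained as a finite quotient of an affine self-map of a complex torus. *)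

theory Defs
  imports
    "HOL-Complex_Analysis.Complex_Analysis"
    "HOL-Library.Multiset"
    "HOL-Library.Extended_Nat"
begin

section \<open>The Riemann sphere\<close>

text \<open>The point at infinity is \<open>None\<close>.\<close>

type_synonym csphere = "complex option"

definition riemann_sphere :: "csphere topology" where
  "riemann_sphere = Alexandroff_compactification euclidean"

lemma topspace_riemann_sphere [simp]: "topspace riemann_sphere = UNIV"
  by (auto simp: riemann_sphere_def notin_range_Some)

text \<open>
  \<open>sphere_coord a\<close> is a local coordinate centred at \<open>a\<close>: it is \<open>z - a\<close> for finite \<open>a\<close> and
  \<open>1 / z\<close> for \<open>a = \<infinity>\<close>. Its inverse is \<open>sphere_point a\<close>. The value of \<open>sphere_coord a\<close> at the
  single point outside the chart (\<open>\<infinity>\<close> and \<open>0\<close>, respectively) is irrelevant.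
\<close>

fun sphere_coord :: "csphere \<Rightarrow> csphere \<Rightarrow> complex" where
  "sphere_coord (Some a) (Some z) = z - a"
| "sphere_coord (Some a) None = 0"
| "sphere_coord None (Some z) = inverse z"
| "sphere_coord None None = 0"

fun sphere_point :: "csphere \<Rightarrow> complex \<Rightarrow> csphere" where
  "sphere_point (Some a) t = Some (a + t)"
| "sphere_point None t = (if t = 0 then None else Some (inverse t))"


section \<open>Rational maps\<close>

text \<open>For coprime \<open>p\<close>, \<open>q\<close>, the self-map of the sphere given by \<open>p / q\<close>; the value at \<open>\<infinity>\<close> is the
  limit, i.e. the quotient of the coefficients in degree \<open>max (degree p) (degree q)\<close>.\<close>

definition ratfun :: "complex poly \<Rightarrow> complex poly \<Rightarrow> csphere \<Rightarrow> csphere" where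
  "ratfun p q z =
     (case z of
        Some x \<Rightarrow> if poly q x = 0 then None else Some (poly p x / poly q x)
      | None \<Rightarrow>
          let d = max (degree p) (degree q)
          in if coeff q d = 0 then None else Some (coeff p d / coeff q d))"

definition rational_map :: "nat \<Rightarrow> (csphere \<Rightarrow> csphere) \<Rightarrow> bool" where
  "rational_map d f \<longleftrightarrow>
     (\<exists>p q. coprime p q \<and> max (degree p) (degree q) = d \<and> f = ratfun p q)"

definition real_rational_map :: "nat \<Rightarrow> (csphere \<Rightarrow> csphere) \<Rightarrow> bool" where
  "real_rational_map d f \<longleftrightarrow>
     (\<exists>p q. coprime p q \<and> max (degree p) (degree q) = d \<and> f = ratfun p q \<and>
            (\<forall>n. coeff p n \<in> \<real>) \<and> (\<forall>n. coeff q n \<in> \<real>))"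

text \<open>The local degree is the order of vanishing of the map in centred coordinates at the point
  and at its image.\<close>

definition local_degree :: "(csphere \<Rightarrow> csphere) \<Rightarrow> csphere \<Rightarrow> nat" where
  "local_degree f z = nat (zorder (\<lambda>t. sphere_coord (f z) (f (sphere_point z t))) 0)"

definition Crit :: "(csphere \<Rightarrow> csphere) \<Rightarrow> csphere set" where
  "Crit f = {z. local_degree f z \<ge> 2}"

definition postcritical_set :: "(csphere \<Rightarrow> csphere) \<Rightarrow> csphere set" where
  "postcritical_set f = riemann_sphere closure_of (\<Union>n\<in>{1..}. (f ^^ n) ` Crit f)"

definition postcritically_finite :: "(csphere \<Rightarrow> csphere) \<Rightarrow> bool" where
  "postcritically_finite f \<longleftrightarrow> finite (postcritical_set f)"

definition superattracting_fixed_point :: "(csphere \<Rightarrow> csphere) \<Rightarrow> csphere \<Rightarrow> bool" where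
  "superattracting_fixed_point f z \<longleftrightarrow> f z = z \<and> z \<in> Crit f"


section \<open>Jordan curves\<close>

abbreviation circle :: "complex topology" where
  "circle \<equiv> top_of_set (sphere 0 1)"

definition jordan_param :: "(complex \<Rightarrow> csphere) \<Rightarrow> csphere set \<Rightarrow> bool" where
  "jordan_param g \<gamma> \<longleftrightarrow> embedding_map circle riemann_sphere g \<and> g ` sphere 0 1 = \<gamma>"

definition jordan_curve :: "csphere set \<Rightarrow> bool" where
  "jordan_curve \<gamma> \<longleftrightarrow> (\<exists>g. jordan_param g \<gamma>)"

text \<open>Free homotopy in the complement of \<open>P\<close>; as the parametrizations are arbitrary, the curves
  are unoriented.\<close>

definition homotopic_rel :: "csphere set \<Rightarrow> csphere set \<Rightarrow> csphere set \<Rightarrow> bool" where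
  "homotopic_rel P \<gamma> \<delta> \<longleftrightarrow>
     (\<exists>g h. jordan_param g \<gamma> \<and> jordan_param h \<delta> \<and>
            homotopic_with (\<lambda>_. True) circle (subtopology riemann_sphere (- P)) g h)"

definition components_in_sphere :: "csphere set \<Rightarrow> csphere set set" where
  "components_in_sphere A = connected_components_of (subtopology riemann_sphere A)"

definition essential_curve :: "(csphere \<Rightarrow> csphere) \<Rightarrow> csphere set \<Rightarrow> bool" where
  "essential_curve f \<gamma> \<longleftrightarrow>
     jordan_curve \<gamma> \<and> \<gamma> \<inter> postcritical_set f = {} \<and>
     (\<forall>U \<in> components_in_sphere (- \<gamma>).
        \<exists>a b. a \<noteq> b \<and> {a, b} \<subseteq> U \<inter> postcritical_set f)"

definition characteristic_curve :: "(csphere \<Rightarrow> csphere) \<Rightarrow> csphere set \<Rightarrow> bool" where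
  "characteristic_curve f \<beta> \<longleftrightarrow>
     essential_curve f \<beta> \<and>
     (\<forall>\<gamma> \<in> components_in_sphere (f -` \<beta>). homotopic_rel (postcritical_set f) \<gamma> \<beta>) \<and>
     (\<exists>\<gamma> \<in> components_in_sphere (f -` \<beta>). \<exists>\<delta> \<in> components_in_sphere (f -` \<beta>). \<gamma> \<noteq> \<delta>)"

definition separates :: "csphere set \<Rightarrow> csphere set \<Rightarrow> csphere set \<Rightarrow> bool" where
  "separates \<gamma> A B \<longleftrightarrow>
     (\<exists>U \<in> components_in_sphere (- \<gamma>). \<exists>V \<in> components_in_sphere (- \<gamma>).
        U \<noteq> V \<and> A \<subseteq> U \<and> B \<subseteq> V)"

text \<open>\<open>f\<close> maps \<open>X\<close> onto \<open>Y\<close> with degree \<open>k\<close>, meaning as a \<open>k\<close>-sheeted covering.\<close>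

definition covering_of_degree ::
    "nat \<Rightarrow> 'a topology \<Rightarrow> 'b topology \<Rightarrow> ('a \<Rightarrow> 'b) \<Rightarrow> bool" where
  "covering_of_degree k X Y f \<longleftrightarrow>
     continuous_map X Y f \<and> f ` topspace X = topspace Y \<and>
     (\<forall>y \<in> topspace Y. \<exists>V \<U>. openin Y V \<and> y \<in> V \<and>
        \<Union>\<U> = {x \<in> topspace X. f x \<in> V} \<and> pairwise disjnt \<U> \<and>
        finite \<U> \<and> card \<U> = k \<and>
        (\<forall>U \<in> \<U>. openin X U \<and> homeomorphic_map (subtopology X U) (subtopology Y V) f))"

definition maps_onto_with_degree ::
    "(csphere \<Rightarrow> csphere) \<Rightarrow> csphere set \<Rightarrow> csphere set \<Rightarrow> nat \<Rightarrow> bool" where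
  "maps_onto_with_degree f \<gamma> \<beta> k \<longleftrightarrow>
     covering_of_degree k (subtopology riemann_sphere \<gamma>) (subtopology riemann_sphere \<beta>) f"


section \<open>Orbifold and Lattes maps\<close>

definition orbifold_weight :: "(csphere \<Rightarrow> csphere) \<Rightarrow> csphere \<Rightarrow> enat" where
  "orbifold_weight f p =
     (let D = {local_degree (f ^^ n) z |n z. n \<ge> 1 \<and> (f ^^ n) z = p}
      in if bdd_above D then enat (Lcm D) else \<infinity>)"

definition orbifold_signature :: "(csphere \<Rightarrow> csphere) \<Rightarrow> enat multiset" where
  "orbifold_signature f = image_mset (orbifold_weight f) (mset_set (postcritical_set f))"

definition complex_lattice :: "complex set \<Rightarrow> bool" where
  "complex_lattice \<Lambda> \<longleftrightarrow>
     (\<exists>\<omega>\<^sub>1 \<omega>\<^sub>2. Im (\<omega>\<^sub>1 * cnj \<omega>\<^sub>2) \<noteq> 0 \<and>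
        \<Lambda> = {of_int m * \<omega>\<^sub>1 + of_int n * \<omega>\<^sub>2 |m n. True})"

text \<open>Continuity has to be required separately, because \<open>sphere_coord\<close> takes an arbitrary value
  outside its chart.\<close>

definition holomorphic_to_sphere :: "(complex \<Rightarrow> csphere) \<Rightarrow> bool" where
  "holomorphic_to_sphere \<Theta> \<longleftrightarrow>
     continuous_map euclidean riemann_sphere \<Theta> \<and>
     (\<forall>z. (\<lambda>w. sphere_coord (\<Theta> z) (\<Theta> w)) analytic_on {z})"

text \<open>A finite-to-one holomorphic surjection from the torus \<open>\<complex> / \<Lambda>\<close> onto the sphere is given by its
  \<open>\<Lambda>\<close>-periodic lift \<open>\<Theta>\<close>; it semiconjugates the map of the torus induced by \<open>z \<mapsto> a z + b\<close> to \<open>f\<close>.\<close>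

definition lattes_map :: "(csphere \<Rightarrow> csphere) \<Rightarrow> bool" where
  "lattes_map f \<longleftrightarrow>
     (\<exists>d\<ge>2. rational_map d f) \<and>
     (\<exists>\<Lambda> a b \<Theta>.
        complex_lattice \<Lambda> \<and> (\<forall>\<omega>\<in>\<Lambda>. a * \<omega> \<in> \<Lambda>) \<and>
        holomorphic_to_sphere \<Theta> \<and> (\<forall>z. \<forall>\<omega>\<in>\<Lambda>. \<Theta> (z + \<omega>) = \<Theta> z) \<and>
        surj \<Theta> \<and> (\<forall>w. finite ((\<lambda>z. (+) z ` \<Lambda>) ` (\<Theta> -` {w}))) \<and>
        (\<forall>z. f (\<Theta> z) = \<Theta> (a * z + b)))"

end

theory Submission
  imports Defs "HOL-Computational_Algebra.Fundamental_Theorem_Algebra"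
begin

text \<open>
  We use an odd map \<open>F z = z\<^sup>3 (1 - z\<^sup>2) / (C (z\<^sup>2 + b)\<^sup>3)\<close> with \<open>v\<^sub>0 = 1\<close>, \<open>v\<^sub>1 = -1\<close> and \<open>v\<^sub>2 = \<infinity>\<close>,
  where \<open>b\<close> and \<open>C\<close> are chosen such that all critical points other than \<open>0\<close> and the poles have value
  \<open>1\<close> or \<open>-1\<close>. The curves are the circles of radius \<open>1\<close> about \<open>1/2\<close> and \<open>-1/2\<close>.

  Let \<open>B\<close> be the first circle and \<open>K\<close> its preimage, a \<open>6\<close>-sheeted covering of \<open>B\<close>. As
  \<open>-1 \<le> F \<le> 1\<close> on the real line, \<open>K\<close> avoids \<open>[0, 1]\<close> and \<open>(-\<infinity>, -1]\<close>, and every component of \<open>K\<close>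
  with a real point is invariant under conjugation, has exactly two real points and even degree
  over \<open>B\<close>; at least two components have real points. By the maximum principle, a component that
  does not enclose \<open>0\<close> encloses a pole \<open>\<plusminus> \<i> \<surd>b\<close>. Hence each component crosses the imaginary axis;
  but \<open>K\<close> has at most one point on the half-axis \<open>\<i> (0, \<infinity>)\<close> on either side of the pole. Therefore there
  are exactly two components, both enclose \<open>0\<close>, and their degrees are \<open>4\<close> and \<open>2\<close>. Curves in the
  complement of the two slits that wind once around \<open>0\<close> are homotopic to each other, and the two
  circles are distinguished by their winding numbers about \<open>1\<close>.

  A Lattes map has no superattracting fixed point, since the local degrees of the
  semiconjugating map \<open>\<Theta>\<close> would be unbounded along an orbit over that point.
\<close>


section \<open>Local degrees\<close>

text \<open>The form of \<open>F\<close> comes from counting. A map of degree 6 has ten critical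
  points with multiplicity; 0 and the two triple poles account for 2 + 4, and the other four have to
  be simple with values 1 and -1. By oddness this is one condition: 1 - F vanishes to second order
  at both roots of a real quadratic z^2 + p z + q. The remaining factor of its numerator is a
  quadratic without real roots, so the same identity yields F <= 1 on the real line. Each circle
  meets the real line in a point of modulus 1/2 and one of modulus 3/2; by the bound only the first
  is a value of \<open>F\<close> at a real point. Uniqueness on the imaginary axis comes from
  monotonicity: away from the poles \<open>F\<close> maps this axis to itself, both circles meet it
  in points of modulus sqrt(3)/2, and the modulus of \<open>F\<close> increases from 0 up to the
  pole and decreases beyond it. This replaces an explicit description of the preimage. The symmetry
  z -> -z exchanges the two circles, and a sign e carries both through one argument.\<close>

definition has_local_degree :: "(csphere \<Rightarrow> csphere) \<Rightarrow> csphere \<Rightarrow> nat \<Rightarrow> bool" where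
  "has_local_degree f z n \<longleftrightarrow> n > 0 \<and>
     (\<exists>h. h analytic_on {0} \<and> h 0 \<noteq> 0 \<and>
        (\<forall>\<^sub>F t in nhds 0. f (sphere_point z t) = sphere_point (f z) (t ^ n * h t)))"

lemma sphere_coord_sphere_point [simp]: "sphere_coord a (sphere_point a t) = t"
  by (cases a) auto

lemma sphere_point_0 [simp]: "sphere_point a 0 = a"
  by (cases a) auto

lemma zorder_power_mult:
  assumes "h analytic_on {0::complex}" "h 0 \<noteq> 0"
    and ev: "\<forall>\<^sub>F t in nhds 0. g t = t ^ n * h t"
  shows "zorder g 0 = int n"
proof -
  obtain S where S: "open S" "0 \<in> S" "h holomorphic_on S"
    using assms(1) analytic_at by blast
  obtain T where T: "open T" "0 \<in> T" "\<And>t. t \<in> T \<Longrightarrow> g t = t ^ n * h t"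
    using ev unfolding eventually_nhds by blast
  show ?thesis
  proof (rule zorder_eqI)
    show "open (S \<inter> T)" "0 \<in> S \<inter> T" "h holomorphic_on S \<inter> T" "h 0 \<noteq> 0"
      using S T assms(2) by (auto intro: holomorphic_on_subset)
    show "\<And>w. w \<in> S \<inter> T \<Longrightarrow> w \<noteq> 0 \<Longrightarrow> g w = h w * (w - 0) powi int n"
      using T by simp
  qed
qed

lemma local_degree_eqI:
  assumes "has_local_degree f z n"
  shows "local_degree f z = n"
proof -
  obtain h where h: "h analytic_on {0}" "h 0 \<noteq> 0"
      "\<forall>\<^sub>F t in nhds 0. f (sphere_point z t) = sphere_point (f z) (t ^ n * h t)"
    using assms unfolding has_local_degree_def by blast
  have "zorder (\<lambda>t. sphere_coord (f z) (f (sphere_point z t))) 0 = int n"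
    by (rule zorder_power_mult[OF h(1,2)]) (use h(3) in eventually_elim, simp)
  then show ?thesis
    by (simp add: local_degree_def)
qed

text \<open>Substituting one normal form t^m h(t), with h analytic and h(0) nonzero, into another
  multiplies the exponents and keeps the unit factor analytic and nonzero. Both the chain rule for
  local degrees and the growth of vanishing orders in the Lattes argument rest on this.\<close>

lemma power_form_compose:
  fixes h k :: "complex \<Rightarrow> complex"
  assumes h: "h analytic_on {0}" "h 0 \<noteq> 0" and k: "k analytic_on {0}" "k 0 \<noteq> 0" and m: "m > 0"
  obtains j where "j analytic_on {0}" "j 0 \<noteq> 0" "\<And>t. (t ^ m * h t) ^ n * k (t ^ m * h t) = t ^ (n * m) * j t"
    "filterlim (\<lambda>t. t ^ m * h t) (nhds 0) (nhds 0)"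
proof
  let ?u = "\<lambda>t. t ^ m * h t"
  have u: "?u analytic_on {0}" "?u 0 = 0"
    using h m by (auto intro!: analytic_intros)
  show "filterlim ?u (nhds 0) (nhds 0)"
    using analytic_at_imp_isCont[OF u(1)] u(2) tendsto_at_iff_tendsto_nhds[of ?u 0]
    by (simp only: isCont_def)
  have "(\<lambda>t. k (?u t)) analytic_on {0}"
    using analytic_on_compose[OF u(1), of k] k(1) u(2) by (simp add: o_def)
  then show "(\<lambda>t. h t ^ n * k (?u t)) analytic_on {0}"
    using h by (intro analytic_intros)
  show "h 0 ^ n * k (?u 0) \<noteq> 0"
    unfolding u(2) using h k by simp
  show "?u t ^ n * k (?u t) = t ^ (n * m) * (h t ^ n * k (?u t))" for t
    by (simp only: power_mult_distrib power_mult mult.commute[of n m] mult.assoc)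
qed

text \<open>Working with \<open>sphere_point\<close> on both sides, and not with
  \<open>sphere_coord\<close> as in \<open>local_degree\<close>, lets the two local normal forms be
  chained literally, without arbitrary chart values.\<close>

lemma has_local_degree_compose:
  assumes f: "has_local_degree f z m" and g: "has_local_degree g (f z) n"
  shows "has_local_degree (g \<circ> f) z (n * m)"
proof -
  obtain h where h: "h analytic_on {0}" "h 0 \<noteq> 0"
      and hev: "\<forall>\<^sub>F t in nhds 0. f (sphere_point z t) = sphere_point (f z) (t ^ m * h t)" and m: "m > 0"
    using f unfolding has_local_degree_def by blast
  obtain k where k: "k analytic_on {0}" "k 0 \<noteq> 0"
      and kev: "\<forall>\<^sub>F t in nhds 0. g (sphere_point (f z) t) = sphere_point (g (f z)) (t ^ n * k t)" and n: "n > 0"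
    using g unfolding has_local_degree_def by blast
  obtain j where j: "j analytic_on {0}" "j 0 \<noteq> 0" "\<And>t. (t ^ m * h t) ^ n * k (t ^ m * h t) = t ^ (n * m) * j t"
    "filterlim (\<lambda>t. t ^ m * h t) (nhds 0) (nhds 0)"
    using power_form_compose[OF h k m, of n] by metis
  have "\<forall>\<^sub>F t in nhds 0. (g \<circ> f) (sphere_point z t) = sphere_point ((g \<circ> f) z) (t ^ (n * m) * j t)"
    using hev eventually_compose_filterlim[OF kev j(4)] by eventually_elim (simp add: j(3))
  then show ?thesis
    unfolding has_local_degree_def using j(1,2) m n by (intro conjI exI[of _ j]) simp_all
qed

lemma eventually_nhds_shift:
  fixes x :: "'a::real_normed_vector"
  assumes "\<forall>\<^sub>F w in nhds x. P w"
  shows "\<forall>\<^sub>F t in nhds 0. P (x + t)"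
proof -
  have "isCont (\<lambda>t. x + t) 0"
    by (intro continuous_intros)
  then have "filterlim (\<lambda>t. x + t) (nhds x) (nhds 0)"
    using tendsto_at_iff_tendsto_nhds[of "\<lambda>t. x + t" 0] by (simp add: isCont_def)
  then show ?thesis
    by (rule eventually_compose_filterlim[OF assms])
qed

lemma analytic_shift:
  assumes "h analytic_on {x::complex}"
  shows "(\<lambda>t. h (x + t)) analytic_on {0}"
  using analytic_on_compose[OF analytic_on_add[OF analytic_on_const[of x] analytic_on_ident], of h "{0}"] assms
  by (simp add: o_def)

lemma has_local_degree_finite:
  assumes "f (Some x) = Some y" "h analytic_on {x}" "h x \<noteq> 0" "n > 0"
    and "\<forall>\<^sub>F w in nhds x. f (Some w) = Some (y + (w - x) ^ n * h w)"
  shows "has_local_degree f (Some x) n"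
  unfolding has_local_degree_def
  using eventually_nhds_shift[OF assms(5)] analytic_shift[OF assms(2)] assms(1,3,4)
  by (intro conjI exI[of _ "\<lambda>t. h (x + t)"]) simp_all

text \<open>In the coordinate 1/w at infinity a pole h(w) / (w - x)^n becomes (w - x)^n / h(w), so
  the unit factor is \<open>inverse (h (x + t))\<close>. The centre is exempted in the hypothesis
  because division by 0 would produce the finite value 0 there.\<close>

lemma has_local_degree_pole:
  assumes "f (Some x) = None" "h analytic_on {x}" "h x \<noteq> 0" "n > 0"
    and ev: "\<forall>\<^sub>F w in nhds x. w \<noteq> x \<longrightarrow> f (Some w) = Some (h w / (w - x) ^ n)"
  shows "has_local_degree f (Some x) n"
proof -
  have sh: "(\<lambda>t. h (x + t)) analytic_on {0}"
    by (rule analytic_shift[OF assms(2)])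
  then have "(\<lambda>t. inverse (h (x + t))) analytic_on {0}"
    using assms(3) by (intro analytic_intros) auto
  moreover have "\<forall>\<^sub>F w in nhds x. h w \<noteq> 0"
    using analytic_at_imp_isCont[OF assms(2)] assms(3)
    unfolding isCont_def tendsto_at_iff_tendsto_nhds by (rule tendsto_imp_eventually_ne)
  with ev have "\<forall>\<^sub>F w in nhds x. (w \<noteq> x \<longrightarrow> f (Some w) = Some (h w / (w - x) ^ n)) \<and> h w \<noteq> 0"
    by eventually_elim auto
  from eventually_nhds_shift[OF this]
  have "\<forall>\<^sub>F t in nhds 0. f (sphere_point (Some x) t) = sphere_point (f (Some x)) (t ^ n * inverse (h (x + t)))"
  proof eventually_elim
    case (elim t)
    then show ?case
      using assms(1,4) by (cases "t = 0") (auto simp: divide_inverse)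
  qed
  ultimately show ?thesis
    unfolding has_local_degree_def using assms(3,4)
    by (intro conjI exI[of _ "\<lambda>t. inverse (h (x + t))"]) simp_all
qed

text \<open>The parameter 0 is exempted in the hypothesis because \<open>inverse 0 = 0\<close>,
  whereas \<open>sphere_point None 0\<close> is infinity.\<close>

lemma has_local_degree_at_infinity:
  assumes "f None = Some y" "h analytic_on {0}" "h 0 \<noteq> 0" "n > 0"
    and "\<forall>\<^sub>F t in nhds 0. t \<noteq> 0 \<longrightarrow> f (Some (inverse t)) = Some (y + t ^ n * h t)"
  shows "has_local_degree f None n"
  unfolding has_local_degree_def
  proof (intro conjI exI[of _ h])
  show "\<forall>\<^sub>F t in nhds 0. f (sphere_point None t) = sphere_point (f None) (t ^ n * h t)"
    using assms(5) by eventually_elim (use assms(1,4) in auto)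
qed (use assms in auto)

section \<open>Jordan curves on the sphere\<close>

text \<open>Each piece is also closed, since its complement is the union of the other open pieces. A
  connected set that meets a clopen piece stays inside it, so the pieces are the components.\<close>

lemma connected_components_of_eqI:
  assumes "\<Union>\<U> = topspace X" "pairwise disjnt \<U>"
    and "\<And>U. U \<in> \<U> \<Longrightarrow> openin X U \<and> connectedin X U \<and> U \<noteq> {}"
  shows "connected_components_of X = \<U>"
proof -
  have clo: "closedin X U" if "U \<in> \<U>" for U
  proof -
    have "topspace X - U = \<Union>(\<U> - {U})"
    proof (intro set_eqI iffI)
      fix x assume "x \<in> topspace X - U"
      then show "x \<in> \<Union>(\<U> - {U})" using assms(1) by blast
    next
      fix x assume "x \<in> \<Union>(\<U> - {U})"
      then obtain V where V: "V \<in> \<U>" "V \<noteq> U" "x \<in> V" by blast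
      then have "disjnt V U" using assms(2) that by (simp add: pairwiseD)
      then show "x \<in> topspace X - U" using V assms(1) by (auto simp: disjnt_def)
    qed
    moreover have "openin X (\<Union>(\<U> - {U}))"
      using assms(3) by (intro openin_Union) auto
    ultimately show ?thesis
      using assms(1) that by (auto simp: closedin_def)
  qed
  have eq: "connected_component_of_set X x = U" if "U \<in> \<U>" "x \<in> U" for x U
  proof
    show "U \<subseteq> connected_component_of_set X x"
      using assms(3)[OF that(1)] that(2) by (intro connected_component_of_maximal) auto
    have "connectedin X (connected_component_of_set X x)"
      by (rule connectedin_connected_component_of)
    then have "connected_component_of_set X x \<subseteq> U \<or> disjnt (connected_component_of_set X x) U"
      using assms(3)[OF that(1)] clo[OF that(1)] by (intro connectedin_clopen_cases) auto
    moreover have "x \<in> connected_component_of_set X x"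
      using that assms(1) by (auto simp: connected_component_of_refl)
    ultimately show "connected_component_of_set X x \<subseteq> U"
      using that(2) by (auto simp: disjnt_iff)
  qed
  show ?thesis
  proof
    show "connected_components_of X \<subseteq> \<U>"
    proof
      fix V assume "V \<in> connected_components_of X"
      then obtain x where x: "x \<in> topspace X" "V = connected_component_of_set X x"
        by (auto simp: connected_components_of_def)
      then obtain U where U: "U \<in> \<U>" "x \<in> U" using assms(1) by blast
      then show "V \<in> \<U>" using eq[OF U] x by simp
    qed
    show "\<U> \<subseteq> connected_components_of X"
    proof
      fix U assume U: "U \<in> \<U>"
      then obtain x where x: "x \<in> U" using assms(3)[OF U] by blast
      then have "x \<in> topspace X" using U assms(1) by blast
      then show "U \<in> connected_components_of X"
        using eq[OF U x] by (auto simp: connected_components_of_def)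
    qed
  qed
qed

lemma homeomorphic_map_Some:
  "homeomorphic_map (top_of_set S) (subtopology riemann_sphere (Some ` S)) Some"
proof -
  have "homeomorphic_map euclidean (subtopology riemann_sphere (range Some)) (Some :: complex \<Rightarrow> _)"
    using embedding_map_Some[of "euclidean :: complex topology"]
    by (simp add: riemann_sphere_def embedding_map_def)
  then have "homeomorphic_map (top_of_set S) (subtopology (subtopology riemann_sphere (range Some)) (Some ` S)) Some"
    by (rule homeomorphic_map_subtopologies) auto
  moreover have "range Some \<inter> Some ` S = Some ` S" by auto
  ultimately show ?thesis by (simp add: subtopology_subtopology)
qed

lemma continuous_map_the: "continuous_map (subtopology riemann_sphere (Some ` S)) (top_of_set S) the"
proof -
  obtain g where g: "homeomorphic_maps (top_of_set S) (subtopology riemann_sphere (Some ` S)) Some g"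
    using homeomorphic_map_Some homeomorphic_map_maps by blast
  then have "continuous_map (subtopology riemann_sphere (Some ` S)) (top_of_set S) g"
    by (simp add: homeomorphic_maps_def)
  moreover have "g x = the x" if "x \<in> Some ` S" for x
    using g that by (auto simp: homeomorphic_maps_def)
  ultimately show ?thesis
    by (auto intro: continuous_map_eq)
qed

lemma continuous_map_Some_riemann:
  assumes "Some ` S \<subseteq> T"
  shows "continuous_map (top_of_set S) (subtopology riemann_sphere T) Some"
  using continuous_map_Some[of "euclidean :: complex topology"] assms
  unfolding riemann_sphere_def
  by (auto simp: continuous_map_in_subtopology continuous_map_from_subtopology)

lemma openin_riemann_sphere_Some: "openin riemann_sphere (Some ` S) \<longleftrightarrow> open S"
  by (simp add: riemann_sphere_def flip: open_openin)

lemma connectedin_riemann_sphere_Some: 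
  assumes "connected S" shows "connectedin riemann_sphere (Some ` S)"
  using connectedin_continuous_map_image[OF continuous_map_Some[of euclidean], of S] assms
  by (simp add: riemann_sphere_def)

text \<open>This is the Jordan curve theorem of the plane carried to the sphere. Only infinity needs
  care: the complement of the outer region is compact, so adding infinity keeps the region open; the
  region is unbounded, so infinity lies in its closure and adding it keeps the region
  connected.\<close>

lemma components_in_sphere_compl:
  assumes p: "simple_path p" "pathfinish p = pathstart p"
  defines "S \<equiv> path_image p"
  shows "components_in_sphere (- (Some ` S)) = {Some ` inside S, insert None (Some ` outside S)}"
proof -
  have J: "inside S \<noteq> {}" "open (inside S)" "connected (inside S)" "open (outside S)"
      "connected (outside S)" "\<not> bounded (outside S)" "inside S \<inter> outside S = {}" "inside S \<union> outside S = - S"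
    using Jordan_inside_outside[OF p] by (auto simp: S_def)
  have bdd: "bounded (- outside S)"
    using cobounded_outside[of S] p by (simp add: S_def bounded_simple_path_image)
  have "openin riemann_sphere (insert None (Some ` outside S))"
    unfolding riemann_sphere_def openin_Alexandroff_compactification
    using J(4) bdd by (intro disjI2 exI[of _ "- outside S"]) (auto simp: compact_eq_bounded_closed closed_Compl)
  moreover have "connectedin riemann_sphere (insert None (Some ` outside S))"
  proof (rule connectedin_intermediate_closure_of)
    show "connectedin riemann_sphere (Some ` outside S)"
      by (rule connectedin_riemann_sphere_Some[OF J(5)])
    have "\<exists>y. y \<in> Some ` outside S \<and> y \<in> T" if T: "openin riemann_sphere T" "None \<in> T" for T
    proof -
      obtain C where C: "compact C" "T = insert None (Some ` (UNIV - C))"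
        using T unfolding riemann_sphere_def openin_Alexandroff_compactification by auto
      have "\<not> outside S \<subseteq> C"
        using J(6) C(1) bounded_subset compact_imp_bounded by blast
      then show ?thesis using C(2) by auto
    qed
    then have "None \<in> riemann_sphere closure_of (Some ` outside S)"
      by (auto simp: in_closure_of)
    then show "insert None (Some ` outside S) \<subseteq> riemann_sphere closure_of (Some ` outside S)"
      using closure_of_subset[of "Some ` outside S" riemann_sphere] by simp
  qed auto
  moreover have "openin riemann_sphere (Some ` inside S)" "connectedin riemann_sphere (Some ` inside S)"
    using J openin_riemann_sphere_Some connectedin_riemann_sphere_Some by auto
  moreover have eq: "\<Union>{Some ` inside S, insert None (Some ` outside S)} = - (Some ` S)"
  proof -
    have "a \<in> inside S \<or> a \<in> outside S \<longleftrightarrow> a \<notin> S" for a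
      using J(8) by blast
    then have "x \<in> \<Union>{Some ` inside S, insert None (Some ` outside S)} \<longleftrightarrow> x \<in> - (Some ` S)" for x
      by (cases x) auto
    then show ?thesis by blast
  qed
  ultimately show ?thesis
    unfolding components_in_sphere_def
  proof -
    let ?U = "Some ` inside S" and ?V = "insert None (Some ` outside S)"
    assume o: "openin riemann_sphere ?V" "connectedin riemann_sphere ?V"
      "openin riemann_sphere ?U" "connectedin riemann_sphere ?U" and eq: "\<Union>{?U, ?V} = - (Some ` S)"
    have sub: "?U \<subseteq> - (Some ` S)" "?V \<subseteq> - (Some ` S)"
      using eq by blast+
    show "connected_components_of (subtopology riemann_sphere (- (Some ` S))) = {?U, ?V}"
    proof (rule connected_components_of_eqI)
      show "\<Union>{?U, ?V} = topspace (subtopology riemann_sphere (- (Some ` S)))"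
        using eq by simp
      have "?U \<inter> ?V = {}" using J(7) unfolding disjoint_iff by auto
      then show "pairwise disjnt {?U, ?V}"
        by (auto simp: pairwise_def disjnt_def)
      fix W assume "W \<in> {?U, ?V}"
      then have "openin riemann_sphere W \<and> connectedin riemann_sphere W \<and> W \<noteq> {} \<and> W \<subseteq> - (Some ` S)"
        using o sub J(1) by auto
      then show "openin (subtopology riemann_sphere (- (Some ` S))) W \<and>
          connectedin (subtopology riemann_sphere (- (Some ` S))) W \<and> W \<noteq> {}"
        by (simp add: connectedin_subtopology openin_subtopology_Int2 Int_absorb1 openin_subtopology) blast
    qed
  qed
qed

section \<open>Loops on the unit interval versus maps on the circle\<close>

abbreviation circle_point :: "real \<Rightarrow> complex" where
  "circle_point t \<equiv> exp (2 * of_real pi * of_real t * \<i>)"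

text \<open>The loop is composed with the inverse of t -> exp(2 pi i t), with arguments in [0, 2
  pi). This is the form in which \<open>homotopic_loops_imp_homotopic_circlemaps\<close> turns a
  homotopy of loops into one of circle maps.\<close>

definition circle_param :: "(real \<Rightarrow> complex) \<Rightarrow> complex \<Rightarrow> complex" where
  "circle_param p = p \<circ> (\<lambda>z. Arg2pi z / (2 * pi))"

lemma Arg2pi_exp_circle: "0 \<le> t \<Longrightarrow> t < 1 \<Longrightarrow> Arg2pi (circle_point t) = 2 * pi * t"
  by (subst Arg2pi_exp) (auto)

lemma circle_eq_exp_Arg2pi: "z \<in> sphere 0 1 \<Longrightarrow> exp (\<i> * of_real (Arg2pi z)) = z"
  using Arg2pi_eq[of z] by simp

lemma jordan_param_circle_param:
  assumes p: "simple_path p" "pathfinish p = pathstart p"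
  shows "jordan_param (Some \<circ> circle_param p) (Some ` path_image p)"
proof -
  let ?q = "circle_param p"
  \<comment> \<open>\<open>Arg2pi\<close> jumps at the point 1 of the circle. Continuity across the
    jump is extracted from the constant homotopy of the closed path, transferred to the
    circle.\<close>
  have "homotopic_loops UNIV p p"
    using p simple_path_imp_path by (subst homotopic_loops_refl) auto
  then have "continuous_on (sphere 0 1) ?q"
    using homotopic_with_imp_continuous[OF homotopic_loops_imp_homotopic_circlemaps]
    unfolding circle_param_def by blast
  then have "continuous_map circle euclidean ?q"
    by simp
  moreover have "inj_on ?q (sphere 0 1)"
  proof (rule inj_onI)
    fix z w :: complex
    assume zw: "z \<in> sphere 0 1" "w \<in> sphere 0 1" "?q z = ?q w"
    let ?s = "Arg2pi z / (2 * pi)" and ?t = "Arg2pi w / (2 * pi)"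
    have st: "?s \<in> {0..1}" "?s < 1" "?t \<in> {0..1}" "?t < 1"
      using Arg2pi[of z] Arg2pi[of w] by auto
    have "p ?s = p ?t" using zw(3) by (simp add: circle_param_def)
    then have "?s = ?t \<or> ?s = 0 \<and> ?t = 1 \<or> ?s = 1 \<and> ?t = 0"
      using p(1) st(1,3) unfolding simple_path_def loop_free_def by blast
    then have "?s = ?t" using st by linarith
    then have "Arg2pi z = Arg2pi w" by simp
    then show "z = w"
      using circle_eq_exp_Arg2pi zw(1,2) by metis
  qed
  ultimately have "embedding_map circle euclidean ?q"
    by (intro continuous_imp_embedding_map) (auto simp: compact_space_subtopology)
  then have "embedding_map circle riemann_sphere (Some \<circ> ?q)"
    unfolding riemann_sphere_def by (rule embedding_map_compose[OF _ embedding_map_Some])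
  moreover have "?q ` sphere 0 1 = path_image p"
  proof
    show "?q ` sphere 0 1 \<subseteq> path_image p"
    proof clarify
      fix z :: complex
      have "Arg2pi z / (2 * pi) \<in> {0..1}" using Arg2pi[of z] by auto
      then show "?q z \<in> path_image p" by (simp add: circle_param_def path_image_def)
    qed
    show "path_image p \<subseteq> ?q ` sphere 0 1"
    proof
      fix x assume "x \<in> path_image p"
      then obtain u where u: "0 \<le> u" "u \<le> 1" "x = p u"
        by (auto simp: path_image_def)
      \<comment> \<open>The normalized argument lies in [0, 1), so the end parameter 1 is replaced
        by 0; the path is closed.\<close>
      define t where "t = (if u = 1 then 0 else u)"
      have t: "0 \<le> t" "t < 1" "x = p t"
        using u p(2) by (auto simp: t_def pathfinish_def pathstart_def)
      then have "?q (circle_point t) = x"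
        using Arg2pi_exp_circle[OF t(1,2)] by (simp add: circle_param_def)
      moreover have "circle_point t \<in> sphere 0 1"
        by (simp add: norm_exp_eq_Re)
      ultimately show "x \<in> ?q ` sphere 0 1" by blast
    qed
  qed
  ultimately show ?thesis
    unfolding jordan_param_def image_comp[symmetric] by simp
qed

lemma homotopic_rel_loops:
  assumes p: "simple_path p" "pathfinish p = pathstart p" and q: "simple_path q" "pathfinish q = pathstart q"
    and h: "homotopic_loops A p q" and A: "Some ` A \<inter> R = {}"
  shows "homotopic_rel R (Some ` path_image p) (Some ` path_image q)"
proof -
  have "homotopic_with (\<lambda>_. True) circle (top_of_set A) (circle_param p) (circle_param q)"
    using homotopic_loops_imp_homotopic_circlemaps[OF h] by (simp add: circle_param_def)
  then have "homotopic_with (\<lambda>_. True) circle (subtopology riemann_sphere (- R))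
      (Some \<circ> circle_param p) (Some \<circ> circle_param q)"
    using continuous_map_Some_riemann[of A "- R"] A
    by (auto intro: homotopic_with_compose_continuous_map_left)
  then show ?thesis
    unfolding homotopic_rel_def using jordan_param_circle_param p q by blast
qed

definition circle_loop :: "(complex \<Rightarrow> csphere) \<Rightarrow> real \<Rightarrow> complex" where
  "circle_loop g = (the \<circ> g) \<circ> exp \<circ> (\<lambda>t. 2 * of_real pi * of_real t * \<i>)"

lemma circle_loop_simple:
  assumes "jordan_param g (Some ` S)"
  shows "simple_path (circle_loop g)" "pathfinish (circle_loop g) = pathstart (circle_loop g)"
    "path_image (circle_loop g) = S"
proof -
  have emb: "embedding_map circle riemann_sphere g" and im: "g ` sphere 0 1 = Some ` S"
    using assms by (auto simp: jordan_param_def)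
  have cont: "continuous_on (sphere 0 1) (the \<circ> g)"
  proof -
    have "continuous_map circle (subtopology riemann_sphere (Some ` S)) g"
      using emb im by (auto simp: embedding_map_def dest: homeomorphic_imp_continuous_map)
    from continuous_map_compose[OF this continuous_map_the]
    show ?thesis by (simp add: continuous_map_in_subtopology)
  qed
  have inj: "inj_on (the \<circ> g) (sphere 0 1)"
  proof (rule inj_onI)
    fix z w assume zw: "z \<in> sphere 0 1" "w \<in> sphere 0 1" "(the \<circ> g) z = (the \<circ> g) w"
    then have "g z \<in> Some ` S" "g w \<in> Some ` S" using im by blast+
    with zw(3) have "g z = g w" by auto
    moreover have "inj_on g (sphere 0 1)"
      using emb homeomorphic_imp_injective_map unfolding embedding_map_def by fastforce
    ultimately show "z = w"
      using zw(1,2) by (auto dest: inj_onD)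
  qed
  have c1: "circle_point t \<in> sphere 0 1" for t
    by (simp add: norm_exp_eq_Re)
  have "continuous_on {0..1} (circle_loop g)"
    unfolding circle_loop_def
    by (intro continuous_on_compose continuous_intros continuous_on_subset[OF cont]) (use c1 in auto)
  then have path: "path (circle_loop g)" by (simp add: path_def)
  show fin: "pathfinish (circle_loop g) = pathstart (circle_loop g)"
    by (simp add: circle_loop_def pathfinish_def pathstart_def exp_two_pi_i')
  have less: "s = t" if "circle_loop g s = circle_loop g t" "0 \<le> s" "s < 1" "0 \<le> t" "t < 1" for s t
  proof -
    have "circle_point s = circle_point t"
      using that(1) inj_onD[OF inj _ c1 c1] by (simp add: circle_loop_def)
    then have "Arg2pi (circle_point s) = Arg2pi (circle_point t)"
      by simp
    then show ?thesis using that by (simp only: Arg2pi_exp_circle) simp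
  qed
  show "simple_path (circle_loop g)"
    unfolding simple_path_def loop_free_def
  proof (intro conjI path ballI impI)
    fix s t :: real assume st: "s \<in> {0..1}" "t \<in> {0..1}" "circle_loop g s = circle_loop g t"
    have 10: "circle_loop g 1 = circle_loop g 0" using fin by (simp add: pathfinish_def pathstart_def)
    consider "s < 1" "t < 1" | "s = 1" "t < 1" | "s < 1" "t = 1" | "s = 1" "t = 1" using st by fastforce
    then show "s = t \<or> s = 0 \<and> t = 1 \<or> s = 1 \<and> t = 0"
    proof cases
      case 2 then show ?thesis using less[of 0 t] st 10 by auto
    next
      case 3 then show ?thesis using less[of s 0] st 10 by auto
    qed (use less[of s t] st in auto)
  qed
  have "(\<lambda>t. circle_point t) ` {0..1::real} = sphere 0 1"
  proof
    show "(\<lambda>t. circle_point t) ` {0..1::real} \<subseteq> sphere 0 1" using c1 by auto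
    show "sphere 0 1 \<subseteq> (\<lambda>t. circle_point t) ` {0..1::real}"
    proof
      fix z :: complex assume "z \<in> sphere 0 1"
      then have "z = exp (2 * of_real pi * of_real (Arg2pi z / (2 * pi)) * \<i>)"
        using circle_eq_exp_Arg2pi[of z] by (simp add: mult.commute)
      moreover have "Arg2pi z / (2 * pi) \<in> {0..1}" using Arg2pi[of z] by auto
      ultimately show "z \<in> (\<lambda>t. circle_point t) ` {0..1::real}" by blast
    qed
  qed
  moreover have "circle_loop g = (the \<circ> g) \<circ> (\<lambda>t. circle_point t)"
    by (simp add: circle_loop_def comp_def)
  ultimately have "path_image (circle_loop g) = (the \<circ> g) ` sphere 0 1"
    by (simp only: path_image_def image_comp[symmetric])
  also have "\<dots> = the ` Some ` S" unfolding image_comp[symmetric] im ..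
  finally show "path_image (circle_loop g) = S" by (simp add: image_comp)
qed

text \<open>Since infinity belongs to the removed set, the homotopy stays in the finite plane and
  can be read off with \<open>the\<close>. The loops come from the parametrizations that the
  homotopy supplies, so only their images are prescribed.\<close>

lemma homotopic_rel_imp_loops:
  assumes "homotopic_rel (insert None (Some ` Q)) (Some ` S) (Some ` T)"
  obtains p q where "simple_path p" "pathfinish p = pathstart p" "path_image p = S"
    "simple_path q" "pathfinish q = pathstart q" "path_image q = T" "homotopic_loops (- Q) p q"
proof -
  obtain g h where gh: "jordan_param g (Some ` S)" "jordan_param h (Some ` T)"
    and hom: "homotopic_with (\<lambda>_. True) circle (subtopology riemann_sphere (- insert None (Some ` Q))) g h"
    using assms unfolding homotopic_rel_def by blast
  have "- insert None (Some ` Q) = Some ` (- Q)"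
  proof -
    have "x \<in> - insert None (Some ` Q) \<longleftrightarrow> x \<in> Some ` (- Q)" for x by (cases x) auto
    then show ?thesis by blast
  qed
  then have "homotopic_with (\<lambda>_. True) circle (top_of_set (- Q)) (the \<circ> g) (the \<circ> h)"
    using hom continuous_map_the[of "- Q"] by (auto intro: homotopic_with_compose_continuous_map_left)
  then have "homotopic_loops (- Q) (circle_loop g) (circle_loop h)"
    unfolding circle_loop_def by (rule homotopic_circlemaps_imp_homotopic_loops)
  then show ?thesis
    by (rule that[OF circle_loop_simple[OF gh(1)] circle_loop_simple[OF gh(2)]])
qed

section \<open>Coverings of a circle\<close>

lemma finite_separation:
  fixes A :: "'a::metric_space set"
  assumes "finite A"
  obtains d where "d > 0" "\<And>x y. x \<in> A \<Longrightarrow> y \<in> A \<Longrightarrow> x \<noteq> y \<Longrightarrow> d \<le> dist x y"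
proof -
  have "\<forall>a. \<exists>d>0. \<forall>x\<in>A. x \<noteq> a \<longrightarrow> d \<le> dist a x"
    using finite_set_avoid[OF assms] by blast
  then obtain e where e: "\<And>a. e a > 0" "\<And>a x. x \<in> A \<Longrightarrow> x \<noteq> a \<Longrightarrow> e a \<le> dist a x"
    by metis
  define d where "d = Min (insert 1 (e ` A))"
  have "d > 0" unfolding d_def using assms e(1) by (subst Min_gr_iff) auto
  moreover have "d \<le> dist x y" if "x \<in> A" "y \<in> A" "x \<noteq> y" for x y
  proof -
    have "d \<le> e x" unfolding d_def using assms that by (intro Min_le) auto
    then show ?thesis using e(2)[of y x] that by auto
  qed
  ultimately show ?thesis using that by blast
qed

text \<open>Constancy of the fibre cardinality takes the place of properness: the n local inverses
  at the points of one fibre already account for all n preimages of every nearby point of S.\<close>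

lemma covering_space_constant_fibre_card:
  fixes F :: "complex \<Rightarrow> complex"
  assumes M: "open M" "F holomorphic_on M"
    and d: "\<And>z. z \<in> M \<Longrightarrow> F z \<in> S \<Longrightarrow> deriv F z \<noteq> 0"
    and card: "\<And>y. y \<in> S \<Longrightarrow> card {x \<in> M. F x = y} = n" and n: "n > 0"
  shows "covering_space {z \<in> M. F z \<in> S} F S"
proof
  let ?K = "{z \<in> M. F z \<in> S}"
  show "continuous_on ?K F"
    by (rule continuous_on_subset[OF holomorphic_on_imp_continuous_on[OF M(2)]]) auto
  show "F ` ?K = S"
  proof
    show "S \<subseteq> F ` ?K"
    proof
      fix y assume y: "y \<in> S"
      then have "{x \<in> M. F x = y} \<noteq> {}" using card[OF y] n by (metis card.empty less_irrefl)
      then show "y \<in> F ` ?K" using y by blast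
    qed
  qed auto
  fix y assume y: "y \<in> S"
  define A where "A = {x \<in> M. F x = y}"
  have cA: "card A = n" using card[OF y] by (simp add: A_def)
  \<comment> \<open>An infinite set has \<open>card\<close> 0, so \<open>n > 0\<close> gives
    finiteness.\<close>
  then have fA: "finite A" using n card.infinite by force
  obtain e where e: "e > 0" "\<And>x y. x \<in> A \<Longrightarrow> y \<in> A \<Longrightarrow> x \<noteq> y \<Longrightarrow> e \<le> dist x y"
    using finite_separation[OF fA] by blast
  have "\<exists>r>0. r \<le> e / 2 \<and> ball a r \<subseteq> M \<and> inj_on F (ball a r)" if a: "a \<in> A" for a
  proof -
    have "deriv F a \<noteq> 0" "a \<in> M" using a d y by (auto simp: A_def)
    then obtain r where r: "r > 0" "ball a r \<subseteq> M" "inj_on F (ball a r)"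
      using has_complex_derivative_locally_injective[OF M(2) _ M(1)] by metis
    have "ball a (min r (e/2)) \<subseteq> ball a r" by auto
    then show ?thesis
      using r e(1) by (intro exI[of _ "min r (e/2)"]) (auto intro: inj_on_subset)
  qed
  then obtain r where r: "\<And>a. a \<in> A \<Longrightarrow> r a > 0 \<and> r a \<le> e / 2 \<and> ball a (r a) \<subseteq> M \<and> inj_on F (ball a (r a))"
    by metis
  define U where "U a = ball a (r a)" for a
  have U: "open (U a)" "a \<in> U a" "U a \<subseteq> M" "inj_on F (U a)" if "a \<in> A" for a
    using r[OF that] by (auto simp: U_def)
  have cont: "continuous_on (U a) F" if "a \<in> A" for a
    by (rule continuous_on_subset[OF holomorphic_on_imp_continuous_on[OF M(2)] U(3)[OF that]])
  have Udisj: "U a \<inter> U a' = {}" if "a \<in> A" "a' \<in> A" "a \<noteq> a'" for a a'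
  proof -
    have "r a + r a' \<le> dist a a'" using r[OF that(1)] r[OF that(2)] e(2)[OF that] by linarith
    then show ?thesis unfolding U_def by (rule disjoint_ballI)
  qed
  have FU: "open (F ` U a)" if "a \<in> A" for a
    by (rule invariance_of_domain[OF cont U(1) U(4)]) (use that in auto)
  define T0 where "T0 = (\<Inter>a\<in>A. F ` U a)"
  have T0: "open T0" "y \<in> T0"
    unfolding T0_def using FU fA U(2) by (auto simp: A_def intro!: open_INT)
  define T where "T = S \<inter> T0"
  define V where "V a = U a \<inter> F -` T" for a
  show "\<exists>T. y \<in> T \<and> openin (top_of_set S) T \<and>
          (\<exists>v. \<Union>v = ?K \<inter> F -` T \<and> (\<forall>u \<in> v. openin (top_of_set ?K) u) \<and>
               pairwise disjnt v \<and> (\<forall>u \<in> v. \<exists>q. homeomorphism u T F q))"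
  proof (intro exI[of _ T] exI[of _ "V ` A"] conjI ballI)
    show "y \<in> T" using y T0 by (simp add: T_def)
    show "openin (top_of_set S) T" unfolding T_def using T0 by (simp add: openin_open_Int)
    show "\<Union>(V ` A) = ?K \<inter> F -` T"
    proof
      show "\<Union>(V ` A) \<subseteq> ?K \<inter> F -` T" using U(3) by (auto simp: V_def T_def)
      show "?K \<inter> F -` T \<subseteq> \<Union>(V ` A)"
      proof
        fix z assume z: "z \<in> ?K \<inter> F -` T"
        then have "F z \<in> F ` U a" if "a \<in> A" for a using that by (auto simp: T_def T0_def)
        then have "\<forall>a\<in>A. \<exists>x\<in>U a. F x = F z" by (metis imageE)
        then obtain x where x: "\<And>a. a \<in> A \<Longrightarrow> x a \<in> U a \<and> F (x a) = F z" by metis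
        \<comment> \<open>The discs around the points of A are disjoint, so they contribute n
          distinct preimages of \<open>F z\<close>. The fibre has exactly n elements, hence z is one
          of them and lies in one of the discs.\<close>
        have "inj_on x A"
          using x Udisj by (metis IntI empty_iff inj_onI)
        then have "card (x ` A) = n" using cA by (simp add: card_image)
        moreover have "x ` A \<subseteq> {w \<in> M. F w = F z}" using x U(3) by blast
        moreover have "card {w \<in> M. F w = F z} = n" using z card by blast
        moreover have "finite {w \<in> M. F w = F z}"
          using calculation(3) n card.infinite by force
        ultimately have "x ` A = {w \<in> M. F w = F z}" by (intro card_subset_eq) auto
        then have "z \<in> x ` A" using z by blast
        then show "z \<in> \<Union>(V ` A)" using x z by (auto simp: V_def)
      qed
    qed
    show "pairwise disjnt (V ` A)"
      unfolding pairwise_def disjnt_def V_def using Udisj by blast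
  next
    fix W assume "W \<in> V ` A"
    then obtain a where a: "a \<in> A" "W = V a" by blast
    have "W = ?K \<inter> (U a \<inter> F -` T0)"
      using a U(3) by (auto simp: V_def T_def)
    moreover have "open (U a \<inter> F -` T0)"
      using continuous_open_preimage[OF cont U(1) T0(1)] a by simp
    ultimately show "openin (top_of_set ?K) W" by auto
    obtain g where g: "homeomorphism (U a) (F ` U a) F g"
      using invariance_of_domain_homeomorphism[OF U(1)[OF a(1)] cont[OF a(1)] _ U(4)[OF a(1)]] by auto
    have "homeomorphism W T F g"
    proof (rule homeomorphism_of_subsets[OF g])
      show "F ` W = T"
      proof
        show "T \<subseteq> F ` W"
        proof
          fix w assume w: "w \<in> T"
          then have "w \<in> F ` U a" using a(1) by (auto simp: T_def T0_def)
          then obtain x where "x \<in> U a" "w = F x" by blast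
          then show "w \<in> F ` W" using a(2) w by (auto simp: V_def)
        qed
      qed (use a in \<open>auto simp: V_def\<close>)
    qed (use a in \<open>auto simp: V_def T_def T0_def\<close>)
    then show "\<exists>q. homeomorphism W T F q" by blast
  qed
qed

section \<open>Lifts of the angular parametrization of a circle\<close>

locale circle_covering =
  fixes K :: "complex set" and F :: "complex \<Rightarrow> complex" and c u :: complex
  assumes u: "u \<noteq> 0" and cov: "covering_space K F (sphere c (norm u))"
    and fin: "finite {x \<in> K. F x = c + u}"
begin

text \<open>The complex radius u selects the base point c + u at angle 0. It will be chosen so that
  the base point is the only value on the circle that \<open>F\<close> takes on the real
  line.\<close>

definition beta :: "real \<Rightarrow> complex" where "beta t = c + u * cis t"

text \<open>Lifts live on the whole real line, the universal cover of the circle, so that components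
  become periodic functions and shifts by multiples of 2 pi act on the lifts.\<close>

definition lift :: "(real \<Rightarrow> complex) \<Rightarrow> bool" where
  "lift \<Gamma> \<longleftrightarrow> continuous_on UNIV \<Gamma> \<and> (\<forall>t. \<Gamma> t \<in> K \<and> F (\<Gamma> t) = beta t)"

lemma beta_eq_iff: "beta s = beta t \<longleftrightarrow> (\<exists>n::int. s = t + 2 * pi * n)"
proof -
  have "beta s = beta t \<longleftrightarrow> sin s = sin t \<and> cos s = cos t"
    using u by (auto simp: beta_def complex_eq_iff[of "cis s"])
  then show ?thesis by (simp add: sin_cos_eq_iff)
qed

lemma beta_shift: "beta (t + 2 * pi * of_int n) = beta t"
  using beta_eq_iff by blast

lemma continuous_on_beta: "continuous_on S beta"
  unfolding beta_def by (intro continuous_intros)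

lemma beta_in_sphere: "beta t \<in> sphere c (norm u)"
  by (simp add: beta_def dist_norm norm_mult)

lemma sphere_beta: "y \<in> sphere c (norm u) \<Longrightarrow> beta (Arg ((y - c) / u)) = y"
proof -
  assume "y \<in> sphere c (norm u)"
  then have "norm ((y - c) / u) = 1"
    using u by (simp add: norm_divide dist_norm norm_minus_commute)
  then have "cis (Arg ((y - c) / u)) = (y - c) / u"
    using complex_norm_eq_1_exp_eq by (simp add: cis_conv_exp)
  then show ?thesis using u by (simp add: beta_def)
qed

lemma lift_exists:
  assumes "x \<in> K" "F x = beta s"
  obtains \<Gamma> where "lift \<Gamma>" "\<Gamma> s = x"
proof -
  obtain g where g: "continuous_on UNIV g" "g \<in> UNIV \<rightarrow> K" "g s = x" "\<And>y. y \<in> UNIV \<Longrightarrow> F (g y) = beta y"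
    by (rule covering_space_lift_strong[OF cov, of x s UNIV beta])
       (use assms continuous_on_beta beta_in_sphere in
        \<open>auto simp: convex_imp_simply_connected convex_imp_locally_path_connected\<close>)
  show ?thesis
    using g by (intro that[of g]) (auto simp: lift_def)
qed

lemma lift_through:
  assumes "x \<in> K"
  obtains \<Gamma> s where "lift \<Gamma>" "\<Gamma> s = x"
proof -
  have "F x \<in> sphere c (norm u)"
    using assms covering_space_imp_surjective[OF cov] by blast
  then show ?thesis using lift_exists[OF assms] sphere_beta that by metis
qed

lemma lift_unique:
  assumes "lift \<Gamma>" "lift \<Delta>" "\<Gamma> s = \<Delta> s"
  shows "\<Gamma> t = \<Delta> t"
proof -
  have b: "beta \<in> UNIV \<rightarrow> sphere c (norm u)" using beta_in_sphere by blast
  have g: "\<Gamma> \<in> UNIV \<rightarrow> K" "continuous_on UNIV \<Gamma>" "\<And>x. beta x = F (\<Gamma> x)"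
    using assms(1) unfolding lift_def by (blast, blast, simp)
  have d: "\<Delta> \<in> UNIV \<rightarrow> K" "continuous_on UNIV \<Delta>" "\<And>x. beta x = F (\<Delta> x)"
    using assms(2) unfolding lift_def by (blast, blast, simp)
  show ?thesis
    by (rule covering_space_lift_unique[where ?g1.0 = \<Gamma> and ?g2.0 = \<Delta> and f = beta and T = UNIV and a = s and x = t,
        OF cov assms(3) continuous_on_beta b g(2,1,3) d(2,1,3) connected_UNIV UNIV_I UNIV_I])
qed

lemma lift_shift:
  assumes "lift \<Gamma>"
  shows "lift (\<lambda>t. \<Gamma> (t + 2 * pi * of_int n))"
proof -
  have g: "continuous_on UNIV \<Gamma>" "\<And>t. \<Gamma> t \<in> K" "\<And>t. F (\<Gamma> t) = beta t"
    using assms by (auto simp: lift_def)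
  have "continuous_on UNIV (\<lambda>t. t + 2 * pi * of_int n)"
    by (intro continuous_intros)
  then have "continuous_on UNIV (\<lambda>t. \<Gamma> (t + 2 * pi * of_int n))"
    by (rule continuous_on_compose2[OF g(1)]) simp
  then show ?thesis
    using g(2,3) by (simp add: lift_def beta_shift)
qed

text \<open>Equal values lie over the same point of the circle, so the parameters differ by a
  multiple of 2 pi; the shifted function is again a lift, and uniqueness of lifts does the
  rest.\<close>

lemma lift_meets_imp_shift:
  assumes "lift \<Gamma>" "lift \<Delta>" "\<Gamma> s = \<Delta> t"
  shows "\<exists>n::int. s = t + 2 * pi * n \<and> (\<forall>v. \<Delta> v = \<Gamma> (v + 2 * pi * n))"
proof -
  have "beta s = beta t" using assms by (metis lift_def)
  then obtain n :: int where n: "s = t + 2 * pi * n" using beta_eq_iff by blast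
  have "\<Delta> v = \<Gamma> (v + 2 * pi * n)" for v
    using lift_unique[OF assms(2) lift_shift[OF assms(1)], of t n v] assms(3) n by simp
  then show ?thesis using n by blast
qed

text \<open>The number of turns after which a lift closes up, which is the degree of the component
  over the circle.\<close>

definition period :: "(real \<Rightarrow> complex) \<Rightarrow> nat" where
  "period \<Gamma> = (LEAST k. k > 0 \<and> \<Gamma> (2 * pi * real k) = \<Gamma> 0)"

lemma period:
  assumes "lift \<Gamma>"
  shows "period \<Gamma> > 0" "\<Gamma> (2 * pi * period \<Gamma>) = \<Gamma> 0"
proof -
  \<comment> \<open>The values at multiples of 2 pi lie in the finite fibre over the base point, so
    two of them agree. By uniqueness of lifts the difference of the two indices is then a
    period.\<close>
  have "range (\<lambda>j::nat. \<Gamma> (2 * pi * j)) \<subseteq> {x \<in> K. F x = c + u}"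
    using assms beta_shift[of 0 "int _"] by (auto simp: lift_def beta_def)
  then have "finite (range (\<lambda>j::nat. \<Gamma> (2 * pi * j)))"
    using fin finite_subset by blast
  then have "\<not> inj (\<lambda>j::nat. \<Gamma> (2 * pi * j))"
    using finite_imageD infinite_UNIV_nat by blast
  then obtain i j :: nat where ij: "i < j" "\<Gamma> (2 * pi * i) = \<Gamma> (2 * pi * j)"
    unfolding inj_def by (metis linorder_neqE_nat)
  have "\<Gamma> (v + 2 * pi * of_int (int i)) = \<Gamma> (v + 2 * pi * of_int (int j))" for v
    using lift_unique[OF lift_shift[OF assms, of "int i"] lift_shift[OF assms, of "int j"], of 0 v] ij(2) by simp
  from this[of "- 2 * pi * i"] have "\<Gamma> 0 = \<Gamma> (2 * pi * real (j - i))"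
    using ij(1) by (simp add: of_nat_diff algebra_simps)
  then have "j - i > 0 \<and> \<Gamma> (2 * pi * real (j - i)) = \<Gamma> 0" using ij by simp
  then have "period \<Gamma> > 0 \<and> \<Gamma> (2 * pi * period \<Gamma>) = \<Gamma> 0"
    unfolding period_def by (rule LeastI)
  then show "period \<Gamma> > 0" "\<Gamma> (2 * pi * period \<Gamma>) = \<Gamma> 0" by auto
qed

lemma lift_periodic_nat:
  assumes "lift \<Gamma>"
  shows "\<Gamma> (t + 2 * pi * period \<Gamma> * real n) = \<Gamma> t"
proof (induction n arbitrary: t)
  case (Suc n)
  have "\<Gamma> (v + 2 * pi * of_int (int (period \<Gamma>))) = \<Gamma> v" for v
  proof (rule lift_unique[OF lift_shift[OF assms] assms])
    show "\<Gamma> (0 + 2 * pi * of_int (int (period \<Gamma>))) = \<Gamma> 0" using period[OF assms] by simp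
  qed
  from this[of "t + 2 * pi * period \<Gamma> * real n"] show ?case
    using Suc.IH[of t] by (simp add: algebra_simps)
qed simp

lemma lift_periodic:
  assumes "lift \<Gamma>"
  shows "\<Gamma> (t + 2 * pi * period \<Gamma> * of_int n) = \<Gamma> t"
proof (cases n rule: int_cases2)
  case (nonneg m)
  then show ?thesis using lift_periodic_nat[OF assms, of t m] by simp
next
  case (nonpos m)
  then show ?thesis using lift_periodic_nat[OF assms, of "t + 2 * pi * period \<Gamma> * of_int n" m] by simp
qed

lemma lift_residue:
  assumes "lift \<Gamma>"
  obtains j where "j < period \<Gamma>" "int j = n mod int (period \<Gamma>)" "\<And>t. \<Gamma> (t + 2 * pi * of_int n) = \<Gamma> (t + 2 * pi * real j)"
proof -
  let ?k = "int (period \<Gamma>)"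
  have k: "?k > 0" using period(1)[OF assms] by simp
  define j where "j = nat (n mod ?k)"
  have j: "int j = n mod ?k" "j < period \<Gamma>" using k by (auto simp: j_def nat_less_iff)
  have "n = ?k * (n div ?k) + int j" using j by simp
  then have "real_of_int n = real_of_int (?k * (n div ?k) + int j)" by simp
  then have "t + 2 * pi * of_int n = t + 2 * pi * real j + 2 * pi * period \<Gamma> * of_int (n div ?k)" for t
    by (simp add: algebra_simps)
  then have "\<Gamma> (t + 2 * pi * of_int n) = \<Gamma> (t + 2 * pi * real j)" for t
    by (simp only: lift_periodic[OF assms])
  then show ?thesis by (rule that[OF j(2,1)])
qed

lemma lift_eq_iff:
  assumes "lift \<Gamma>"
  shows "\<Gamma> s = \<Gamma> t \<longleftrightarrow> (\<exists>n::int. s = t + 2 * pi * period \<Gamma> * n)"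
proof
  assume "\<exists>n::int. s = t + 2 * pi * period \<Gamma> * n"
  then show "\<Gamma> s = \<Gamma> t" using lift_periodic[OF assms] by blast
next
  assume "\<Gamma> s = \<Gamma> t"
  then obtain n :: int where n: "s = t + 2 * pi * n" "\<And>v. \<Gamma> v = \<Gamma> (v + 2 * pi * n)"
    using lift_meets_imp_shift[OF assms assms] by blast
  obtain j where j: "j < period \<Gamma>" "int j = n mod int (period \<Gamma>)" "\<And>t. \<Gamma> (t + 2 * pi * of_int n) = \<Gamma> (t + 2 * pi * real j)"
    using lift_residue[OF assms] by blast
  have "\<Gamma> (2 * pi * real j) = \<Gamma> 0" using n(2)[of 0] j(3)[of 0] by simp
  \<comment> \<open>A positive residue below the period would contradict the minimality in the
    definition of \<open>period\<close>.\<close>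
  then have "j = 0"
    using not_less_Least[of j "\<lambda>k. k > 0 \<and> \<Gamma> (2 * pi * real k) = \<Gamma> 0"] j(1) unfolding period_def[symmetric] by auto
  then have "int (period \<Gamma>) dvd n" using j(2) by (simp add: dvd_eq_mod_eq_0)
  then obtain m where "n = int (period \<Gamma>) * m" by (elim dvdE)
  then show "\<exists>n::int. s = t + 2 * pi * period \<Gamma> * n"
    using n(1) by (intro exI[of _ m]) simp
qed

lemma lift_range_image: 
  assumes "lift \<Gamma>"
  shows "range \<Gamma> = \<Gamma> ` {a..a + 2 * pi * period \<Gamma>}"
proof
  show "range \<Gamma> \<subseteq> \<Gamma> ` {a..a + 2 * pi * period \<Gamma>}"
  proof clarify
    fix t
    let ?L = "2 * pi * period \<Gamma>"
    have L: "?L > 0" using period(1)[OF assms] by simp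
    define n where "n = \<lfloor>(t - a) / ?L\<rfloor>"
    have "of_int n \<le> (t - a) / ?L" "(t - a) / ?L < of_int n + 1"
      by (auto simp: n_def)
    then have "of_int n * ?L \<le> t - a" "t - a < (of_int n + 1) * ?L"
      using L by (simp_all only: pos_le_divide_eq pos_divide_less_eq)
    then have "t - ?L * of_int n \<in> {a..a + ?L}" by (auto simp: algebra_simps)
    moreover have "\<Gamma> t = \<Gamma> (t - ?L * of_int n)"
      using lift_periodic[OF assms, of "t - ?L * of_int n" n] by simp
    ultimately show "\<Gamma> t \<in> \<Gamma> ` {a..a + 2 * pi * period \<Gamma>}" by blast
  qed
qed auto

lemma lift_range_compact: "lift \<Gamma> \<Longrightarrow> compact (range \<Gamma>)"
  by (subst lift_range_image[of _ 0]) (auto intro!: compact_continuous_image simp: lift_def intro: continuous_on_subset)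

lemma lift_range_connected: "lift \<Gamma> \<Longrightarrow> connected (range \<Gamma>)"
  by (intro connected_continuous_image) (auto simp: lift_def)

lemma lift_ranges:
  assumes "lift \<Gamma>" "lift \<Delta>" "range \<Gamma> \<inter> range \<Delta> \<noteq> {}"
  shows "range \<Gamma> = range \<Delta>"
proof -
  obtain s t where "\<Gamma> s = \<Delta> t" using assms(3) by auto
  then obtain n :: int where n: "\<And>v. \<Delta> v = \<Gamma> (v + 2 * pi * n)"
    using lift_meets_imp_shift[OF assms(1,2)] by blast
  have "range \<Delta> = \<Gamma> ` range (\<lambda>v. v + 2 * pi * n)"
    by (simp only: image_image flip: n)
  moreover have "range (\<lambda>v. v + 2 * pi * n) = UNIV"
    by (rule surjI[of _ "\<lambda>v. v - 2 * pi * n"]) simp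
  ultimately show ?thesis by simp
qed

definition loop :: "(real \<Rightarrow> complex) \<Rightarrow> real \<Rightarrow> complex" where
  "loop \<Gamma> t = \<Gamma> (2 * pi * period \<Gamma> * t)"

lemma loop:
  assumes "lift \<Gamma>"
  shows "simple_path (loop \<Gamma>)" "pathfinish (loop \<Gamma>) = pathstart (loop \<Gamma>)" "path_image (loop \<Gamma>) = range \<Gamma>"
proof -
  have k: "real (period \<Gamma>) > 0" using period(1)[OF assms] by simp
  show "pathfinish (loop \<Gamma>) = pathstart (loop \<Gamma>)"
    using period(2)[OF assms] by (simp add: loop_def pathfinish_def pathstart_def)
  have "continuous_on {0..1} (loop \<Gamma>)"
  proof -
    have "continuous_on UNIV \<Gamma>" using assms by (simp add: lift_def)
    moreover have "continuous_on {0..1} (\<lambda>t. 2 * pi * period \<Gamma> * t)" by (intro continuous_intros)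
    ultimately show ?thesis
      unfolding loop_def[abs_def] by (rule continuous_on_compose2) simp
  qed
  moreover have "s = t \<or> s = 0 \<and> t = 1 \<or> s = 1 \<and> t = 0"
    if st: "s \<in> {0..1}" "t \<in> {0..1}" "loop \<Gamma> s = loop \<Gamma> t" for s t
  proof -
    obtain n :: int where "2 * pi * period \<Gamma> * s = 2 * pi * period \<Gamma> * t + 2 * pi * period \<Gamma> * n"
      using lift_eq_iff[OF assms] st(3) unfolding loop_def by blast
    then have "2 * pi * period \<Gamma> * s = 2 * pi * period \<Gamma> * (t + n)" by (simp add: algebra_simps)
    then have n: "s = t + n" using k by simp
    then have "-1 \<le> n" "n \<le> 1" using st(1,2) by auto
    then have "n = -1 \<or> n = 0 \<or> n = 1" by linarith
    then show ?thesis using n st(1,2) by auto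
  qed
  ultimately show "simple_path (loop \<Gamma>)"
    by (auto simp: simple_path_def loop_free_def path_def)
  have "path_image (loop \<Gamma>) = \<Gamma> ` (\<lambda>t. 2 * pi * period \<Gamma> * t) ` {0..1}"
    by (auto simp: path_image_def loop_def)
  also have "(\<lambda>t. 2 * pi * period \<Gamma> * t) ` {0..1} = {0..2 * pi * period \<Gamma>}"
    using k by (subst image_mult_atLeastAtMost) auto
  also have "\<Gamma> ` {0..2 * pi * period \<Gamma>} = range \<Gamma>"
    using lift_range_image[OF assms, of 0] by simp
  finally show "path_image (loop \<Gamma>) = range \<Gamma>" .
qed

text \<open>A lift is determined by its value at 0, which lies in the finite fibre over the base
  point.\<close>

lemma finite_ranges: "finite (range ` {\<Gamma>. lift \<Gamma>})"
proof -
  define G where "G x = (SOME \<Gamma>. lift \<Gamma> \<and> \<Gamma> 0 = x)" for x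
  have "range ` {\<Gamma>. lift \<Gamma>} \<subseteq> (\<lambda>x. range (G x)) ` {x \<in> K. F x = c + u}"
  proof clarify
    fix \<Gamma> assume \<Gamma>: "lift \<Gamma>"
    have G: "lift (G (\<Gamma> 0)) \<and> G (\<Gamma> 0) 0 = \<Gamma> 0"
      unfolding G_def by (rule someI[where x = \<Gamma>]) (simp add: \<Gamma>)
    have "G (\<Gamma> 0) = \<Gamma>"
      by (rule ext, rule lift_unique[OF conjunct1[OF G] \<Gamma> conjunct2[OF G]])
    moreover have "\<Gamma> 0 \<in> {x \<in> K. F x = c + u}" using \<Gamma> by (simp add: lift_def beta_def)
    ultimately show "range \<Gamma> \<in> (\<lambda>x. range (G x)) ` {x \<in> K. F x = c + u}"
      by (intro image_eqI[where x = "\<Gamma> 0"]) simp_all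
  qed
  then show ?thesis using fin finite_surj by blast
qed

lemma Union_ranges: "\<Union>(range ` {\<Gamma>. lift \<Gamma>}) = K"
proof
  show "K \<subseteq> \<Union>(range ` {\<Gamma>. lift \<Gamma>})"
  proof
    fix x assume "x \<in> K"
    then obtain \<Gamma> s where "lift \<Gamma>" "\<Gamma> s = x" using lift_through by blast
    then show "x \<in> \<Union>(range ` {\<Gamma>. lift \<Gamma>})" by blast
  qed
qed (auto simp: lift_def)

text \<open>The other components are finitely many compact sets, so their union is closed.\<close>

lemma range_openin:
  assumes "lift \<Gamma>"
  shows "openin (top_of_set K) (range \<Gamma>)"
proof -
  let ?R = "\<Union>(range ` {\<Gamma>. lift \<Gamma>} - {range \<Gamma>})"
  have "range \<Gamma> = K \<inter> - ?R"
  proof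
    show "range \<Gamma> \<subseteq> K \<inter> - ?R"
      using lift_ranges[OF assms] Union_ranges assms by blast
    show "K \<inter> - ?R \<subseteq> range \<Gamma>" using Union_ranges by blast
  qed
  moreover have "closed ?R"
    using finite_ranges lift_range_compact by (intro closed_Union) (auto intro: compact_imp_closed)
  ultimately show ?thesis by (auto simp: openin_open)
qed

text \<open>Identifies the period with a number of preimages, so that the periods of the components
  add up to the cardinality of the whole fibre over the base point.\<close>

lemma fibre_in_range:
  assumes "lift \<Gamma>"
  shows "{x \<in> range \<Gamma>. F x = c + u} = (\<lambda>j. \<Gamma> (2 * pi * real j)) ` {..<period \<Gamma>}"
    and "card {x \<in> range \<Gamma>. F x = c + u} = period \<Gamma>"
proof -
  let ?k = "int (period \<Gamma>)"
  have k: "?k > 0" using period(1)[OF assms] by simp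
  show eq: "{x \<in> range \<Gamma>. F x = c + u} = (\<lambda>j. \<Gamma> (2 * pi * real j)) ` {..<period \<Gamma>}"
  proof
    show "{x \<in> range \<Gamma>. F x = c + u} \<subseteq> (\<lambda>j. \<Gamma> (2 * pi * real j)) ` {..<period \<Gamma>}"
    proof clarify
      fix t assume "F (\<Gamma> t) = c + u"
      then have "beta t = beta 0" using assms by (simp add: lift_def) (simp add: beta_def)
      then obtain n :: int where n: "t = 2 * pi * n" using beta_eq_iff by auto
      obtain j where "j < period \<Gamma>" "\<And>t. \<Gamma> (t + 2 * pi * of_int n) = \<Gamma> (t + 2 * pi * real j)"
        using lift_residue[OF assms] by blast
      then have "j < period \<Gamma>" "\<Gamma> t = \<Gamma> (2 * pi * real j)" using n by (metis add_0)+
      then show "\<Gamma> t \<in> (\<lambda>j. \<Gamma> (2 * pi * real j)) ` {..<period \<Gamma>}" by blast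
    qed
    have "F (\<Gamma> (2 * pi * real j)) = c + u" for j
      using assms beta_shift[of 0 "int j"] by (simp add: lift_def beta_def)
    then show "(\<lambda>j. \<Gamma> (2 * pi * real j)) ` {..<period \<Gamma>} \<subseteq> {x \<in> range \<Gamma>. F x = c + u}" by auto
  qed
  have "inj_on (\<lambda>j. \<Gamma> (2 * pi * real j)) {..<period \<Gamma>}"
  proof (rule inj_onI)
    fix i j assume ij: "i \<in> {..<period \<Gamma>}" "j \<in> {..<period \<Gamma>}" "\<Gamma> (2 * pi * real i) = \<Gamma> (2 * pi * real j)"
    then obtain n :: int where "2 * pi * real i = 2 * pi * real j + 2 * pi * period \<Gamma> * n"
      using lift_eq_iff[OF assms] by blast
    then have "2 * pi * real i = 2 * pi * (real j + period \<Gamma> * of_int n)" by (simp add: algebra_simps)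
    then have "real i = real j + period \<Gamma> * of_int n" by simp
    then have "real_of_int (int i) = real_of_int (int j + ?k * n)" by simp
    then have n: "int i = int j + ?k * n" by (simp only: of_int_eq_iff)
    then have "int i mod ?k = int j mod ?k" by simp
    then show "i = j" using ij(1,2) by simp
  qed
  then show "card {x \<in> range \<Gamma>. F x = c + u} = period \<Gamma>"
    unfolding eq by (simp add: card_image)
qed

end

section \<open>Sheets of a component over an arc, and the covering degree\<close>

abbreviation sphere_sub :: "complex set \<Rightarrow> csphere topology" where
  "sphere_sub S \<equiv> subtopology riemann_sphere (Some ` S)"

context circle_covering
begin

text \<open>The circle minus the point opposite to \<open>beta t0\<close>; over this arc the
  covering splits into sheets.\<close>

abbreviation arc_at :: "real \<Rightarrow> complex set" where
  "arc_at t0 \<equiv> beta ` {t0 - pi<..<t0 + pi}"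

lemma components_in_sphere_K: "components_in_sphere (Some ` K) = (`) Some ` range ` {\<Gamma>. lift \<Gamma>}"
proof -
  have "connected_components_of (top_of_set K) = range ` {\<Gamma>. lift \<Gamma>}"
  proof (rule connected_components_of_eqI)
    show "\<Union>(range ` {\<Gamma>. lift \<Gamma>}) = topspace (top_of_set K)"
      using Union_ranges by simp
    show "pairwise disjnt (range ` {\<Gamma>. lift \<Gamma>})"
    proof (rule pairwiseI)
      fix U V assume "U \<in> range ` {\<Gamma>. lift \<Gamma>}" "V \<in> range ` {\<Gamma>. lift \<Gamma>}" "U \<noteq> V"
      then obtain \<Gamma> \<Delta> where "lift \<Gamma>" "U = range \<Gamma>" "lift \<Delta>" "V = range \<Delta>" by blast
      then show "disjnt U V" using lift_ranges[of \<Gamma> \<Delta>] \<open>U \<noteq> V\<close> unfolding disjnt_def by argo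
    qed
    fix U assume "U \<in> range ` {\<Gamma>. lift \<Gamma>}"
    then obtain \<Gamma> where \<Gamma>: "lift \<Gamma>" "U = range \<Gamma>" by blast
    then show "openin (top_of_set K) U \<and> connectedin (top_of_set K) U \<and> U \<noteq> {}"
      using range_openin[OF \<Gamma>(1)] lift_range_connected[OF \<Gamma>(1)]
      by (auto simp: connectedin_subtopology lift_def)
  qed
  then show ?thesis
    unfolding components_in_sphere_def homeomorphic_map_connected_components_of[OF homeomorphic_map_Some] by simp
qed

lemma beta_image:
  "arc_at t0 = sphere c (norm u) - {beta (t0 + pi)}"
proof
  have two_pi_pos: "0 < 2 * pi" by simp
  show "arc_at t0 \<subseteq> sphere c (norm u) - {beta (t0 + pi)}"
  proof (intro image_subsetI)
    fix t assume t: "t \<in> {t0 - pi<..<t0 + pi}"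
    have "beta t \<noteq> beta (t0 + pi)"
    proof
      assume "beta t = beta (t0 + pi)"
      then obtain n :: int where n: "t = t0 + pi + 2 * pi * n" using beta_eq_iff by blast
      then have "2 * pi * (-1) < 2 * pi * real_of_int n" "2 * pi * real_of_int n < 2 * pi * 0"
        using t by auto
      then have "-1 < real_of_int n" "real_of_int n < 0"
        by (simp_all only: mult_less_cancel_left_pos two_pi_pos)
      then have "-1 < n" "n < 0" by simp_all
      then show False by linarith
    qed
    then show "beta t \<in> sphere c (norm u) - {beta (t0 + pi)}" using beta_in_sphere by blast
  qed
  show "sphere c (norm u) - {beta (t0 + pi)} \<subseteq> arc_at t0"
  proof
    fix w assume w: "w \<in> sphere c (norm u) - {beta (t0 + pi)}"
    define x where "x = Arg ((w - c) / (u * cis t0))"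
    have "norm ((w - c) / (u * cis t0)) = 1"
      using w u by (simp add: norm_divide norm_mult dist_norm norm_minus_commute)
    then have "cis x = (w - c) / (u * cis t0)"
      using complex_norm_eq_1_exp_eq by (simp add: cis_conv_exp x_def)
    then have wb: "w = beta (t0 + x)"
      using u by (simp add: beta_def flip: cis_mult)
    moreover have "-pi < x" "x \<le> pi" using Arg_bounded[of "(w - c) / (u * cis t0)"] by (auto simp: x_def)
    moreover have "x \<noteq> pi" using w wb by auto
    ultimately show "w \<in> arc_at t0" using wb by (intro image_eqI[where x = "t0 + x"]) auto
  qed
qed

definition sheet :: "(real \<Rightarrow> complex) \<Rightarrow> real \<Rightarrow> nat \<Rightarrow> complex set" where
  "sheet \<Gamma> t0 j = \<Gamma> ` {t0 + 2 * pi * real j - pi<..<t0 + 2 * pi * real j + pi}"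

text \<open>The rest of the component is the image E of the compact remainder of one period, hence
  closed.\<close>

lemma sheet_openin:
  assumes "lift \<Gamma>"
  shows "openin (top_of_set (range \<Gamma>)) (sheet \<Gamma> t0 j)"
proof -
  define a where "a = t0 + 2 * pi * real j - pi"
  define L where "L = 2 * pi * period \<Gamma>"
  define E where "E = \<Gamma> ` {a + 2 * pi..a + L}"
  have L: "L > 0" using period(1)[OF assms] by (simp add: L_def)
  have sh: "sheet \<Gamma> t0 j = \<Gamma> ` {a<..<a + 2 * pi}"
    by (simp add: sheet_def a_def algebra_simps)
  have C: "range \<Gamma> = \<Gamma> ` {a..a + L}"
    using lift_range_image[OF assms, of a] by (simp add: L_def)
  have "2 * pi \<le> L"
  proof -
    have "1 \<le> real (period \<Gamma>)" using period(1)[OF assms] by simp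
    then show ?thesis unfolding L_def using mult_left_mono[of 1 "real (period \<Gamma>)" "2 * pi"] by simp
  qed
  \<comment> \<open>E also contains the point at which the open sheet begins, because the remainder
    ends at \<open>a + L\<close>. For period 1 the remainder consists of this point alone.\<close>
  have "\<Gamma> (a + L) = \<Gamma> a" using lift_periodic[OF assms, of a 1] by (simp add: L_def)
  then have "\<Gamma> a \<in> E" using \<open>2 * pi \<le> L\<close> unfolding E_def by (intro image_eqI[of _ _ "a + L"]) auto
  have "sheet \<Gamma> t0 j = range \<Gamma> \<inter> - E"
  proof
    show "sheet \<Gamma> t0 j \<subseteq> range \<Gamma> \<inter> - E"
    proof
      fix x assume "x \<in> sheet \<Gamma> t0 j"
      then obtain s where s: "a < s" "s < a + 2 * pi" "x = \<Gamma> s" by (auto simp: sh)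
      have "\<Gamma> s \<noteq> \<Gamma> t" if t: "t \<in> {a + 2 * pi..a + L}" for t
      proof
        assume "\<Gamma> s = \<Gamma> t"
        then obtain n :: int where "t = s + L * n" using lift_eq_iff[OF assms, of t s] unfolding L_def by auto
        then have d: "L * real_of_int n = t - s" by simp
        have "L * 0 < L * real_of_int n" "L * real_of_int n < L * 1" unfolding d using s t by auto
        then have "0 < real_of_int n" "real_of_int n < 1"
          using L by (simp_all only: mult_less_cancel_left_pos)
        then have "0 < n" "n < 1" by simp_all
        then show False by linarith
      qed
      then have "x \<notin> E" unfolding E_def s(3) by (metis imageE)
      then show "x \<in> range \<Gamma> \<inter> - E" unfolding s(3) by simp
    qed
    show "range \<Gamma> \<inter> - E \<subseteq> sheet \<Gamma> t0 j"
    proof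
      fix x assume x: "x \<in> range \<Gamma> \<inter> - E"
      then have "x \<in> \<Gamma> ` {a..a + L}" using C by simp
      then obtain s where s: "s \<in> {a..a + L}" "x = \<Gamma> s" by (rule imageE)
      have "s \<noteq> a" using s x \<open>\<Gamma> a \<in> E\<close> by auto
      moreover have "\<not> s \<ge> a + 2 * pi" using s x unfolding E_def by auto
      ultimately show "x \<in> sheet \<Gamma> t0 j" unfolding sh using s by auto
    qed
  qed
  moreover have "closed E"
    unfolding E_def using assms
    by (intro compact_imp_closed compact_continuous_image) (auto simp: lift_def intro: continuous_on_subset)
  ultimately show ?thesis by (auto simp: openin_open)
qed

lemma sheet_homeomorphic:
  assumes "lift \<Gamma>"
  shows "homeomorphic_map (top_of_set (sheet \<Gamma> t0 j)) (top_of_set (arc_at t0)) F"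
proof -
  \<comment> \<open>Dividing by \<open>u * cis t0\<close> turns the arc so that the cut of
    \<open>Arg\<close> falls on the deleted opposite point.\<close>
  define g where "g w = \<Gamma> (t0 + 2 * pi * real j + Arg ((w - c) / (u * cis t0)))" for w
  have arg: "Arg ((beta t - c) / (u * cis t0)) = t - t0" if "t \<in> {t0 - pi<..<t0 + pi}" for t
  proof -
    have "(beta t - c) / (u * cis t0) = cis (t - t0)" using u by (simp add: beta_def cis_divide)
    then show ?thesis using that by (simp add: Arg_cis)
  qed
  have contF: "continuous_on K F" using cov by (rule covering_space_imp_continuous)
  have sub: "sheet \<Gamma> t0 j \<subseteq> K" using assms by (auto simp: sheet_def lift_def)
  have bs: "beta (t + 2 * pi * real j) = beta t" for t using beta_shift[of t "int j"] by simp
  have c1: "continuous_on (arc_at t0) (\<lambda>w. (w - c) / (u * cis t0))"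
    by (intro continuous_intros) (simp add: u)
  have "continuous_on (arc_at t0) (\<lambda>w. Arg ((w - c) / (u * cis t0)))"
  proof (rule continuous_on_Arg'[OF c1])
    fix w assume "w \<in> arc_at t0"
    then obtain t where t: "t \<in> {t0 - pi<..<t0 + pi}" "w = beta t" by blast
    have "(w - c) / (u * cis t0) = cis (t - t0)" using u t by (simp add: beta_def cis_divide)
    moreover have "cis (t - t0) \<notin> \<real>\<^sub>\<le>\<^sub>0"
    proof
      assume "cis (t - t0) \<in> \<real>\<^sub>\<le>\<^sub>0"
      then have sc: "sin (t - t0) = 0" "cos (t - t0) \<le> 0" by (auto simp: complex_nonpos_Reals_iff)
      have "- pi < t - t0" "t - t0 < pi" using t(1) by auto
      then have "t - t0 = 0" using sc(1) by (rule sin_eq_0_pi)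
      with sc(2) show False by simp
    qed
    ultimately show "(w - c) / (u * cis t0) \<notin> \<real>\<^sub>\<le>\<^sub>0" by simp
  qed
  then have c2: "continuous_on (arc_at t0) (\<lambda>w. t0 + 2 * pi * real j + Arg ((w - c) / (u * cis t0)))"
    by (rule continuous_on_add[OF continuous_on_const])
  have "continuous_on UNIV \<Gamma>" using assms by (simp add: lift_def)
  from continuous_on_compose2[OF this c2] have contg: "continuous_on (arc_at t0) g"
    unfolding g_def[abs_def] by simp
  have gim: "g (beta t) = \<Gamma> (t + 2 * pi * real j)" if "t \<in> {t0 - pi<..<t0 + pi}" for t
    using arg[OF that] by (simp add: g_def add.commute)
  have "homeomorphic_maps (top_of_set (sheet \<Gamma> t0 j)) (top_of_set (arc_at t0)) F g"
    unfolding homeomorphic_maps_def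
  proof (intro conjI ballI)
    have shape: "\<exists>t \<in> {t0 - pi<..<t0 + pi}. x = \<Gamma> (t + 2 * pi * real j)" if "x \<in> sheet \<Gamma> t0 j" for x
    proof -
      obtain s where s: "s \<in> {t0 + 2 * pi * real j - pi<..<t0 + 2 * pi * real j + pi}" "x = \<Gamma> s"
        using \<open>x \<in> sheet \<Gamma> t0 j\<close> unfolding sheet_def by blast
      then show ?thesis by (intro bexI[of _ "s - 2 * pi * real j"]) auto
    qed
    have F\<Gamma>: "F (\<Gamma> (t + 2 * pi * real j)) = beta t" for t
      using assms bs by (simp add: lift_def)
    show "continuous_map (top_of_set (sheet \<Gamma> t0 j)) (top_of_set (arc_at t0)) F"
      using continuous_on_subset[OF contF sub] shape F\<Gamma> by fastforce
    show "continuous_map (top_of_set (arc_at t0)) (top_of_set (sheet \<Gamma> t0 j)) g"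
    proof -
      have "g (beta t) \<in> sheet \<Gamma> t0 j" if "t \<in> {t0 - pi<..<t0 + pi}" for t
        unfolding gim[OF that] sheet_def using that by (intro imageI) auto
      then show ?thesis using contg by auto
    qed
    show "g (F x) = x" if "x \<in> topspace (top_of_set (sheet \<Gamma> t0 j))" for x
    proof -
      have "x \<in> sheet \<Gamma> t0 j" using that by simp
      from shape[OF this] obtain t where "t \<in> {t0 - pi<..<t0 + pi}" "x = \<Gamma> (t + 2 * pi * real j)" by blast
      then show ?thesis using gim F\<Gamma> by simp
    qed
    show "F (g y) = y" if "y \<in> topspace (top_of_set (arc_at t0))" for y
    proof -
      have "y \<in> arc_at t0" using that by simp
      then obtain t where "t \<in> {t0 - pi<..<t0 + pi}" "y = beta t" by blast
      then show ?thesis using gim F\<Gamma> by simp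
    qed
  qed
  then show ?thesis using homeomorphic_map_maps by blast
qed

lemma Union_sheets:
  assumes "lift \<Gamma>"
  shows "(\<Union>j<period \<Gamma>. sheet \<Gamma> t0 j) = {x \<in> range \<Gamma>. F x \<in> arc_at t0}"
proof
  have bs: "beta (t + 2 * pi * real j) = beta t" for t j using beta_shift[of t "int j"] by simp
  show "(\<Union>j<period \<Gamma>. sheet \<Gamma> t0 j) \<subseteq> {x \<in> range \<Gamma>. F x \<in> arc_at t0}"
  proof
    fix x assume "x \<in> (\<Union>j<period \<Gamma>. sheet \<Gamma> t0 j)"
    then obtain j s where s: "s \<in> {t0 + 2 * pi * real j - pi<..<t0 + 2 * pi * real j + pi}" "x = \<Gamma> s"
      unfolding sheet_def by blast
    have "F x = beta (s - 2 * pi * real j)" using assms s bs[of "s - 2 * pi * real j" j] by (simp add: lift_def)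
    then show "x \<in> {x \<in> range \<Gamma>. F x \<in> arc_at t0}" using s by auto
  qed
  show "{x \<in> range \<Gamma>. F x \<in> arc_at t0} \<subseteq> (\<Union>j<period \<Gamma>. sheet \<Gamma> t0 j)"
  proof clarify
    fix s t assume t: "F (\<Gamma> s) = beta t" "t \<in> {t0 - pi<..<t0 + pi}"
    then have "beta s = beta t" using assms by (simp add: lift_def)
    then obtain n :: int where n: "s = t + 2 * pi * n" using beta_eq_iff by blast
    obtain j where j: "j < period \<Gamma>" "\<And>t. \<Gamma> (t + 2 * pi * of_int n) = \<Gamma> (t + 2 * pi * real j)"
      using lift_residue[OF assms] by blast
    then have "\<Gamma> s = \<Gamma> (t + 2 * pi * real j)" using n by simp
    moreover have "\<Gamma> (t + 2 * pi * real j) \<in> sheet \<Gamma> t0 j"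
      unfolding sheet_def using t(2) by (intro imageI) auto
    ultimately show "\<Gamma> s \<in> (\<Union>j<period \<Gamma>. sheet \<Gamma> t0 j)" using j by auto
  qed
qed

lemma sheets_disjoint:
  assumes "lift \<Gamma>" "i < period \<Gamma>" "j < period \<Gamma>" "i \<noteq> j"
  shows "sheet \<Gamma> t0 i \<inter> sheet \<Gamma> t0 j = {}"
proof (rule ccontr)
  assume "sheet \<Gamma> t0 i \<inter> sheet \<Gamma> t0 j \<noteq> {}"
  then obtain x where "x \<in> sheet \<Gamma> t0 i" "x \<in> sheet \<Gamma> t0 j" by blast
  then obtain s t where s: "s \<in> {t0 + 2 * pi * real i - pi<..<t0 + 2 * pi * real i + pi}"
    and t: "t \<in> {t0 + 2 * pi * real j - pi<..<t0 + 2 * pi * real j + pi}" and eq: "\<Gamma> s = \<Gamma> t"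
    unfolding sheet_def by blast
  obtain n :: int where n: "s = t + 2 * pi * period \<Gamma> * n" using lift_eq_iff[OF assms(1)] eq by blast
  \<comment> \<open>The two parameters, moved back by whole turns, both lie within pi of
    \<open>t0\<close>, so the integer m is strictly between -1 and 1.\<close>
  define m where "m = int (period \<Gamma>) * n + int j - int i"
  have "2 * pi * real_of_int m = (s - 2 * pi * real i) - (t - 2 * pi * real j)"
    by (simp add: m_def n algebra_simps)
  then have "2 * pi * real_of_int m < 2 * pi * 1" "2 * pi * (-1) < 2 * pi * real_of_int m"
    using s t by auto
  moreover have "0 < 2 * pi" by simp
  ultimately have "real_of_int m < 1" "-1 < real_of_int m"
    by (simp_all only: mult_less_cancel_left_pos)
  then have "m < 1" "-1 < m" by simp_all
  then have "m = 0" by linarith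
  then have "int i = int j + int (period \<Gamma>) * n" by (simp add: m_def)
  then have "int i mod int (period \<Gamma>) = int j mod int (period \<Gamma>)" by simp
  then show False using assms(2-4) by simp
qed

text \<open>The sheets over the arc around a given point form the evenly covered decomposition; it
  is carried to the sphere through \<open>Some\<close> and \<open>the\<close>.\<close>

lemma maps_onto_with_degree_range:
  assumes \<Gamma>: "lift \<Gamma>" and f: "\<And>z. z \<in> K \<Longrightarrow> f (Some z) = Some (F z)"
  shows "maps_onto_with_degree f (Some ` range \<Gamma>) (Some ` sphere c (norm u)) (period \<Gamma>)"
proof -
  let ?C = "range \<Gamma>" and ?B = "sphere c (norm u)"
  have CK: "?C \<subseteq> K" using \<Gamma> by (auto simp: lift_def)
  have transfer: "homeomorphic_map (sphere_sub S) (sphere_sub T) f"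
    if "homeomorphic_map (top_of_set S) (top_of_set T) F" "S \<subseteq> K" for S T
  proof -
    have "homeomorphic_map (sphere_sub S) (top_of_set S) the"
    proof -
      have "homeomorphic_maps (top_of_set S) (sphere_sub S) Some the"
        unfolding homeomorphic_maps_def
        using continuous_map_the[of S] continuous_map_Some_riemann[of S "Some ` S"] by auto
      then show ?thesis using homeomorphic_maps_map by blast
    qed
    then have "homeomorphic_map (sphere_sub S) (sphere_sub T) (Some \<circ> (F \<circ> the))"
      using that(1) homeomorphic_map_Some[of T] by (intro homeomorphic_map_compose)
    then show ?thesis
      by (rule homeomorphic_map_eq) (use f that(2) in auto)
  qed
  have FC: "F ` ?C = ?B"
  proof
    show "F ` ?C \<subseteq> ?B" using \<Gamma> beta_in_sphere by (auto simp: lift_def)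
    show "?B \<subseteq> F ` ?C"
    proof
      fix y assume "y \<in> ?B"
      then have "y = F (\<Gamma> (Arg ((y - c) / u)))" using sphere_beta \<Gamma> by (simp add: lift_def)
      then show "y \<in> F ` ?C" by blast
    qed
  qed
  have fC: "f ` Some ` ?C = Some ` ?B"
  proof -
    have "f ` Some ` ?C = Some ` F ` ?C"
      unfolding image_image using f CK by (intro image_cong) auto
    then show ?thesis using FC by simp
  qed
  show ?thesis
    unfolding maps_onto_with_degree_def covering_of_degree_def
  proof (intro conjI ballI)
    have "continuous_map (top_of_set ?C) (top_of_set ?B) F"
      using continuous_on_subset[OF covering_space_imp_continuous[OF cov] CK] FC by auto
    then have "continuous_map (sphere_sub ?C) (sphere_sub ?B) (Some \<circ> (F \<circ> the))"
      using continuous_map_the[of ?C] continuous_map_Some_riemann[of ?B "Some ` ?B"]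
      by (intro continuous_map_compose) auto
    then show "continuous_map (sphere_sub ?C) (sphere_sub ?B) f"
      by (rule continuous_map_eq) (use f CK in auto)
    show "f ` topspace (sphere_sub ?C) = topspace (sphere_sub ?B)"
      using fC by simp
    fix y assume "y \<in> topspace (sphere_sub ?B)"
    then obtain w where w: "w \<in> ?B" "y = Some w" by auto
    define t0 where "t0 = Arg ((w - c) / u)"
    have t0: "w = beta t0" using sphere_beta w(1) by (simp add: t0_def)
    let ?V = "arc_at t0"
    let ?U = "(\<lambda>j. Some ` sheet \<Gamma> t0 j) ` {..<period \<Gamma>}"
    have VB: "?V \<subseteq> ?B" using beta_in_sphere by auto
    show "\<exists>V \<U>. openin (sphere_sub ?B) V \<and> y \<in> V \<and>
        \<Union>\<U> = {x \<in> topspace (sphere_sub ?C). f x \<in> V} \<and> pairwise disjnt \<U> \<and>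
        finite \<U> \<and> card \<U> = period \<Gamma> \<and>
        (\<forall>U \<in> \<U>. openin (sphere_sub ?C) U \<and>
           homeomorphic_map (subtopology (sphere_sub ?C) U)
             (subtopology (sphere_sub ?B) V) f)"
    proof (intro exI[of _ "Some ` ?V"] exI[of _ ?U] conjI ballI)
      have "openin (top_of_set ?B) ?V"
        unfolding beta_image by (intro openin_delete) simp
      then show "openin (sphere_sub ?B) (Some ` ?V)"
        using homeomorphic_map_openness[OF homeomorphic_map_Some, of ?V ?B] VB by simp
      show "y \<in> Some ` ?V" using t0 w(2) pi_gt_zero by auto
      have "\<Union>?U = Some ` {x \<in> ?C. F x \<in> ?V}"
        unfolding Union_sheets[OF \<Gamma>, of t0, symmetric] image_UN ..
      also have "\<dots> = {x \<in> topspace (sphere_sub ?C). f x \<in> Some ` ?V}"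
        using f CK by auto
      finally show "\<Union>?U = {x \<in> topspace (sphere_sub ?C). f x \<in> Some ` ?V}" .
      have disj: "Some ` sheet \<Gamma> t0 i \<inter> Some ` sheet \<Gamma> t0 j = {}" if "i < period \<Gamma>" "j < period \<Gamma>" "i \<noteq> j" for i j
        using sheets_disjoint[OF \<Gamma> that, of t0] by auto
      show "pairwise disjnt ?U"
        unfolding pairwise_def disjnt_def using disj by auto
      show "finite ?U" by simp
      have "inj_on (\<lambda>j. Some ` sheet \<Gamma> t0 j) {..<period \<Gamma>}"
      proof (rule inj_onI)
        fix i j assume ij: "i \<in> {..<period \<Gamma>}" "j \<in> {..<period \<Gamma>}" "Some ` sheet \<Gamma> t0 i = Some ` sheet \<Gamma> t0 j"
        have "\<Gamma> (t0 + 2 * pi * real i) \<in> sheet \<Gamma> t0 i"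
          unfolding sheet_def using pi_gt_zero by (intro imageI) auto
        then have "Some ` sheet \<Gamma> t0 i \<inter> Some ` sheet \<Gamma> t0 j \<noteq> {}" using ij(3) by auto
        then show "i = j" using disj ij(1,2) by auto
      qed
      then show "card ?U = period \<Gamma>" by (simp add: card_image)
    next
      fix U assume "U \<in> ?U"
      then obtain j where j: "U = Some ` sheet \<Gamma> t0 j" by blast
      have sub: "sheet \<Gamma> t0 j \<subseteq> ?C" by (auto simp: sheet_def)
      show "openin (sphere_sub ?C) U"
        using homeomorphic_map_openness[OF homeomorphic_map_Some, of "sheet \<Gamma> t0 j" ?C] sub sheet_openin[OF \<Gamma>] j by simp
      have "homeomorphic_map (subtopology riemann_sphere U) (sphere_sub ?V) f"
        unfolding j by (rule transfer[OF sheet_homeomorphic[OF \<Gamma>]]) (use sub CK in auto)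
      moreover have "Some ` ?C \<inter> U = U" "Some ` ?B \<inter> Some ` ?V = Some ` ?V"
        using sub VB j by auto
      ultimately show "homeomorphic_map (subtopology (sphere_sub ?C) U)
             (subtopology (sphere_sub ?B) (Some ` ?V)) f"
        by (simp only: subtopology_subtopology)
    qed
  qed
qed

end

section \<open>The rational map\<close>

text \<open>\<open>identity\<close> makes 1 - F vanish to second order at the roots of z^2 + p z +
  q, \<open>disc\<close> keeps the other quadratic positive on the real line, and \<open>q2\<close>
  and \<open>p2\<close> say that these roots and their negatives are the zeros of the quartic factor
  in the derivative of F. \<open>q_neg\<close> makes the roots real.\<close>

locale pcf_map =
  fixes b C p q r s :: real
  assumes b_pos: "b > 0" and C_pos: "C > 0" and p_pos: "p > 0" and q_neg: "q < 0"
    and q2: "q\<^sup>2 = 3 * b" and p2: "p\<^sup>2 = 2 * q + 5 * b + 3" and disc: "r\<^sup>2 < 4 * s"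
    and identity: "\<And>z::complex. C * (z\<^sup>2 + b) ^ 3 - z ^ 3 * (1 - z\<^sup>2)
                     = C * (z\<^sup>2 + p * z + q)\<^sup>2 * (z\<^sup>2 + r * z + s)"

text \<open>Comparison of coefficients in \<open>identity\<close> determines everything from q:
  \<open>q2\<close> gives b, \<open>p2\<close> gives p, the constant term gives s = b^3 / q^2, the
  linear term gives r = - 2 p s / q, and the coefficient of z^5 gives C = 1 / (2 p + r). The
  coefficients of z^4, z^3 and z^2 then all follow from one cubic equation for q.\<close>

lemma pcf_map_exists: "\<exists>b C p q r s. pcf_map b C p q r s"
proof -
  \<comment> \<open>The cubic takes the values -27/25 at -6/5 and 4 at -1. On this interval q^2 <=
    36/25 and p^2 <= 17/5, so p^2 q^2 is far below 27, which is the inequality behind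
    \<open>disc\<close>.\<close>
  have "\<exists>q::real. -6/5 \<le> q \<and> q \<le> -1 \<and> 5 * q^3 + 9 * q^2 + 27 * q + 27 = 0"
    by (rule IVT') (auto intro!: continuous_intros simp: power3_eq_cube power2_eq_square)
  then obtain q :: real where q: "-6/5 \<le> q" "q \<le> -1" and eq: "5 * q^3 + 9 * q^2 + 27 * q + 27 = 0"
    by blast
  define b where "b = q\<^sup>2 / 3"
  define p where "p = sqrt (2 * q + 5 * b + 3)"
  define s where "s = q ^ 4 / 27"
  define r where "r = - 2 * p * q ^ 3 / 27"
  define C where "C = 1 / (2 * p + r)"
  have q2: "1 \<le> q\<^sup>2" "q\<^sup>2 \<le> 36/25"
    using power_mono[of 1 "-q" 2] power_mono[of "-q" "6/5" 2] q by (auto simp: power_divide)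
  have q3: "1 \<le> - (q ^ 3)"
    using power_mono[of 1 "-q" 3] q by auto
  have p_sq: "p\<^sup>2 = 2 * q + 5 * b + 3" and p_pos: "p > 0"
    using q q2 by (auto simp: p_def b_def)
  have p_le: "p\<^sup>2 \<le> 17/5"
    using q q2 by (simp add: p_sq b_def)
  have r_pos: "r > 0"
    using mult_pos_pos[OF p_pos, of "- (q ^ 3)"] q3 q by (simp add: r_def)
  have C_pos: "C > 0" and C: "C * (2 * p + r) = 1"
    using p_pos r_pos by (auto simp: C_def)
  have "s > 0" using q by (simp add: s_def)
  have r2: "r\<^sup>2 = 4 * s * (p\<^sup>2 * q\<^sup>2 / 27)"
    by (simp add: r_def s_def power_mult_distrib power_divide power2_eq_square) algebra
  have "p\<^sup>2 * q\<^sup>2 \<le> 17/5 * (36/25)"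
    by (intro mult_mono p_le q2) auto
  then have disc: "r\<^sup>2 < 4 * s"
    unfolding r2 using \<open>s > 0\<close> by simp
  have c4: "3 * b = p\<^sup>2 + 2 * q + 2 * p * r + s"
  proof -
    have "2 * p * r = (- 4) * p\<^sup>2 * q^3/27" by (simp add: r_def power2_eq_square)
    then show ?thesis
      unfolding p_sq b_def s_def using eq by (simp add: field_simps) algebra
  qed
  have c3: "- 1 = C * (2 * p * q + r * (p\<^sup>2 + 2 * q) + 2 * p * s)"
  proof -
    have "2 * p * q + r * (p\<^sup>2 + 2 * q) + 2 * p * s = 2 * p * (q - q^3/27 * (p\<^sup>2 + 2 * q) + s)"
      by (simp add: r_def field_simps)
    also have "q - q^3/27 * (p\<^sup>2 + 2 * q) + s = - (1 - (q ^ 3) / 27)"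
      unfolding p_sq b_def s_def using eq by (simp add: field_simps) algebra
    also have "2 * p * (- (1 - q ^ 3 / 27)) = - (2 * p + r)"
      by (simp add: r_def field_simps)
    finally show ?thesis using C by algebra
  qed
  have c2: "3 * b\<^sup>2 = q\<^sup>2 + 2 * p * q * r + s * (p\<^sup>2 + 2 * q)"
  proof -
    have "2 * p * q * r = (- 4) * p\<^sup>2 * q^4/27" by (simp add: r_def power2_eq_square) algebra
    then show ?thesis
      unfolding p_sq b_def s_def using eq by (simp add: field_simps power2_eq_square) algebra
  qed
  have c1: "q\<^sup>2 * r + 2 * p * q * s = 0"
    unfolding r_def s_def by (simp add: field_simps) algebra
  have c0: "b ^ 3 = q\<^sup>2 * s"
    unfolding b_def s_def by (simp add: field_simps)
  have "C * (z\<^sup>2 + b) ^ 3 - z ^ 3 * (1 - z\<^sup>2) = C * (z\<^sup>2 + p * z + q)\<^sup>2 * (z\<^sup>2 + r * z + s)"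
    for z :: complex
  proof -
    have C': "of_real C * (2 * of_real p + of_real r) = (1::complex)"
      using arg_cong[OF C, of complex_of_real] by simp
    have c4': "3 * complex_of_real b = of_real p ^ 2 + 2 * of_real q + 2 * of_real p * of_real r + of_real s"
      using arg_cong[OF c4, of complex_of_real] by simp
    have c3': "- 1 = complex_of_real C * (2 * of_real p * of_real q + of_real r * (of_real p ^ 2 + 2 * of_real q) + 2 * of_real p * of_real s)"
      using arg_cong[OF c3, of complex_of_real] by simp
    have c2': "3 * complex_of_real b ^ 2 = of_real q ^ 2 + 2 * of_real p * of_real q * of_real r + of_real s * (of_real p ^ 2 + 2 * of_real q)"
      using arg_cong[OF c2, of complex_of_real] by simp
    have c1': "complex_of_real q ^ 2 * of_real r + 2 * of_real p * of_real q * of_real s = 0"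
      using arg_cong[OF c1, of complex_of_real] by simp
    have c0': "complex_of_real b ^ 3 = of_real q ^ 2 * of_real s"
      using arg_cong[OF c0, of complex_of_real] by simp
    have "C * (z\<^sup>2 + b) ^ 3 = C * z^6 + C * (3 * complex_of_real b) * z^4 + C * (3 * complex_of_real b ^ 2) * z^2 + C * complex_of_real b ^ 3"
      by algebra
    also have "\<dots> = C * (z\<^sup>2 + p * z + q)\<^sup>2 * (z\<^sup>2 + r * z + s)
        - (complex_of_real C * (2 * of_real p + of_real r)) * z^5
        - (complex_of_real C * (2 * of_real p * of_real q + of_real r * (of_real p ^ 2 + 2 * of_real q) + 2 * of_real p * of_real s)) * z ^ 3
        - C * (complex_of_real q ^ 2 * of_real r + 2 * of_real p * of_real q * of_real s) * z"
      unfolding c4' c2' c0' by algebra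
    also have "\<dots> = C * (z\<^sup>2 + p * z + q)\<^sup>2 * (z\<^sup>2 + r * z + s) - z ^ 5 + z ^ 3"
      unfolding C' c3'[symmetric] c1' by simp
    finally show ?thesis by algebra
  qed
  then have "pcf_map b C p q r s"
    using q q2 p_pos p_sq C_pos disc
    by unfold_locales (simp_all add: b_def)
  then show ?thesis by blast
qed

section \<open>The map, its coefficients and its derivative\<close>

context pcf_map
begin

definition F :: "complex \<Rightarrow> complex" where
  "F z = z ^ 3 * (1 - z\<^sup>2) / (of_real C * (z\<^sup>2 + of_real b) ^ 3)"

definition num :: "complex poly" where "num = [:0, 0, 0, 1, 0, -1:]"

definition den :: "complex poly" where "den = smult (of_real C) ([:of_real b, 0, 1:] ^ 3)"

definition f :: "csphere \<Rightarrow> csphere" where "f = ratfun num den"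

lemma poly_num: "poly num z = z ^ 3 * (1 - z\<^sup>2)" for z :: complex
  by (simp add: num_def power2_eq_square power3_eq_cube algebra_simps)

lemma poly_den: "poly den z = C * (z\<^sup>2 + b) ^ 3" for z :: complex
  by (simp add: den_def power2_eq_square algebra_simps)

lemma poly_den_eq_0_iff: "poly den z = 0 \<longleftrightarrow> z\<^sup>2 + b = 0" for z :: complex
  using C_pos by (simp add: poly_den)

lemma degree_num: "degree num = 5"
  by (simp add: num_def)

lemma degree_den: "degree den = 6"
  using C_pos by (simp add: den_def degree_power_eq)

lemma coeff_den_6: "coeff den 6 = of_real C"
  using lead_coeff_power[of "[:of_real b, 0, 1:] :: complex poly" 3]
  by (simp add: den_def degree_power_eq)

lemma f_None: "f None = Some 0"
proof -
  have "coeff num 6 = 0" by (simp add: coeff_eq_0 degree_num)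
  then show ?thesis
    using C_pos by (simp add: f_def ratfun_def degree_num degree_den coeff_den_6 Let_def)
qed

lemma f_Some: "f (Some z) = (if z\<^sup>2 + b = 0 then None else Some (F z))" for z :: complex
  using C_pos by (auto simp: f_def ratfun_def poly_den_eq_0_iff F_def poly_num poly_den)

lemma no_common_root:
  fixes z :: complex
  assumes "z ^ 3 * (1 - z\<^sup>2) = 0"
  shows "z\<^sup>2 + b \<noteq> 0"
proof -
  have "z = 0 \<or> z\<^sup>2 = 1" using assms by auto
  then have "z\<^sup>2 + b = of_real b \<or> z\<^sup>2 + b = of_real (1 + b)" by auto
  then show ?thesis using b_pos by (auto simp del: of_real_add)
qed

lemma coprime_num_den: "coprime num den"
proof (rule ccontr)
  assume "\<not> coprime num den"
  then obtain d where d: "d dvd num" "d dvd den" "\<not> is_unit d"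
    by (meson not_coprimeE)
  have "num \<noteq> 0" by (simp add: num_def)
  with d have "degree d \<noteq> 0"
    using is_unit_iff_degree by (metis dvd_0_left_iff)
  then obtain z where "poly d z = 0"
    using fundamental_theorem_of_algebra[of d] constant_degree[of d] by auto
  then have "poly num z = 0" "poly den z = 0"
    using d(1,2) by (metis dvdE mult_zero_left poly_mult)+
  then show False
    using no_common_root poly_den_eq_0_iff poly_num by metis
qed

lemma coeff_num_den_Reals: "(\<forall>n. coeff num n \<in> \<real>) \<and> (\<forall>n. coeff den n \<in> \<real>)"
proof
  show "\<forall>n. coeff num n \<in> \<real>"
    by (auto simp: num_def coeff_pCons split: nat.split)
  have "den = [:of_real (C * b ^ 3), 0, of_real (3 * C * b\<^sup>2), 0, of_real (3 * C * b), 0, of_real C:]"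
    by (simp add: den_def power3_eq_cube power2_eq_square)
  then show "\<forall>n. coeff den n \<in> \<real>"
    by (auto simp: coeff_pCons simp del: of_real_mult of_real_power split: nat.split)
qed

lemma real_rational_map_f: "real_rational_map 6 f"
  unfolding real_rational_map_def
  using coprime_num_den degree_num degree_den coeff_num_den_Reals f_def
  by (intro exI[of _ num] exI[of _ den]) auto

lemma F_minus: "F (- z) = - F z"
  by (simp add: F_def)

lemma F_cnj: "F (cnj z) = cnj (F z)"
  by (simp add: F_def)

lemma one_minus_F:
  fixes z :: complex
  assumes "z\<^sup>2 + b \<noteq> 0"
  shows "F z = 1 - C * (z\<^sup>2 + p * z + q)\<^sup>2 * (z\<^sup>2 + r * z + s) / (C * (z\<^sup>2 + b) ^ 3)"
  using assms C_pos identity[of z] by (simp add: F_def field_simps)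

text \<open>Up to the denominator the derivative is z^2 times the even quartic z^4 - (5 b + 3) z^2 +
  3 b, and \<open>p2\<close> and \<open>q2\<close> are the conditions under which it splits into the
  two quadratics.\<close>

lemma DERIV_F:
  fixes z :: complex
  assumes "z\<^sup>2 + b \<noteq> 0"
  shows "(F has_field_derivative z\<^sup>2 * (z\<^sup>2 + p * z + q) * (z\<^sup>2 - p * z + q) / (C * (z\<^sup>2 + b) ^ 4)) (at z)"
proof -
  have p2': "complex_of_real p ^ 2 = 2 * q + 5 * b + 3" and q2': "complex_of_real q ^ 2 = 3 * b"
    using p2 q2 by (metis of_real_power)+
  then have p2'': "complex_of_real p ^ 2 = 2 * of_real q + 5 * of_real b + 3" and q2'': "complex_of_real q ^ 2 = 3 * of_real b"
    by simp_all
  have *: "(z\<^sup>2 + p * z + q) * (z\<^sup>2 - p * z + q) = z ^ 4 - (5 * b + 3) * z\<^sup>2 + 3 * b"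
    using p2'' q2'' unfolding of_real_add of_real_mult of_real_numeral by algebra
  show ?thesis
    unfolding F_def mult.assoc *
    apply (rule derivative_eq_intros refl | use assms C_pos in simp; fail)+
    using assms C_pos
    apply (simp add: divide_simps)
    apply algebra
    done
qed

end

section \<open>Critical points and orbifold\<close>

lemma square_eq_pos_real_imp_real:
  fixes w :: complex
  assumes "w\<^sup>2 = of_real a" "a > 0"
  shows "Im w = 0" "w \<noteq> 0"
proof -
  have "Re w * Im w = 0" "(Re w)\<^sup>2 - (Im w)\<^sup>2 = a"
    using assms by (auto simp: complex_eq_iff power2_eq_square)
  then show "Im w = 0"
    using assms(2) by (cases "Re w = 0") (auto simp: not_less[symmetric])
  show "w \<noteq> 0" using assms by auto
qed

lemma has_local_degree_id: "has_local_degree id z 1"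
  unfolding has_local_degree_def by (intro conjI exI[of _ "\<lambda>_. 1"]) auto

text \<open>The unit factor is the difference quotient, with its removable singularity at x filled
  by the derivative.\<close>

lemma has_local_degree_simple:
  assumes S: "open S" "g holomorphic_on S" "x \<in> S" and d: "(g has_field_derivative d) (at x)" "d \<noteq> 0"
    and f: "f (Some x) = Some (g x)" "\<forall>\<^sub>F w in nhds x. f (Some w) = Some (g w)"
  shows "has_local_degree f (Some x) 1"
proof (rule has_local_degree_finite[where f = f and x = x and y = "g x" and n = 1 and h = "\<lambda>w. if w = x then deriv g x else (g w - g x) / (w - x)"])
  show "(\<lambda>w. if w = x then deriv g x else (g w - g x) / (w - x)) analytic_on {x}"
    using pole_lemma[OF S(2), of x] S interior_open unfolding analytic_at by blast
  show "\<forall>\<^sub>F w in nhds x. f (Some w) = Some (g x + (w - x) ^ 1 * (if w = x then deriv g x else (g w - g x) / (w - x)))"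
    using f(2) by eventually_elim auto
qed (use d f DERIV_imp_deriv in auto)

context pcf_map
begin

definition P :: "csphere set" where "P = {Some 0, Some 1, Some (-1), None}"

lemma discr_pos: "p\<^sup>2 - 4 * q > 0"
  using q_neg by (smt (verit) zero_le_power2)

lemma rs_pos: "x\<^sup>2 + r * x + s > 0" for x :: real
proof -
  have "x\<^sup>2 + r * x + s = (x + r / 2)\<^sup>2 + (4 * s - r\<^sup>2) / 4"
    by (simp add: power2_eq_square field_simps)
  then show ?thesis using disc by (smt (verit) zero_le_power2 divide_pos_pos)
qed

text \<open>Completing the square gives (2 z + e p)^2 = p^2 - 4 q, which is positive because q < 0.
  Hence these critical points are real and each quadratic has distinct roots.\<close>

lemma Im_critical_eq_0:
  fixes z :: complex
  assumes "e \<in> {1, -1::real}" "z\<^sup>2 + e * p * z + q = 0"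
  shows "Im z = 0" "2 * z + e * p \<noteq> 0"
proof -
  have e2: "complex_of_real e ^ 2 = 1" using assms(1) by auto
  have "(2 * z + e * p)\<^sup>2 = of_real (p\<^sup>2 - 4 * q)"
    using assms(2) e2 unfolding of_real_diff of_real_mult of_real_power of_real_numeral by algebra
  from square_eq_pos_real_imp_real[OF this discr_pos]
  show "Im z = 0" "2 * z + e * p \<noteq> 0" by auto
qed

lemma real_not_pole: "Im z = 0 \<Longrightarrow> z\<^sup>2 + b \<noteq> 0" for z :: complex
proof -
  assume "Im z = 0"
  then have "z\<^sup>2 + b = of_real ((Re z)\<^sup>2 + b)"
    by (simp add: complex_eq_iff power2_eq_square)
  moreover have "(Re z)\<^sup>2 + b > 0"
    using b_pos by (smt (verit) zero_le_power2)
  ultimately show ?thesis by (metis of_real_eq_0_iff less_irrefl)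
qed

text \<open>The sign e is the critical value. The case -1 is the case 1 at -z, as \<open>F\<close>
  is odd.\<close>

lemma F_eq_sign:
  fixes z :: complex
  assumes "e \<in> {1, -1::real}" "z\<^sup>2 + b \<noteq> 0"
  shows "F z = e - e * (z\<^sup>2 + e * p * z + q)\<^sup>2 * (z\<^sup>2 + e * r * z + s) / (z\<^sup>2 + b) ^ 3"
  using assms(1)
proof (elim insertE emptyE)
  assume "e = 1"
  then show ?thesis
    using one_minus_F[OF assms(2)] C_pos by simp
next
  assume "e = -1"
  then show ?thesis
    using one_minus_F[of "- z"] assms(2) C_pos by (simp add: F_minus minus_equation_iff[of "F z"])
qed

lemma eventually_not_pole: "z\<^sup>2 + b \<noteq> 0 \<Longrightarrow> \<forall>\<^sub>F w in nhds z. w\<^sup>2 + b \<noteq> 0" for z :: complex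
  by (rule tendsto_imp_eventually_ne[where c = "z\<^sup>2 + b"]) (auto intro!: tendsto_eq_intros filterlim_ident)

lemma eventually_f_Some: 
  fixes z :: complex
  assumes "z\<^sup>2 + b \<noteq> 0"
  shows "\<forall>\<^sub>F w in nhds z. f (Some w) = Some (F w)"
  using eventually_not_pole[OF assms] by eventually_elim (simp add: f_Some)

lemma open_not_pole: "open {z::complex. z\<^sup>2 + b \<noteq> 0}"
  by (intro open_Collect_neq continuous_intros)

lemma F_holomorphic: "F holomorphic_on {z. z\<^sup>2 + b \<noteq> 0}"
  unfolding F_def using C_pos by (intro holomorphic_intros) auto

lemma local_degree_zero: "has_local_degree f (Some 0) 3"
proof (rule has_local_degree_finite[where f = f and x = 0 and n = 3 and y = 0 and h = "\<lambda>w::complex. (1 - w\<^sup>2) / (C * (w\<^sup>2 + b) ^ 3)"])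
  show "\<forall>\<^sub>F w::complex in nhds 0. f (Some w) = Some (0 + (w - 0) ^ 3 * ((1 - w\<^sup>2) / (C * (w\<^sup>2 + b) ^ 3)))"
    using eventually_f_Some[of 0] b_pos by (auto simp: F_def elim: eventually_mono)
qed (use b_pos C_pos in \<open>auto intro!: analytic_intros simp: f_Some F_def\<close>)

lemma local_degree_critical:
  fixes z :: complex
  assumes e: "e \<in> {1, -1::real}" and z: "z\<^sup>2 + e * p * z + q = 0"
  shows "has_local_degree f (Some z) 2" "f (Some z) = Some (of_real e)"
proof -
  let ?h = "\<lambda>w::complex. - e * (w + z + e * p)\<^sup>2 * (w\<^sup>2 + e * r * w + s) / (w\<^sup>2 + b) ^ 3"
  have np: "z\<^sup>2 + b \<noteq> 0"
    using Im_critical_eq_0[OF assms] real_not_pole by blast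
  show val: "f (Some z) = Some (of_real e)"
    using F_eq_sign[OF e np] z np by (simp add: f_Some)
  \<comment> \<open>The second root is - z - e p, so the cofactor does not vanish at z and the
    square of the quadratic contributes order exactly 2.\<close>
  have fac: "w\<^sup>2 + e * p * w + q = (w - z) * (w + z + e * p)" for w :: complex
    using z by algebra
  have "e * e = 1" using e by auto
  then have "z\<^sup>2 + e * r * z + s = of_real ((e * Re z)\<^sup>2 + r * (e * Re z) + s)"
    using Im_critical_eq_0(1)[OF assms] by (auto simp: complex_eq_iff power2_eq_square)
  then have nz: "z\<^sup>2 + e * r * z + s \<noteq> 0"
    using rs_pos[of "e * Re z"] by (metis of_real_eq_0_iff less_irrefl)
  show "has_local_degree f (Some z) 2"
  proof (rule has_local_degree_finite[where f = f and x = z and n = 2 and y = "of_real e" and h = ?h])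
    show "\<forall>\<^sub>F w::complex in nhds z. f (Some w) = Some (e + (w - z)\<^sup>2 * ?h w)"
      using eventually_not_pole[OF np]
    proof eventually_elim
      case (elim w)
      have "F w = e + (w - z)\<^sup>2 * ?h w"
        unfolding F_eq_sign[OF e elim] fac by (simp add: power_mult_distrib mult_ac)
      with elim show ?case by (simp add: f_Some)
    qed
    show "?h analytic_on {z}"
      using np by (intro analytic_intros) auto
    have "z + z + e * p \<noteq> 0"
      using Im_critical_eq_0(2)[OF assms] unfolding mult_2 .
    moreover have "complex_of_real e \<noteq> 0" using e by auto
    ultimately show "?h z \<noteq> 0"
      using np nz by (simp only: divide_eq_0_iff mult_eq_0_iff power_eq_0_iff neg_equal_0_iff_equal) simp
  qed (simp_all add: val)
qed

lemma local_degree_pole: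
  fixes z :: complex
  assumes "z\<^sup>2 + b = 0"
  shows "has_local_degree f (Some z) 3" "f (Some z) = None"
proof -
  let ?h = "\<lambda>w::complex. w ^ 3 * (1 - w\<^sup>2) / (C * (w + z) ^ 3)"
  show val: "f (Some z) = None" using assms by (simp add: f_Some)
  have z: "z \<noteq> 0" "z ^ 3 * (1 - z\<^sup>2) \<noteq> 0"
    using assms b_pos no_common_root[of z] by auto
  show "has_local_degree f (Some z) 3"
  proof (rule has_local_degree_pole[where f = f and x = z and n = 3 and h = ?h])
    have fac: "w\<^sup>2 + b = (w - z) * (w + z)" for w :: complex
      using assms by algebra
    have "\<forall>\<^sub>F w in nhds z. w + z \<noteq> 0"
      using z(1) by (intro tendsto_imp_eventually_ne[where c = "z + z"]) (auto intro!: tendsto_eq_intros filterlim_ident)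
    then show "\<forall>\<^sub>F w in nhds z. w \<noteq> z \<longrightarrow> f (Some w) = Some (?h w / (w - z) ^ 3)"
      by eventually_elim (auto simp: f_Some fac F_def power_mult_distrib)
    show "?h analytic_on {z}" "?h z \<noteq> 0"
      using z C_pos by (auto intro!: analytic_intros)
  qed (simp_all add: val)
qed

text \<open>The numerator has degree 5 and the denominator degree 6, so infinity is a simple
  zero.\<close>

lemma local_degree_infinity: "has_local_degree f None 1"
proof (rule has_local_degree_at_infinity[where f = f and y = 0 and n = 1 and h = "\<lambda>t::complex. (t\<^sup>2 - 1) / (C * (1 + b * t\<^sup>2) ^ 3)"])
  have "\<forall>\<^sub>F t::complex in nhds 0. 1 + b * t\<^sup>2 \<noteq> (0::complex)"
    by (rule tendsto_imp_eventually_ne[where c = 1]) (auto intro!: tendsto_eq_intros filterlim_ident)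
  then show "\<forall>\<^sub>F t::complex in nhds 0. t \<noteq> 0 \<longrightarrow> f (Some (inverse t)) = Some (0 + t ^ 1 * ((t\<^sup>2 - 1) / (C * (1 + b * t\<^sup>2) ^ 3)))"
  proof eventually_elim
    case (elim t)
    show ?case
    proof
      assume t: "t \<noteq> 0"
      have a: "(inverse t)\<^sup>2 + b = (1 + b * t\<^sup>2) / t\<^sup>2"
        using t by (simp add: field_simps power2_eq_square)
      have "F (inverse t) = t * (t\<^sup>2 - 1) / (C * (1 + b * t\<^sup>2) ^ 3)"
        unfolding F_def a using t elim C_pos by (simp add: power_divide power_inverse divide_simps) algebra
      then show "f (Some (inverse t)) = Some (0 + t ^ 1 * ((t\<^sup>2 - 1) / (C * (1 + b * t\<^sup>2) ^ 3)))"
        using elim t a by (simp add: f_Some)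
    qed
  qed
qed (use C_pos f_None in \<open>auto intro!: analytic_intros\<close>)

lemma local_degree_regular:
  fixes z :: complex
  assumes "z \<noteq> 0" "z\<^sup>2 + p * z + q \<noteq> 0" "z\<^sup>2 - p * z + q \<noteq> 0" "z\<^sup>2 + b \<noteq> 0"
  shows "has_local_degree f (Some z) 1"
proof (rule has_local_degree_simple[OF open_not_pole F_holomorphic _ DERIV_F[OF assms(4)]])
  show "\<forall>\<^sub>F w in nhds z. f (Some w) = Some (F w)"
    by (rule eventually_f_Some[OF assms(4)])
qed (use assms C_pos in \<open>simp_all add: f_Some\<close>)

definition critical :: "csphere set" where
  "critical = Some ` {z::complex. z = 0 \<or> z\<^sup>2 + p * z + q = 0 \<or> z\<^sup>2 - p * z + q = 0 \<or> z\<^sup>2 + b = 0}"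

lemma not_critical: "z \<notin> critical \<Longrightarrow> has_local_degree f z 1"
  using local_degree_regular local_degree_infinity by (cases z) (auto simp: critical_def)

lemma critical_cases:
  assumes "z \<in> critical"
  obtains "has_local_degree f z 3" "f z = Some 0" "z = Some 0" | "has_local_degree f z 2" "f z = Some 1"
    | "has_local_degree f z 2" "f z = Some (-1)" | "has_local_degree f z 3" "f z = None"
proof -
  obtain w :: complex where w: "z = Some w" "w = 0 \<or> w\<^sup>2 + p * w + q = 0 \<or> w\<^sup>2 - p * w + q = 0 \<or> w\<^sup>2 + b = 0"
    using assms by (auto simp: critical_def)
  have "f (Some 0) = Some 0" using b_pos by (simp add: f_Some F_def)
  with w(2) show ?thesis
  proof (elim disjE)
    assume "w\<^sup>2 + p * w + q = 0"
    then show ?thesis using that(2) local_degree_critical[of 1 w] w(1) by simp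
  next
    assume "w\<^sup>2 - p * w + q = 0"
    then show ?thesis using that(3) local_degree_critical[of "-1" w] w(1) by simp
  next
    assume "w\<^sup>2 + b = 0"
    then show ?thesis using that(4) local_degree_pole[of w] w(1) by simp
  qed (use w(1) that(1) local_degree_zero in simp)
qed

lemma Crit_f: "Crit f = critical"
proof (intro equalityI subsetI)
  fix z assume "z \<in> Crit f"
  then show "z \<in> critical"
    using not_critical[of z] local_degree_eqI[of f z 1] by (auto simp: Crit_def)
next
  fix z assume "z \<in> critical"
  then show "z \<in> Crit f"
    by (cases rule: critical_cases) (auto simp: Crit_def dest!: local_degree_eqI)
qed

lemma f_eq_0_iff: "f z = Some 0 \<longleftrightarrow> z \<in> P"
proof (cases z)
  case None then show ?thesis by (simp add: f_None P_def)
next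
  case (Some w)
  have "f (Some w) = Some 0 \<longleftrightarrow> w\<^sup>2 + b \<noteq> 0 \<and> w ^ 3 * (1 - w\<^sup>2) = 0"
    using C_pos by (auto simp: f_Some F_def)
  also have "\<dots> \<longleftrightarrow> w ^ 3 * (1 - w\<^sup>2) = 0"
    using no_common_root by blast
  also have "\<dots> \<longleftrightarrow> w \<in> {0, 1, -1}"
    by (auto simp: power2_eq_1_iff)
  finally show ?thesis using Some by (auto simp: P_def)
qed

lemma f_P: "z \<in> P \<Longrightarrow> f z \<in> P"
  using f_eq_0_iff[of z] by (simp add: P_def)

lemma funpow_f_P: "z \<in> P \<Longrightarrow> (f ^^ n) z \<in> P"
  by (induction n) (auto intro: f_P)

lemma f_critical_P: "z \<in> critical \<Longrightarrow> f z \<in> P"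
  by (erule critical_cases) (auto simp: P_def)

lemma exists_critical:
  assumes "e \<in> {1, -1::real}"
  shows "\<exists>z::complex. z\<^sup>2 + e * p * z + q = 0"
proof -
  define x where "x = (- e * p + sqrt (p\<^sup>2 - 4 * q)) / 2"
  have "(sqrt (p\<^sup>2 - 4 * q))\<^sup>2 = p\<^sup>2 - 4 * q" using discr_pos by simp
  moreover have "e\<^sup>2 = 1" using assms by auto
  ultimately have "x\<^sup>2 + e * p * x + q = 0"
    unfolding x_def by (simp add: power2_eq_square field_simps)
  from arg_cong[OF this, of complex_of_real]
  have "(complex_of_real x)\<^sup>2 + e * p * complex_of_real x + q = 0"
    by simp
  then show ?thesis by blast
qed

lemma exists_pole: "\<exists>z::complex. z\<^sup>2 + b = 0"
  using b_pos by (intro exI[of _ "\<i> * of_real (sqrt b)"]) (simp add: power_mult_distrib flip: of_real_power)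

lemma critical_preimages:
  obtains z1 z2 z3 where "z1 \<in> critical" "f z1 = Some 1" "z2 \<in> critical" "f z2 = Some (-1)"
    "z3 \<in> critical" "f z3 = None"
proof -
  obtain z1 :: complex where z1: "z1\<^sup>2 + p * z1 + q = 0" using exists_critical[of 1] by auto
  obtain z2 :: complex where z2: "z2\<^sup>2 - p * z2 + q = 0" using exists_critical[of "-1"] by auto
  obtain z3 :: complex where z3: "z3\<^sup>2 + b = 0" using exists_pole by blast
  show ?thesis
    using that[of "Some z1" "Some z2" "Some z3"] z1 z2 z3 local_degree_pole(2)[OF z3]
      local_degree_critical(2)[of 1 z1] local_degree_critical(2)[of "-1" z2]
    by (auto simp: critical_def)
qed

text \<open>Every point of P is a critical value, so the union is exhausted at n = 1, and P is
  forward invariant because f sends all of it to 0. Being finite, P is closed.\<close>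

lemma postcritical_set_f: "postcritical_set f = P"
proof -
  have "(\<Union>n\<in>{1..}. (f ^^ n) ` Crit f) = P"
  proof (intro equalityI subsetI)
    fix w assume "w \<in> (\<Union>n\<in>{1..}. (f ^^ n) ` Crit f)"
    then obtain n z where n: "n \<ge> 1" "z \<in> critical" "w = (f ^^ n) z"
      by (auto simp: Crit_f)
    then obtain m where "n = Suc m" by (cases n) auto
    then have "w = (f ^^ m) (f z)" using n by (simp add: funpow_swap1)
    then show "w \<in> P" using n funpow_f_P f_critical_P by simp
  next
    fix w assume "w \<in> P"
    have "\<exists>z\<in>critical. f z = w"
    proof -
      have 0: "Some 0 \<in> critical" "f (Some 0) = Some 0"
        using f_eq_0_iff[of "Some 0"] by (auto simp: critical_def P_def)
      obtain z1 z2 z3 where "z1 \<in> critical" "f z1 = Some 1" "z2 \<in> critical" "f z2 = Some (-1)"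
        "z3 \<in> critical" "f z3 = None"
        by (rule critical_preimages)
      then show ?thesis
        using \<open>w \<in> P\<close> 0 by (auto simp: P_def)
    qed
    then have "w \<in> (f ^^ 1) ` Crit f"
      by (auto simp: Crit_f)
    then show "w \<in> (\<Union>n\<in>{1..}. (f ^^ n) ` Crit f)"
      by blast
  qed
  moreover have "closedin riemann_sphere P"
  proof (rule t1_space_closedin_finite[THEN iffD1, rule_format])
    show "t1_space riemann_sphere"
      unfolding riemann_sphere_def by (simp add: t1_space_euclidean)
  qed (auto simp: P_def)
  ultimately show ?thesis
    unfolding postcritical_set_def by (simp add: closure_of_closedin)
qed

end

section \<open>Local degrees of iterates and orbifold weights\<close>

context pcf_map
begin

text \<open>P is forward invariant and contains the critical values, so an orbit that ends outside P
  passes through no critical point before its end, and the chain rule multiplies ones.\<close>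

lemma local_degree_1_iterate:
  "(f ^^ n) z \<notin> P \<Longrightarrow> has_local_degree (f ^^ n) z 1"
proof (induction n)
  case 0
  have "f ^^ 0 = id" by (rule ext) simp
  then show ?case by (simp only: has_local_degree_id)
next
  case (Suc n)
  then have n: "(f ^^ n) z \<notin> P" "(f ^^ n) z \<notin> critical"
    using f_P[of "(f ^^ n) z"] f_critical_P[of "(f ^^ n) z"] by auto
  from has_local_degree_compose[OF Suc.IH[OF n(1)] not_critical[OF n(2)]]
  show ?case by (simp only: funpow.simps mult_1)
qed

text \<open>At the fixed point the n-th iterate has local degree 3^n, so the local degrees over 0
  are unbounded.\<close>

lemma orbifold_weight_0: "orbifold_weight f (Some 0) = \<infinity>"
proof -
  have fix0: "(f ^^ n) (Some 0) = Some 0" for n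
    using f_eq_0_iff[of "Some 0"] by (induction n) (auto simp: P_def)
  have "has_local_degree (f ^^ n) (Some 0) (3 ^ n)" for n
  proof (induction n)
    case 0
    have "f ^^ 0 = id" by (rule ext) simp
    then show ?case by (simp only: power_0 has_local_degree_id)
  next
    case (Suc n)
    from has_local_degree_compose[OF this, of f 3] local_degree_zero
    show ?case by (simp only: fix0 funpow.simps power_Suc)
  qed
  then have ld: "local_degree (f ^^ n) (Some 0) = 3 ^ n" for n
    by (rule local_degree_eqI)
  have mem: "3 ^ n \<in> {local_degree (f ^^ n) z |n z. n \<ge> 1 \<and> (f ^^ n) z = Some 0}" if "n \<ge> 1" for n
    using that by (intro CollectI exI[of _ n] exI[of _ "Some 0"]) (simp add: fix0 ld)
  have "\<not> bdd_above {local_degree (f ^^ n) z |n z. n \<ge> 1 \<and> (f ^^ n) z = Some 0}"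
  proof
    assume "bdd_above {local_degree (f ^^ n) z |n z. n \<ge> 1 \<and> (f ^^ n) z = Some 0}"
    then obtain M where M: "\<And>d. d \<in> {local_degree (f ^^ n) z |n z. n \<ge> 1 \<and> (f ^^ n) z = Some 0} \<Longrightarrow> d \<le> M"
      unfolding bdd_above_def by blast
    have "Suc M < 3 ^ Suc M"
      by (rule power_gt_expt) simp
    with M[OF mem[of "Suc M"]] show False by linarith
  qed
  then show ?thesis by (simp add: orbifold_weight_def Let_def)
qed

text \<open>A preimage of v under f lies outside P, because f maps P to 0. Hence an iterate can
  ramify over v only in its last step, and the local degrees over v are those of f itself.\<close>

lemma orbifold_weight_eq:
  assumes v: "v \<in> P" "v \<noteq> Some 0" and k: "k > 0"
    and ub: "\<And>z. f z = v \<Longrightarrow> local_degree f z \<in> {1, k}" and ex: "\<exists>z. f z = v \<and> local_degree f z = k"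
  shows "orbifold_weight f v = enat k"
proof -
  define D where "D = {local_degree (f ^^ n) z |n z. n \<ge> 1 \<and> (f ^^ n) z = v}"
  have "D \<subseteq> {1, k}"
  proof
    fix d assume "d \<in> D"
    then obtain n z where n: "n \<ge> 1" "(f ^^ n) z = v" "d = local_degree (f ^^ n) z"
      by (auto simp: D_def)
    then obtain m where m: "n = Suc m" by (cases n) auto
    define y where "y = (f ^^ m) z"
    have y: "f y = v" using n m y_def by simp
    then have "y \<notin> P" using v f_eq_0_iff[of y] by auto
    then have 1: "has_local_degree (f ^^ m) z 1" using local_degree_1_iterate y_def by simp
    obtain j where j: "has_local_degree f y j"
      using not_critical critical_cases by metis
    then have "has_local_degree (f ^^ n) z j"
      using has_local_degree_compose[OF 1, of f j] y_def m by (simp only: funpow.simps mult_1_right)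
    then have "d = local_degree f y"
      using n(3) j local_degree_eqI by metis
    then show "d \<in> {1, k}" using ub y by simp
  qed
  moreover have "k \<in> D"
  proof -
    obtain z where z: "f z = v" "local_degree f z = k" using ex by blast
    then show ?thesis
      unfolding D_def by (intro CollectI exI[of _ 1] exI[of _ z]) simp
  qed
  ultimately have "D = {k} \<or> D = {1, k}" by auto
  then have "bdd_above D" "Lcm D = k" by auto
  then show ?thesis
    unfolding orbifold_weight_def by (simp add: Let_def D_def)
qed

lemma orbifold_weights:
  "orbifold_weight f (Some 1) = 2" "orbifold_weight f (Some (-1)) = 2" "orbifold_weight f None = 3"
proof -
  have val: "local_degree f z = (if z \<notin> critical then 1 else if f z \<in> {Some 0, None} then 3 else 2)" for z
  proof (cases "z \<in> critical")
    case True
    then show ?thesis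
      by (cases rule: critical_cases) (use True in \<open>simp_all add: local_degree_eqI\<close>)
  next
    case False
    then show ?thesis using local_degree_eqI[OF not_critical[OF False]] by simp
  qed
  obtain z1 z2 z3 where c: "z1 \<in> critical" "z2 \<in> critical" "z3 \<in> critical"
    and v: "f z1 = Some 1" "f z2 = Some (-1)" "f z3 = None"
    by (rule critical_preimages)
  have "orbifold_weight f (Some 1) = enat 2"
  proof (rule orbifold_weight_eq)
    show "\<exists>z. f z = Some 1 \<and> local_degree f z = 2"
      by (rule exI[of _ z1]) (simp add: val v c)
  qed (simp_all add: P_def val)
  then show "orbifold_weight f (Some 1) = 2" by (simp add: numeral_eq_enat)
  have "orbifold_weight f (Some (-1)) = enat 2"
  proof (rule orbifold_weight_eq)
    show "\<exists>z. f z = Some (-1) \<and> local_degree f z = 2"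
      by (rule exI[of _ z2]) (simp add: val v c)
  qed (simp_all add: P_def val)
  then show "orbifold_weight f (Some (-1)) = 2" by (simp add: numeral_eq_enat)
  have "orbifold_weight f None = enat 3"
  proof (rule orbifold_weight_eq)
    show "\<exists>z. f z = None \<and> local_degree f z = 3"
      by (rule exI[of _ z3]) (simp add: val v c)
  qed (simp_all add: P_def val)
  then show "orbifold_weight f None = 3" by (simp add: numeral_eq_enat)
qed

lemma orbifold_signature_f: "orbifold_signature f = {#2, 2, 3, \<infinity>#}"
  unfolding orbifold_signature_def postcritical_set_f P_def
  by (simp add: orbifold_weight_0 orbifold_weights)

end

section \<open>Preimages of circles\<close>

context pcf_map
begin

section \<open>Values on the real and the imaginary axis\<close>

definition Fr :: "real \<Rightarrow> real" where "Fr x = x ^ 3 * (1 - x\<^sup>2) / (C * (x\<^sup>2 + b) ^ 3)"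

lemma F_of_real: "F (complex_of_real x) = complex_of_real (Fr x)"
  by (simp add: F_def Fr_def)

lemma den_pos: "C * (x\<^sup>2 + b) ^ 3 > 0" for x :: real
proof -
  have "x\<^sup>2 + b > 0" using b_pos zero_le_power2[of x] by linarith
  then show ?thesis using C_pos by simp
qed

lemma Fr_minus: "Fr (- x) = - Fr x"
  by (simp add: Fr_def)

lemma Fr_le_1: "Fr x \<le> 1"
proof -
  have xb: "x\<^sup>2 + b > 0" using b_pos zero_le_power2[of x] by linarith
  have np: "(complex_of_real x)\<^sup>2 + complex_of_real b \<noteq> 0"
    by (rule real_not_pole) simp
  have "complex_of_real (Fr x) = complex_of_real (1 - (x\<^sup>2 + p * x + q)\<^sup>2 * (x\<^sup>2 + r * x + s) / (x\<^sup>2 + b) ^ 3)"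
    using F_eq_sign[of 1, OF _ np] by (simp add: F_of_real)
  then have "Fr x = 1 - (x\<^sup>2 + p * x + q)\<^sup>2 * (x\<^sup>2 + r * x + s) / (x\<^sup>2 + b) ^ 3"
    by (simp only: of_real_eq_iff)
  moreover have "(x\<^sup>2 + p * x + q)\<^sup>2 * (x\<^sup>2 + r * x + s) / (x\<^sup>2 + b) ^ 3 \<ge> 0"
    using rs_pos[of x] xb by simp
  ultimately show ?thesis by linarith
qed

lemma abs_Fr_le_1: "\<bar>Fr x\<bar> \<le> 1"
  using Fr_le_1[of x] Fr_le_1[of "- x"] by (simp add: Fr_minus abs_le_iff)

text \<open>These two intervals become the slits: \<open>Fr\<close> cannot be -1/2 on them, the
  value it has at real points over the first circle.\<close>

lemma Fr_nonneg:
  assumes "x \<le> -1 \<or> 0 \<le> x \<and> x \<le> 1"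
  shows "Fr x \<ge> 0"
proof -
  have "x ^ 3 * (1 - x\<^sup>2) \<ge> 0"
  proof (cases "x \<le> -1")
    case True
    then have "x ^ 3 \<le> 0" "x\<^sup>2 \<ge> 1"
      using power_mono[of 1 "- x" 2] zero_le_power[of "- x" 3] by auto
    then show ?thesis by (simp add: mult_nonpos_nonpos)
  next
    case False
    then have "0 \<le> x" "x \<le> 1" using assms by auto
    then show ?thesis by (simp add: power_le_one)
  qed
  then show ?thesis using den_pos[of x] by (simp add: Fr_def)
qed

lemma continuous_on_Fr: "continuous_on S Fr"
  unfolding Fr_def[abs_def]
proof (intro continuous_intros ballI)
  show "C * (x\<^sup>2 + b) ^ 3 \<noteq> 0" for x :: real by (rule less_imp_neq[OF den_pos, symmetric])
qed

lemma Fr_critical: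
  assumes "x\<^sup>2 - p * x + q = 0"
  shows "Fr x = -1"
proof -
  from arg_cong[OF assms, of complex_of_real]
  have "f (Some (complex_of_real x)) = Some (-1)"
    using local_degree_critical(2)[of "-1" "complex_of_real x"] by simp
  then have "F (complex_of_real x) = -1" by (auto simp: f_Some split: if_splits)
  then have "complex_of_real (Fr x) = complex_of_real (-1)" by (simp add: F_of_real)
  then show ?thesis by (simp only: of_real_eq_iff)
qed

text \<open>\<open>Fr\<close> vanishes at -1, 0 and 1 and equals -1 at the roots of x^2 - p x + q,
  one in (-1, 0) and one beyond 1; so -1/2 is taken on either side of the first root and once more
  before the second. Three solutions are one more than a single component can accommodate.\<close>

lemma Fr_three_solutions: "\<exists>x1 x2 x3. Fr x1 = -1/2 \<and> Fr x2 = -1/2 \<and> Fr x3 = -1/2 \<and> x1 < x2 \<and> x2 < x3"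
proof -
  define d where "d = sqrt (p\<^sup>2 - 4 * q)"
  have d2: "d * d = p * p - 4 * q" using discr_pos by (simp add: d_def power2_eq_square flip: real_sqrt_mult)
  have d: "d > p"
    unfolding d_def using q_neg p_pos by (intro real_less_rsqrt) simp
  define y1 y2 where "y1 = (p - d) / 2" and "y2 = (p + d) / 2"
  have roots: "Fr y1 = -1" "Fr y2 = -1"
    by (rule Fr_critical, simp add: y1_def y2_def power2_eq_square field_simps d2)+
  have y: "y1 < 0" "y2 > 0" using d p_pos by (auto simp: y1_def y2_def)
  have "y1 > -1" using Fr_nonneg[of y1] roots(1) by linarith
  have "y2 > 1" using Fr_nonneg[of y2] roots(2) y(2) by linarith
  have 0: "Fr 0 = 0" "Fr 1 = 0" "Fr (-1) = 0" by (auto simp: Fr_def)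
  have "\<exists>x\<ge>-1. x \<le> y1 \<and> Fr x = -1/2"
    by (rule IVT2') (use roots 0 \<open>y1 > -1\<close> continuous_on_Fr in auto)
  then obtain x1 where x1: "Fr x1 = -1/2" "x1 \<le> y1" by blast
  have "\<exists>x\<ge>y1. x \<le> 0 \<and> Fr x = -1/2"
    by (rule IVT') (use roots 0 y continuous_on_Fr in auto)
  then obtain x2 where x2: "Fr x2 = -1/2" "y1 \<le> x2" "x2 \<le> 0" by blast
  have "\<exists>x\<ge>1. x \<le> y2 \<and> Fr x = -1/2"
    by (rule IVT2') (use roots 0 \<open>y2 > 1\<close> continuous_on_Fr in auto)
  then obtain x3 where x3: "Fr x3 = -1/2" "1 \<le> x3" by blast
  have "x1 \<noteq> y1" using x1 roots by auto
  then show ?thesis using x1 x2 x3 by (intro exI[of _ x1] exI[of _ x2] exI[of _ x3]) auto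
qed

abbreviation imag :: "real \<Rightarrow> complex" where
  "imag t \<equiv> \<i> * complex_of_real t"

lemma F_imaginary: "F (imag t) = - \<i> * complex_of_real (t ^ 3 * (1 + t\<^sup>2) / (C * (b - t\<^sup>2) ^ 3))"
proof -
  have "\<i> ^ 3 = - \<i>" by (simp add: power3_eq_cube)
  then have "(imag t) ^ 3 = - \<i> * complex_of_real (t ^ 3)" "(imag t)\<^sup>2 = - complex_of_real (t\<^sup>2)"
    by (simp_all add: power_mult_distrib)
  then show ?thesis by (simp add: F_def)
qed

lemma imaginary_increasing:
  fixes v t :: real
  assumes "0 < v" "v < t" "t\<^sup>2 < b"
  shows "v ^ 3 * (1 + v\<^sup>2) / (C * (b - v\<^sup>2) ^ 3) < t ^ 3 * (1 + t\<^sup>2) / (C * (b - t\<^sup>2) ^ 3)"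
proof (rule frac_less)
  have "v\<^sup>2 < t\<^sup>2" "v ^ 3 < t ^ 3" using assms by (auto intro: power_strict_mono)
  then show "v ^ 3 * (1 + v\<^sup>2) < t ^ 3 * (1 + t\<^sup>2)"
    using assms by (intro mult_strict_mono) (auto intro: add_pos_nonneg)
  show "C * (b - t\<^sup>2) ^ 3 \<le> C * (b - v\<^sup>2) ^ 3"
    using \<open>v\<^sup>2 < t\<^sup>2\<close> assms C_pos by (intro mult_left_mono power_mono) auto
qed (use assms C_pos in auto)

text \<open>Up to the constant C the quotient is the product of t^2 / (t^2 - b), (1 + t^2) / (t^2 -
  b) and t / (t^2 - b), each decreasing beyond the pole. The three inequalities are cross-multiplied
  and then multiplied together.\<close>

lemma imaginary_decreasing:
  fixes v t :: real
  assumes "0 < v" "v < t" "b < v\<^sup>2"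
  shows "t ^ 3 * (1 + t\<^sup>2) / (C * (t\<^sup>2 - b) ^ 3) < v ^ 3 * (1 + v\<^sup>2) / (C * (v\<^sup>2 - b) ^ 3)"
proof -
  have vt2: "v\<^sup>2 < t\<^sup>2" using assms by (auto intro: power_strict_mono)
  have pos: "v\<^sup>2 - b > 0" "t\<^sup>2 - b > 0" "t > 0" using assms vt2 by auto
  have bs: "b * v\<^sup>2 < b * t\<^sup>2" using vt2 b_pos by simp
  have 1: "t\<^sup>2 * (v\<^sup>2 - b) < v\<^sup>2 * (t\<^sup>2 - b)"
    using bs by (simp add: algebra_simps)
  have 2: "(1 + t\<^sup>2) * (v\<^sup>2 - b) < (1 + v\<^sup>2) * (t\<^sup>2 - b)"
    using bs vt2 by (simp add: algebra_simps)
  have "v * t * (v - t) < b * (t - v)"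
  proof -
    have "v * t * (v - t) < 0" using assms pos by (simp add: mult_pos_neg)
    moreover have "b * (t - v) > 0" using assms b_pos by simp
    ultimately show ?thesis by linarith
  qed
  then have 3: "t * (v\<^sup>2 - b) < v * (t\<^sup>2 - b)"
    by (simp add: algebra_simps power2_eq_square)
  have n: "0 < v\<^sup>2 * (t\<^sup>2 - b)" "0 < 1 + t\<^sup>2" "0 < 1 + v\<^sup>2" "0 < t\<^sup>2 * (v\<^sup>2 - b)"
    using pos assms by (simp_all add: add_pos_nonneg)
  have m: "0 < (1 + t\<^sup>2) * (v\<^sup>2 - b)" "0 < (1 + v\<^sup>2) * (t\<^sup>2 - b)" "0 < t * (v\<^sup>2 - b)"
    using pos n by simp_all
  have "(t\<^sup>2 * (v\<^sup>2 - b)) * ((1 + t\<^sup>2) * (v\<^sup>2 - b)) < (v\<^sup>2 * (t\<^sup>2 - b)) * ((1 + v\<^sup>2) * (t\<^sup>2 - b))"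
    by (rule mult_strict_mono[OF 1 2 n(1) less_imp_le[OF m(1)]])
  then have "(t\<^sup>2 * (v\<^sup>2 - b)) * ((1 + t\<^sup>2) * (v\<^sup>2 - b)) * (t * (v\<^sup>2 - b))
      < (v\<^sup>2 * (t\<^sup>2 - b)) * ((1 + v\<^sup>2) * (t\<^sup>2 - b)) * (v * (t\<^sup>2 - b))"
    by (rule mult_strict_mono[OF _ 3 mult_pos_pos[OF n(1) m(2)] less_imp_le[OF m(3)]])
  also have "(t\<^sup>2 * (v\<^sup>2 - b)) * ((1 + t\<^sup>2) * (v\<^sup>2 - b)) * (t * (v\<^sup>2 - b)) = t ^ 3 * (1 + t\<^sup>2) * (v\<^sup>2 - b) ^ 3"
    by algebra
  also have "(v\<^sup>2 * (t\<^sup>2 - b)) * ((1 + v\<^sup>2) * (t\<^sup>2 - b)) * (v * (t\<^sup>2 - b)) = v ^ 3 * (1 + v\<^sup>2) * (t\<^sup>2 - b) ^ 3"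
    by algebra
  finally have "t ^ 3 * (1 + t\<^sup>2) / (t\<^sup>2 - b) ^ 3 < v ^ 3 * (1 + v\<^sup>2) / (v\<^sup>2 - b) ^ 3"
    using pos by (simp add: divide_less_eq less_divide_eq mult.commute)
  from divide_strict_right_mono[OF this C_pos] show ?thesis
    by (simp add: mult.commute)
qed

text \<open>A multiple root of num - y den would be a zero of the derivative of F, and there F is 0,
  1 or -1. For other y all roots are simple, so their number is the degree.\<close>

lemma fibre_card:
  fixes y :: complex
  assumes y: "y \<noteq> 0" "y \<noteq> 1" "y \<noteq> -1"
  shows "card {z::complex. z\<^sup>2 + b \<noteq> 0 \<and> F z = y} = 6"
    and "\<And>z::complex. z\<^sup>2 + b \<noteq> 0 \<Longrightarrow> F z = y \<Longrightarrow> deriv F z \<noteq> 0"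
proof -
  show d: "deriv F z \<noteq> 0" if z: "z\<^sup>2 + b \<noteq> 0" "F z = y" for z :: complex
  proof
    assume "deriv F z = 0"
    then have "z\<^sup>2 * (z\<^sup>2 + p * z + q) * (z\<^sup>2 - p * z + q) = 0"
      using DERIV_imp_deriv[OF DERIV_F[OF z(1)]] z(1) C_pos by simp
    then consider "z = 0" | "z\<^sup>2 + p * z + q = 0" | "z\<^sup>2 - p * z + q = 0" by auto
    then show False
    proof cases
      case 1 then show False using z y by (simp add: F_def)
    next
      case 2 then show False using F_eq_sign[of 1 z] z y by simp
    next
      case 3 then show False using F_eq_sign[of "-1" z] z y by simp
    qed
  qed
  define G where "G = num - smult y den"
  \<comment> \<open>The numerator has degree only 5, so \<open>y \<noteq> 0\<close> preserves the
    leading term coming from the denominator.\<close>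
  have deg: "degree G = 6"
  proof -
    have "degree G = degree (smult y den)"
      unfolding G_def diff_conv_add_uminus using y degree_num degree_den by (subst degree_add_eq_right) auto
    then show ?thesis using y degree_den by simp
  qed
  then have "G \<noteq> 0" by auto
  have polyG: "poly G z = poly den z * (F z - y)" if "z\<^sup>2 + b \<noteq> 0" for z :: complex
    using that C_pos by (simp add: G_def poly_num poly_den F_def field_simps)
  have roots: "poly G z = 0 \<longleftrightarrow> z\<^sup>2 + b \<noteq> 0 \<and> F z = y" for z :: complex
  proof (cases "z\<^sup>2 + b = 0")
    case True
    then have "poly G z \<noteq> 0"
      using no_common_root[of z] poly_den_eq_0_iff[of z] by (auto simp: G_def poly_num)
    then show ?thesis using True by simp
  next
    case False
    then show ?thesis using polyG[OF False] poly_den_eq_0_iff[of z] by simp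
  qed
  have "rsquarefree G"
    unfolding rsquarefree_roots
  proof (intro allI notI)
    fix a assume a: "poly G a = 0 \<and> poly (pderiv G) a = 0"
    then have np: "a\<^sup>2 + b \<noteq> 0" and Fa: "F a = y" using roots by auto
    have "(F has_field_derivative deriv F a) (at a)"
      using DERIV_F[OF np] DERIV_imp_deriv by metis
    \<comment> \<open>At a zero of F - y the product rule leaves only the term that contains the
      derivative of F.\<close>
    then have "((\<lambda>z. poly den z * (F z - y)) has_field_derivative poly den a * deriv F a) (at a)"
      by (auto intro!: derivative_eq_intros simp: Fa)
    moreover have "\<forall>\<^sub>F z in nhds a. poly G z = poly den z * (F z - y)"
      using eventually_not_pole[OF np] by eventually_elim (rule polyG)
    ultimately have "(poly G has_field_derivative poly den a * deriv F a) (at a)"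
      by (simp only: DERIV_cong_ev[OF refl _ refl])
    then have "poly den a * deriv F a = poly (pderiv G) a"
      using DERIV_unique poly_DERIV by blast
    then show False using a d[OF np Fa] poly_den_eq_0_iff[of a] np by simp
  qed
  from complex_poly_decompose_rsquarefree[OF this]
  have "degree (smult (lead_coeff G) (\<Prod>z | poly G z = 0. [:- z, 1:])) = 6"
    using deg by simp
  then have "card {z. poly G z = 0} = 6"
    using \<open>G \<noteq> 0\<close> by (simp add: degree_prod_sum_eq)
  then show "card {z::complex. z\<^sup>2 + b \<noteq> 0 \<and> F z = y} = 6"
    using roots by simp
qed

end

text \<open>One sign covers both circles: once real parts are written as \<open>e * Re z\<close>,
  the two cases read alike.\<close>

locale pcf_curve = pcf_map +
  fixes e :: real
  assumes e: "e = 1 \<or> e = -1"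
begin

lemma e_square: "e * e = 1" "e\<^sup>2 = 1" "e \<noteq> 0" "\<bar>e\<bar> = 1"
  using e by auto

abbreviation B :: "complex set" where "B \<equiv> sphere (complex_of_real e / 2) 1"

definition K :: "complex set" where "K = {z::complex. z\<^sup>2 + b \<noteq> 0 \<and> F z \<in> B}"

text \<open>In this form the intersections with the axes can be read off; on the imaginary axis the
  equation just fixes the modulus sqrt(3/4).\<close>

lemma in_B_iff: "w \<in> B \<longleftrightarrow> (norm w)\<^sup>2 = e * Re w + 3 / 4"
proof -
  have "w \<in> B \<longleftrightarrow> (norm (w - complex_of_real e / 2))\<^sup>2 = 1"
    by (simp add: dist_norm norm_minus_commute power2_eq_1_iff) (smt (verit) norm_ge_zero)
  also have "(norm (w - complex_of_real e / 2))\<^sup>2 = (norm w)\<^sup>2 - e * Re w + 1 / 4"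
    unfolding cmod_power2 using e_square by (simp add: power2_eq_square algebra_simps)
  finally show ?thesis by auto
qed

lemma of_real_in_B_iff: "complex_of_real x \<in> B \<longleftrightarrow> x = - e / 2 \<or> x = 3 * e / 2"
proof -
  have "complex_of_real x \<in> B \<longleftrightarrow> x\<^sup>2 = e * x + 3 / 4" unfolding in_B_iff by simp
  also have "(x + e / 2) * (x - 3 * e / 2) = x\<^sup>2 - e * x - 3 / 4 * (e * e)"
    by (simp add: power2_eq_square field_simps)
  then have "x\<^sup>2 = e * x + 3 / 4 \<longleftrightarrow> (x + e / 2) * (x - 3 * e / 2) = 0"
    using e_square by auto
  finally show ?thesis by auto
qed

lemma B_avoids: "0 \<notin> B" "1 \<notin> B" "-1 \<notin> B"
  using of_real_in_B_iff[of 0] of_real_in_B_iff[of 1] of_real_in_B_iff[of "-1"] e by auto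

lemma B_neq:
  assumes "y \<in> B"
  shows "y \<noteq> 0" "y \<noteq> 1" "y \<noteq> -1"
  using assms B_avoids by blast+

text \<open>The circle meets the real line in - e / 2 and 3 e / 2, and the second value is ruled out
  by \<open>abs_Fr_le_1\<close>.\<close>

lemma K_real:
  assumes "z \<in> K" "Im z = 0"
  shows "Fr (Re z) = - e / 2"
proof -
  have z: "z = complex_of_real (Re z)" using assms(2) by (simp add: complex_eq_iff)
  have "F z \<in> B" using assms(1) by (simp add: K_def)
  then have "complex_of_real (Fr (Re z)) \<in> B" using F_of_real[of "Re z"] z by simp
  then show ?thesis using of_real_in_B_iff[of "Fr (Re z)"] abs_Fr_le_1[of "Re z"] e by auto
qed

lemma K_real_avoids_slits:
  assumes "z \<in> K" "Im z = 0"
  shows "\<not> (e * Re z \<le> -1 \<or> 0 \<le> e * Re z \<and> e * Re z \<le> 1)"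
proof
  assume "e * Re z \<le> -1 \<or> 0 \<le> e * Re z \<and> e * Re z \<le> 1"
  then have "Fr (e * Re z) \<ge> 0" by (rule Fr_nonneg)
  moreover have "Fr (e * Re z) = e * Fr (Re z)" using e Fr_minus by auto
  moreover have "e * Fr (Re z) = -1/2" using K_real[OF assms] e_square by simp
  ultimately show False by simp
qed

lemma K_covering: "covering_space K F B"
proof -
  have "covering_space {z \<in> {z::complex. z\<^sup>2 + b \<noteq> 0}. F z \<in> B} F B"
  proof (rule covering_space_constant_fibre_card[OF open_not_pole F_holomorphic])
    fix z :: complex assume "z \<in> {z::complex. z\<^sup>2 + b \<noteq> 0}" "F z \<in> B"
    then show "deriv F z \<noteq> 0" using fibre_card(2)[OF B_neq[OF \<open>F z \<in> B\<close>], of z] by blast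
  next
    fix y assume "y \<in> B"
    from fibre_card(1)[OF B_neq[OF this]] show "card {z \<in> {z::complex. z\<^sup>2 + b \<noteq> 0}. F z = y} = 6" by simp
  qed simp
  moreover have "{z \<in> {z::complex. z\<^sup>2 + b \<noteq> 0}. F z \<in> B} = K" unfolding K_def by blast
  ultimately show ?thesis by (simp only:)
qed

lemma base_fibre: "card {x \<in> K. F x = complex_of_real e / 2 + - complex_of_real e} = 6"
proof -
  let ?y = "complex_of_real (- e / 2)"
  have h: "complex_of_real e / 2 + - complex_of_real e = ?y" by simp
  have B: "?y \<in> B" using of_real_in_B_iff[of "- e / 2"] by blast
  then have "{x \<in> K. F x = ?y} = {z::complex. z\<^sup>2 + b \<noteq> 0 \<and> F z = ?y}"
    unfolding K_def by auto
  then show ?thesis unfolding h using fibre_card(1)[OF B_neq[OF B]] by (simp only:)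
qed

text \<open>The complex radius - e puts angle 0 at the base point - e / 2, so all real points of K
  lie in the fibre over the base point.\<close>

sublocale cc: circle_covering K F "complex_of_real e / 2" "- complex_of_real e"
proof
  show "- complex_of_real e \<noteq> 0" using e_square by simp
  have "norm (- complex_of_real e) = 1" using e_square by simp
  then show "covering_space K F (sphere (complex_of_real e / 2) (norm (- complex_of_real e)))"
    using K_covering by simp
  show "finite {x \<in> K. F x = complex_of_real e / 2 + - complex_of_real e}"
    using base_fibre card.infinite by force
qed

end

lemma open_subset_sphere_empty:
  fixes S :: "complex set"
  assumes "open S" "S \<subseteq> sphere c 1"
  shows "S = {}"
proof (rule ccontr)
  assume "S \<noteq> {}"
  then obtain w where w: "w \<in> S" by blast
  then obtain d where d: "d > 0" "ball w d \<subseteq> S" using assms(1) openE by blast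
  have w1: "norm (w - c) = 1" using w assms(2) by (auto simp: dist_norm norm_minus_commute)
  define w' where "w' = w + of_real (d / 2) * (w - c)"
  have "dist w w' = d / 2" using w1 d by (simp add: w'_def dist_norm norm_mult)
  then have "w' \<in> ball w d" using d(1) by simp
  then have "w' \<in> sphere c 1" using d(2) assms(2) by blast
  moreover have "w' - c = of_real (1 + d / 2) * (w - c)" by (simp add: w'_def algebra_simps)
  then have "norm (w' - c) = \<bar>1 + d / 2\<bar> * 1" using w1 by (simp only: norm_mult norm_of_real)
  ultimately show False using d(1) by (simp add: dist_norm norm_minus_commute)
qed

lemma connected_disjoint_inside_or_outside:
  fixes p :: "real \<Rightarrow> complex"
  assumes p: "simple_path p" "pathfinish p = pathstart p"
    and S: "connected S" "S \<inter> path_image p = {}"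
  shows "S \<subseteq> inside (path_image p) \<or> S \<subseteq> outside (path_image p)"
proof -
  have J: "open (inside (path_image p))" "open (outside (path_image p))"
    "inside (path_image p) \<inter> outside (path_image p) = {}" "inside (path_image p) \<union> outside (path_image p) = - path_image p"
    using Jordan_inside_outside[OF p] by auto
  have "S \<subseteq> inside (path_image p) \<union> outside (path_image p)" using S(2) J(4) by blast
  then have "inside (path_image p) \<inter> S = {} \<or> outside (path_image p) \<inter> S = {}"
    using connectedD[OF S(1) J(1,2)] J(3) by blast
  then show ?thesis using \<open>S \<subseteq> inside (path_image p) \<union> outside (path_image p)\<close> by blast
qed

lemma connected_unbounded_meets:
  fixes p :: "real \<Rightarrow> complex"
  assumes p: "simple_path p" "pathfinish p = pathstart p"
    and S: "connected S" "\<not> bounded S" "x \<in> S" "x \<in> inside (path_image p)"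
  shows "S \<inter> path_image p \<noteq> {}"
proof
  assume "S \<inter> path_image p = {}"
  then have "S \<subseteq> inside (path_image p) \<or> S \<subseteq> outside (path_image p)"
    by (rule connected_disjoint_inside_or_outside[OF p S(1)])
  moreover have "bounded (inside (path_image p))" "inside (path_image p) \<inter> outside (path_image p) = {}"
    using Jordan_inside_outside[OF p] by auto
  ultimately show False using S(2-4) bounded_subset by blast
qed

lemma unbounded_ray:
  fixes v :: complex
  assumes "v \<noteq> 0"
  shows "\<not> bounded ((\<lambda>t. of_real t * v) ` {a..})"
proof
  assume "bounded ((\<lambda>t. of_real t * v) ` {a..})"
  then obtain M where M: "\<And>t. t \<ge> a \<Longrightarrow> norm (of_real t * v) \<le> M"
    unfolding bounded_iff by auto
  define t where "t = max a (\<bar>M\<bar> / norm v + 1)"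
  have t: "\<bar>M\<bar> / norm v + 1 \<le> t" "a \<le> t" by (auto simp: t_def)
  have "M < t * norm v"
  proof -
    have "\<bar>M\<bar> < (\<bar>M\<bar> / norm v + 1) * norm v" using assms by (simp add: algebra_simps)
    also have "\<dots> \<le> t * norm v" using t by (intro mult_right_mono) auto
    finally show ?thesis by linarith
  qed
  also have "t * norm v \<le> norm (of_real t * v)" by (simp add: norm_mult mult_right_mono)
  finally show False using M[OF t(2)] by linarith
qed

lemma connected_ray: "connected ((\<lambda>t. of_real t * v) ` {a::real..})" "connected ((\<lambda>t. of_real t * v) ` {a..b})"
  for v :: complex
  by (intro connected_continuous_image continuous_intros connected_Ici connected_Icc)+

section \<open>Slits and the maximum principle\<close>

context pcf_curve
begin

lemma e_cancel: "e * (e * x) = x" for x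
  using e by auto

text \<open>One slit joins 0 to e, the other joins - e to infinity. Together with infinity they
  contain P, and their complement is an annulus. A curve that avoids them cannot separate the two
  ends of a slit.\<close>

definition slits :: "complex set" where
  "slits = {z. Im z = 0 \<and> (e * Re z \<le> -1 \<or> 0 \<le> e * Re z \<and> e * Re z \<le> 1)}"

lemma K_slits: "K \<inter> slits = {}"
  using K_real_avoids_slits by (auto simp: slits_def)

lemma slit_points: "complex_of_real (e * t) \<in> slits \<longleftrightarrow> t \<le> -1 \<or> 0 \<le> t \<and> t \<le> 1"
proof -
  have "e * (e * t) = t" using e_square by (simp flip: mult.assoc)
  then show ?thesis
    by (simp only: slits_def mem_Collect_eq Re_complex_of_real Im_complex_of_real simp_thms)
qed

text \<open>Core curves of the annulus between the slits. Enclosing 0 decides on which side every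
  point of P lies.\<close>

definition good_loop :: "(real \<Rightarrow> complex) \<Rightarrow> bool" where
  "good_loop l \<longleftrightarrow> simple_path l \<and> pathfinish l = pathstart l \<and> path_image l \<inter> slits = {} \<and> 0 \<in> inside (path_image l)"

text \<open>The outer slit is connected and unbounded, whereas the inside of the loop is
  bounded.\<close>

lemma outer_slit_outside:
  assumes l: "simple_path l" "pathfinish l = pathstart l" "path_image l \<inter> slits = {}"
  shows "complex_of_real (- e) \<in> outside (path_image l)"
proof -
  let ?S = "(\<lambda>t. complex_of_real t * complex_of_real (- e)) ` {1..}"
  have "?S \<subseteq> slits"
  proof (rule image_subsetI)
    fix t :: real assume "t \<in> {1..}"
    then show "complex_of_real t * complex_of_real (- e) \<in> slits"
      using slit_points[of "- t"] by (simp add: mult.commute)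
  qed
  then have d: "?S \<inter> path_image l = {}" using l(3) by blast
  have "complex_of_real (- e) \<noteq> 0" using e_square by simp
  then have "\<not> bounded ?S" by (rule unbounded_ray)
  moreover have "bounded (inside (path_image l))" using Jordan_inside_outside[OF l(1,2)] by auto
  ultimately have "\<not> ?S \<subseteq> inside (path_image l)" using bounded_subset by blast
  then have "?S \<subseteq> outside (path_image l)"
    using connected_disjoint_inside_or_outside[OF l(1,2) connected_ray(1) d] by blast
  moreover have "complex_of_real (- e) \<in> ?S" by (rule image_eqI[of _ _ 1]) auto
  ultimately show ?thesis by blast
qed

lemma inner_slit_same_side:
  assumes l: "simple_path l" "pathfinish l = pathstart l" "path_image l \<inter> slits = {}"
  shows "0 \<in> inside (path_image l) \<longleftrightarrow> complex_of_real e \<in> inside (path_image l)"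
proof -
  let ?S = "(\<lambda>t. complex_of_real t * complex_of_real e) ` {0..1}"
  have "?S \<subseteq> slits"
  proof (rule image_subsetI)
    fix t :: real assume "t \<in> {0..1}"
    then show "complex_of_real t * complex_of_real e \<in> slits"
      using slit_points[of t] by (simp add: mult.commute)
  qed
  then have d: "?S \<inter> path_image l = {}" using l(3) by blast
  have "inside (path_image l) \<inter> outside (path_image l) = {}" using Jordan_inside_outside[OF l(1,2)] by auto
  moreover have "0 \<in> ?S" by (rule image_eqI[of _ _ 0]) auto
  moreover have "complex_of_real e \<in> ?S" by (rule image_eqI[of _ _ 1]) auto
  ultimately show ?thesis
    using connected_disjoint_inside_or_outside[OF l(1,2) connected_ray(2) d] by blast
qed

lemma K_D: "z \<in> K \<Longrightarrow> z\<^sup>2 + b \<noteq> 0" "z \<in> K \<Longrightarrow> F z \<in> B"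
  by (auto simp: K_def)

lemma F_zeros: "F z = 0 \<Longrightarrow> z\<^sup>2 + b \<noteq> 0 \<Longrightarrow> z = 0 \<or> z = complex_of_real e \<or> z = complex_of_real (- e)"
  using C_pos e by (auto simp: F_def power2_eq_1_iff)

text \<open>If neither 0 nor a pole is enclosed, the slits keep e and - e from being enclosed as
  well, so \<open>F\<close> has neither zeros nor poles on the closed region. Two applications of
  the maximum principle confine its values on the region to the circle, which contradicts
  openness.\<close>

lemma inside_zero_or_pole:
  fixes l :: "real \<Rightarrow> complex"
  assumes l: "simple_path l" "pathfinish l = pathstart l" "path_image l \<subseteq> K" "0 \<notin> inside (path_image l)"
  shows "\<exists>z \<in> inside (path_image l). z\<^sup>2 + b = 0"
proof (rule ccontr)
  assume np: "\<not> ?thesis"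
  let ?U = "inside (path_image l)"
  have J: "?U \<noteq> {}" "open ?U" "bounded ?U" "frontier ?U = path_image l" "?U \<inter> outside (path_image l) = {}"
    using Jordan_inside_outside[OF l(1,2)] by auto
  have sl: "path_image l \<inter> slits = {}" using l(3) K_slits by blast
  have cl: "closure ?U = ?U \<union> path_image l"
    using J(4) closure_Un_frontier[of ?U] by simp
  have np': "z\<^sup>2 + b \<noteq> 0" if "z \<in> closure ?U" for z
    using that np l(3) K_D(1) unfolding cl by blast
  have nz: "F z \<noteq> 0" if "z \<in> closure ?U" for z
  proof
    assume "F z = 0"
    then have z: "z = 0 \<or> z = complex_of_real e \<or> z = complex_of_real (- e)"
      using F_zeros np'[OF that] by blast
    have "z \<notin> path_image l" using l(3) K_D(2)[of z] \<open>F z = 0\<close> B_avoids(1) by (auto simp del: mem_sphere)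
    then have "z \<in> ?U" using that cl by blast
    then show False
      using z l(4) inner_slit_same_side[OF l(1,2) sl] outer_slit_outside[OF l(1,2) sl] J(5) by blast
  qed
  have hol: "F holomorphic_on closure ?U"
    using np' by (intro holomorphic_on_subset[OF F_holomorphic]) auto
  have cont: "continuous_on (closure ?U) F" by (rule holomorphic_on_imp_continuous_on[OF hol])
  have int: "interior ?U = ?U" using J(2) by (rule interior_open)
  have holU: "F holomorphic_on ?U" by (rule holomorphic_on_subset[OF hol closure_subset])
  have nzU: "F z \<noteq> 0" if "z \<in> ?U" for z using that nz closure_subset by blast
  have norm3: "(norm (3 + 2 * complex_of_real e * w))\<^sup>2 = 9 + 12 * (e * Re w) + 4 * (norm w)\<^sup>2" for w
    unfolding cmod_power2 using e_square by (simp add: power2_eq_square algebra_simps e_cancel)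
  have FB: "F z \<in> B" if z: "z \<in> ?U" for z
  proof -
    have 1: "norm (F z - complex_of_real e / 2) \<le> 1"
    proof (rule maximum_modulus_frontier[where f = "\<lambda>z. F z - complex_of_real e / 2" and S = ?U])
      show "(\<lambda>z. F z - complex_of_real e / 2) holomorphic_on interior ?U"
        unfolding int by (intro holomorphic_intros holU)
      show "continuous_on (closure ?U) (\<lambda>z. F z - complex_of_real e / 2)"
        by (intro continuous_intros cont)
      fix w assume "w \<in> frontier ?U"
      then have "F w \<in> B" using J(4) l(3) K_D(2) by blast
      then show "norm (F w - complex_of_real e / 2) \<le> 1"
        by (simp add: dist_norm norm_minus_commute)
    qed (use J z in auto)
    \<comment> \<open>The lower bound needs a Moebius map that takes the exterior of the circle to a
      disc. Its pole is placed at 0, a value that \<open>F\<close> is known to omit, whereas the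
      centre e / 2 is not excluded at this point. The circle is the locus |3 + 2 e w| = 4 |w|, and
      outside it the quotient has modulus less than 4.\<close>
    have 2: "norm ((3 + 2 * complex_of_real e * F z) / F z) \<le> 4"
    proof (rule maximum_modulus_frontier[where f = "\<lambda>z. (3 + 2 * complex_of_real e * F z) / F z" and S = ?U])
      show "(\<lambda>z. (3 + 2 * complex_of_real e * F z) / F z) holomorphic_on interior ?U"
        unfolding int using nzU by (intro holomorphic_intros holU)
      show "continuous_on (closure ?U) (\<lambda>z. (3 + 2 * complex_of_real e * F z) / F z)"
        using nz by (intro continuous_intros cont) auto
      fix w assume "w \<in> frontier ?U"
      then have w: "F w \<in> B" using J(4) l(3) K_D(2) by blast
      have "(norm (3 + 2 * complex_of_real e * F w))\<^sup>2 = (4 * norm (F w))\<^sup>2"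
        using w unfolding norm3 in_B_iff by (simp add: power_mult_distrib)
      then have "norm (3 + 2 * complex_of_real e * F w) = 4 * norm (F w)"
        by (rule power2_eq_imp_eq) auto
      then show "norm ((3 + 2 * complex_of_real e * F w) / F w) \<le> 4"
        by (simp add: norm_divide divide_le_eq)
    qed (use J z in auto)
    have "norm (3 + 2 * complex_of_real e * F z) \<le> 4 * norm (F z)"
      using 2 nzU[OF z] by (simp add: norm_divide divide_le_eq)
    then have "(norm (3 + 2 * complex_of_real e * F z))\<^sup>2 \<le> (4 * norm (F z))\<^sup>2"
      by (intro power_mono) auto
    then have "(norm (F z))\<^sup>2 \<ge> e * Re (F z) + 3 / 4"
      unfolding norm3 by (simp add: power_mult_distrib)
    moreover have "(norm (F z - complex_of_real e / 2))\<^sup>2 \<le> 1"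
      using 1 by (simp add: power_le_one)
    then have "(norm (F z))\<^sup>2 - e * Re (F z) + 1 / 4 \<le> 1"
      unfolding cmod_power2 using e_square by (simp add: power2_eq_square algebra_simps e_cancel)
    ultimately show ?thesis unfolding in_B_iff by linarith
  qed
  \<comment> \<open>No critical value lies on the circle, so \<open>F\<close> is locally open at z,
    but the circle contains no nonempty open set.\<close>
  obtain z where z: "z \<in> ?U" using J(1) by blast
  have "z\<^sup>2 + b \<noteq> 0" using np' z closure_subset by blast
  then have "deriv F z \<noteq> 0" using fibre_card(2)[OF B_neq[OF FB[OF z]], of z] by blast
  then obtain \<rho> where \<rho>: "\<rho> > 0" "ball z \<rho> \<subseteq> ?U" "open (F ` ball z \<rho>)"
    using has_complex_derivative_locally_invertible[OF holU z J(2)] by metis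
  have "F ` ball z \<rho> \<subseteq> B" using \<rho>(2) FB by blast
  then have "F ` ball z \<rho> = {}" by (rule open_subset_sphere_empty[OF \<rho>(3)])
  then show False using \<rho>(1) by simp
qed

lemma K_imaginary:
  assumes "imag t \<in> K"
  shows "t \<noteq> 0" "t\<^sup>2 \<noteq> b" "\<bar>t ^ 3 * (1 + t\<^sup>2) / (C * (b - t\<^sup>2) ^ 3)\<bar> = sqrt (3 / 4)"
proof -
  let ?v = "t ^ 3 * (1 + t\<^sup>2) / (C * (b - t\<^sup>2) ^ 3)"
  have "(imag t)\<^sup>2 + b = complex_of_real (b - t\<^sup>2)" by (simp add: power_mult_distrib)
  then show "t\<^sup>2 \<noteq> b" using K_D(1)[OF assms] by auto
  have "F (imag t) \<in> B" by (rule K_D(2)[OF assms])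
  moreover have "norm (- \<i> * complex_of_real x) = \<bar>x\<bar>" "Re (- \<i> * complex_of_real x) = 0" for x
    by (simp_all add: norm_mult)
  ultimately have v: "?v\<^sup>2 = 3 / 4" unfolding F_imaginary in_B_iff by (simp only: power2_abs)
  then have "\<bar>?v\<bar> = sqrt (3 / 4)" by (metis real_sqrt_abs)
  then show "\<bar>?v\<bar> = sqrt (3 / 4)" .
  show "t \<noteq> 0" using v by auto
qed

text \<open>On either side of the pole the modulus of \<open>F\<close> is strictly monotone, and
  membership in K prescribes it.\<close>

lemma K_imaginary_unique:
  assumes st: "imag t \<in> K" "imag t' \<in> K" "t > 0" "t' > 0"
    and side: "t\<^sup>2 < b \<longleftrightarrow> t'\<^sup>2 < b"
  shows "t = t'"
proof -
  have False if xy: "x < y" "imag x \<in> K" "imag y \<in> K" "x > 0" "x\<^sup>2 < b \<longleftrightarrow> y\<^sup>2 < b" for x y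
  proof (cases "x\<^sup>2 < b")
    case True
    then have y: "y\<^sup>2 < b" using xy by simp
    have "0 \<le> x ^ 3 * (1 + x\<^sup>2) / (C * (b - x\<^sup>2) ^ 3)" "0 \<le> y ^ 3 * (1 + y\<^sup>2) / (C * (b - y\<^sup>2) ^ 3)"
      using True y xy C_pos by simp_all
    then show False
      using imaginary_increasing[OF xy(4,1) y] K_imaginary(3)[OF xy(2)] K_imaginary(3)[OF xy(3)] by simp
  next
    case False
    then have x: "b < x\<^sup>2" using K_imaginary(2)[OF xy(2)] by simp
    have y: "b < y\<^sup>2" using K_imaginary(2)[OF xy(3)] False xy(5) by simp
    have eq: "\<bar>t ^ 3 * (1 + t\<^sup>2) / (C * (b - t\<^sup>2) ^ 3)\<bar> = t ^ 3 * (1 + t\<^sup>2) / (C * (t\<^sup>2 - b) ^ 3)"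
      if "b < t\<^sup>2" "t > 0" for t
    proof -
      have "(b - t\<^sup>2) ^ 3 = - ((t\<^sup>2 - b) ^ 3)" by algebra
      then have "t ^ 3 * (1 + t\<^sup>2) / (C * (b - t\<^sup>2) ^ 3) = - (t ^ 3 * (1 + t\<^sup>2) / (C * (t\<^sup>2 - b) ^ 3))"
        by simp
      moreover have "0 \<le> t ^ 3 * (1 + t\<^sup>2) / (C * (t\<^sup>2 - b) ^ 3)" using that C_pos by simp
      ultimately show ?thesis by (simp only: abs_minus_cancel abs_of_nonneg)
    qed
    show False
      using imaginary_decreasing[OF xy(4,1) x] K_imaginary(3)[OF xy(2)] K_imaginary(3)[OF xy(3)]
        eq[OF x xy(4)] eq[OF y] xy(1,4) by simp
  qed
  from this[of t t'] this[of t' t] show ?thesis using st side by (cases t t' rule: linorder_cases) auto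
qed

end

section \<open>Conjugation symmetry and the number of components\<close>

context pcf_curve
begin

lemma beta_0: "cc.beta 0 = complex_of_real (- e / 2)"
  by (simp add: cc.beta_def)

lemma cnj_beta: "cnj (cc.beta t) = cc.beta (- t)"
  by (simp add: cc.beta_def flip: cis_cnj)

lemma cnj_K: "z \<in> K \<Longrightarrow> cnj z \<in> K"
proof -
  assume z: "z \<in> K"
  have "(cnj z)\<^sup>2 + complex_of_real b = cnj (z\<^sup>2 + complex_of_real b)" by simp
  then have "(cnj z)\<^sup>2 + complex_of_real b \<noteq> 0"
    using K_D(1)[OF z] by (simp only: complex_cnj_zero_iff) simp
  moreover have "F (cnj z) \<in> B"
    using K_D(2)[OF z] unfolding F_cnj in_B_iff by simp
  ultimately show ?thesis by (simp add: K_def del: mem_sphere)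
qed

definition real_lift :: "(real \<Rightarrow> complex) \<Rightarrow> bool" where
  "real_lift \<Gamma> \<longleftrightarrow> cc.lift \<Gamma> \<and> Im (\<Gamma> 0) = 0"

lemma lift_D: "cc.lift \<Gamma> \<Longrightarrow> \<Gamma> t \<in> K" "cc.lift \<Gamma> \<Longrightarrow> F (\<Gamma> t) = cc.beta t"
  by (auto simp: cc.lift_def)

text \<open>Conjugating a lift and reversing its parameter gives a lift; it has the same value at 0
  because that value is real.\<close>

lemma real_lift_cnj:
  assumes "real_lift \<Gamma>"
  shows "\<Gamma> (- t) = cnj (\<Gamma> t)"
proof -
  have \<Gamma>: "cc.lift \<Gamma>" "Im (\<Gamma> 0) = 0" using assms by (auto simp: real_lift_def)
  have "continuous_on UNIV \<Gamma>" using \<Gamma>(1) by (simp add: cc.lift_def)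
  moreover have "continuous_on UNIV (\<lambda>t::real. - t)" by (intro continuous_intros)
  ultimately have "continuous_on UNIV (\<lambda>t. \<Gamma> (- t))"
    by (rule continuous_on_compose2) simp
  then have "continuous_on UNIV (\<lambda>t. cnj (\<Gamma> (- t)))" by (intro continuous_intros)
  then have "cc.lift (\<lambda>t. cnj (\<Gamma> (- t)))"
    unfolding cc.lift_def by (simp add: cnj_K lift_D[OF \<Gamma>(1)] F_cnj cnj_beta)
  moreover have "cnj (\<Gamma> (- 0)) = \<Gamma> 0" using \<Gamma>(2) by (simp add: complex_eq_iff)
  ultimately have "cnj (\<Gamma> (- (- t))) = \<Gamma> (- t)"
    using cc.lift_unique[of "\<lambda>t. cnj (\<Gamma> (- t))" \<Gamma> 0 "- t"] \<Gamma>(1) by simp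
  then show ?thesis by simp
qed

lemma real_lift_range_cnj:
  assumes "real_lift \<Gamma>" "z \<in> range \<Gamma>"
  shows "cnj z \<in> range \<Gamma>"
proof -
  obtain t where "z = \<Gamma> t" using assms(2) by blast
  then have "cnj z = \<Gamma> (- t)" using real_lift_cnj[OF assms(1)] by simp
  then show ?thesis by blast
qed

text \<open>At a real point the parameters t and -t have the same image, so 2 t is a multiple of the
  full period and t is congruent to 0 or to half of it.\<close>

lemma real_lift_real_points:
  assumes \<Gamma>: "real_lift \<Gamma>" and z: "z \<in> range \<Gamma>" "Im z = 0"
  shows "z = \<Gamma> 0 \<or> z = \<Gamma> (pi * cc.period \<Gamma>)"
proof -
  have l: "cc.lift \<Gamma>" using \<Gamma> by (simp add: real_lift_def)
  obtain t where t: "z = \<Gamma> t" using z(1) by blast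
  have "\<Gamma> t = \<Gamma> (- t)" using real_lift_cnj[OF \<Gamma>, of t] z(2) t by (simp add: complex_eq_iff)
  then obtain n :: int where n: "t = - t + 2 * pi * cc.period \<Gamma> * n" using cc.lift_eq_iff[OF l] by blast
  then have t': "t = pi * cc.period \<Gamma> * n" by simp
  show ?thesis
  proof (cases "even n")
    case True
    then obtain m where "n = 2 * m" by (elim evenE)
    then have "t = 0 + 2 * pi * cc.period \<Gamma> * of_int m" using t' by simp
    then have "\<Gamma> t = \<Gamma> 0" using cc.lift_periodic[OF l, of 0 m] by simp
    then show ?thesis using t by simp
  next
    case False
    then obtain m where "n = 2 * m + 1" by (elim oddE)
    then have "t = pi * cc.period \<Gamma> + 2 * pi * cc.period \<Gamma> * of_int m" using t' by (simp add: algebra_simps)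
    then have "\<Gamma> t = \<Gamma> (pi * cc.period \<Gamma>)" using cc.lift_periodic[OF l] by simp
    then show ?thesis using t by simp
  qed
qed

text \<open>For an odd period the half-period point would be fixed by conjugation, hence real, and
  yet lie over 3 e / 2, the point opposite to the base point, which \<open>F\<close> does not take
  on the real line.\<close>

lemma real_lift_period_even:
  assumes \<Gamma>: "real_lift \<Gamma>"
  shows "even (cc.period \<Gamma>)"
proof (rule ccontr)
  assume odd: "odd (cc.period \<Gamma>)"
  have l: "cc.lift \<Gamma>" using \<Gamma> by (simp add: real_lift_def)
  let ?t = "pi * cc.period \<Gamma>"
  have "\<Gamma> (- ?t) = \<Gamma> ?t" using cc.lift_periodic[OF l, of "- ?t" 1] by simp
  then have im: "Im (\<Gamma> ?t) = 0" using real_lift_cnj[OF \<Gamma>, of ?t] by (simp add: complex_eq_iff)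
  have "cis ?t = -1"
    using odd cos_pi_eq_zero by (simp add: cis.ctr complex_eq_iff mult.commute cos_npi)
  then have "cc.beta ?t = complex_of_real (3 * e / 2)" by (simp add: cc.beta_def)
  then have F1: "F (\<Gamma> ?t) = complex_of_real (3 * e / 2)" using lift_D(2)[OF l] by simp
  have "\<Gamma> ?t = complex_of_real (Re (\<Gamma> ?t))" using im by (simp add: complex_eq_iff)
  then have "F (\<Gamma> ?t) = complex_of_real (Fr (Re (\<Gamma> ?t)))" using F_of_real[of "Re (\<Gamma> ?t)"] by simp
  also have "Fr (Re (\<Gamma> ?t)) = - e / 2" by (rule K_real[OF lift_D(1)[OF l] im])
  finally show False using F1 e by simp
qed

lemma lift_loop:
  assumes "cc.lift \<Gamma>"
  shows "simple_path (cc.loop \<Gamma>)" "pathfinish (cc.loop \<Gamma>) = pathstart (cc.loop \<Gamma>)"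
    "path_image (cc.loop \<Gamma>) = range \<Gamma>" "range \<Gamma> \<subseteq> K" "range \<Gamma> \<inter> slits = {}"
proof -
  show "range \<Gamma> \<subseteq> K" using lift_D(1)[OF assms] by blast
  then show "range \<Gamma> \<inter> slits = {}" using K_slits by blast
qed (use cc.loop[OF assms] in auto)

lemma pole_imaginary:
  fixes z :: complex
  assumes "z\<^sup>2 + b = 0"
  obtains \<sigma> :: real where "\<sigma> = 1 \<or> \<sigma> = -1" "z = complex_of_real (sqrt b) * (\<i> * complex_of_real \<sigma>)"
proof -
  let ?y = "\<i> * complex_of_real (sqrt b)"
  have "complex_of_real (sqrt b) ^ 2 = complex_of_real b"
    using b_pos by (simp flip: of_real_power)
  then have "(z - ?y) * (z + ?y) = z\<^sup>2 + b" by (simp add: algebra_simps power2_eq_square)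
  then have "z = ?y \<or> z = - ?y" using assms by (auto simp: eq_neg_iff_add_eq_0)
  then show ?thesis using that[of 1] that[of "-1"] by auto
qed

text \<open>Such a component encloses a pole but not 0. On the imaginary axis both the segment from
  0 to the pole and the ray from the pole to infinity lead from its inside to its outside, so it is
  crossed on either side of the pole.\<close>

lemma lift_not_enclosing:
  assumes "cc.lift \<Gamma>" "0 \<notin> inside (range \<Gamma>)"
  shows "\<exists>t t'. imag t \<in> range \<Gamma> \<and> imag t' \<in> range \<Gamma> \<and> t\<^sup>2 < b \<and> b < t'\<^sup>2"
proof -
  let ?C = "range \<Gamma>"
  note L = lift_loop[OF assms(1)]
  obtain z where z: "z \<in> inside ?C" "z\<^sup>2 + b = 0"
    using inside_zero_or_pole[OF L(1,2)] L(3,4) assms(2) by auto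
  obtain \<sigma> :: real where \<sigma>: "\<sigma> = 1 \<or> \<sigma> = -1" "z = complex_of_real (sqrt b) * (\<i> * complex_of_real \<sigma>)"
    using pole_imaginary[OF z(2)] by blast
  have \<sigma>2: "\<sigma>\<^sup>2 = 1" using \<sigma>(1) by auto
  have conv: "\<i> * complex_of_real (t * \<sigma>) = complex_of_real t * (\<i> * complex_of_real \<sigma>)" for t
    by (simp add: mult_ac)
  have "(\<lambda>t. complex_of_real t * (\<i> * complex_of_real \<sigma>)) ` {sqrt b..} \<inter> path_image (cc.loop \<Gamma>) \<noteq> {}"
  proof (rule connected_unbounded_meets[OF L(1,2) connected_ray(1)])
    show "\<not> bounded ((\<lambda>t. complex_of_real t * (\<i> * complex_of_real \<sigma>)) ` {sqrt b..})"
      by (rule unbounded_ray) (use \<sigma> in auto)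
    show "z \<in> (\<lambda>t. complex_of_real t * (\<i> * complex_of_real \<sigma>)) ` {sqrt b..}"
      using \<sigma>(2) by (rule image_eqI) simp
  qed (use z L(3) in simp)
  then obtain w' where w': "w' \<in> (\<lambda>t. complex_of_real t * (\<i> * complex_of_real \<sigma>)) ` {sqrt b..}" "w' \<in> ?C"
    unfolding L(3) by blast
  then obtain t' where "t' \<in> {sqrt b..}" "w' = complex_of_real t' * (\<i> * complex_of_real \<sigma>)" by blast
  then have t': "t' \<ge> sqrt b" "\<i> * complex_of_real (t' * \<sigma>) \<in> ?C"
    using w'(2) unfolding conv by simp_all
  let ?S = "(\<lambda>t. complex_of_real t * (\<i> * complex_of_real \<sigma>)) ` {0..sqrt b}"
  have "?S \<inter> path_image (cc.loop \<Gamma>) \<noteq> {}"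
  proof
    assume "?S \<inter> path_image (cc.loop \<Gamma>) = {}"
    then have "?S \<subseteq> inside ?C \<or> ?S \<subseteq> outside ?C"
      using connected_disjoint_inside_or_outside[OF L(1,2) connected_ray(2)] unfolding L(3) by blast
    moreover have "z \<in> ?S" using \<sigma>(2) by (rule image_eqI) (use b_pos in simp)
    moreover have "0 \<in> ?S" by (rule image_eqI[of _ _ 0]) (use b_pos in auto)
    ultimately show False
      using z(1) assms(2) Jordan_inside_outside[OF L(1,2)] unfolding L(3) by blast
  qed
  then obtain w where w: "w \<in> ?S" "w \<in> ?C" unfolding L(3) by blast
  then obtain t where "t \<in> {0..sqrt b}" "w = complex_of_real t * (\<i> * complex_of_real \<sigma>)" by blast
  then have t: "0 \<le> t" "t \<le> sqrt b" "\<i> * complex_of_real (t * \<sigma>) \<in> ?C"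
    using w(2) unfolding conv by simp_all
  have sq: "(t * \<sigma>)\<^sup>2 = t\<^sup>2" "(t' * \<sigma>)\<^sup>2 = t'\<^sup>2" using \<sigma>2 by (simp_all add: power_mult_distrib)
  have ne: "(t * \<sigma>)\<^sup>2 \<noteq> b" "(t' * \<sigma>)\<^sup>2 \<noteq> b"
    using K_imaginary(2) t(3) t'(2) L(4) by blast+
  have sb: "(sqrt b)\<^sup>2 = b" using b_pos by simp
  have "t\<^sup>2 \<le> b" using power_mono[OF t(2,1), of 2] sb by simp
  moreover have "b \<le> t'\<^sup>2" using power_mono[OF t'(1), of 2] b_pos sb by simp
  ultimately have "(t * \<sigma>)\<^sup>2 < b" "b < (t' * \<sigma>)\<^sup>2" using ne unfolding sq by linarith+
  then show ?thesis using t(3) t'(2) by blast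
qed

lemma lift_meets_imaginary:
  assumes "cc.lift \<Gamma>"
  shows "\<exists>t. imag t \<in> range \<Gamma>"
proof (cases "0 \<in> inside (range \<Gamma>)")
  case True
  have "(\<lambda>t. complex_of_real t * \<i>) ` {0..} \<inter> path_image (cc.loop \<Gamma>) \<noteq> {}"
  proof (rule connected_unbounded_meets[OF lift_loop(1,2)[OF assms] connected_ray(1)])
    show "\<not> bounded ((\<lambda>t. complex_of_real t * \<i>) ` {0..})" by (rule unbounded_ray) simp
    show "0 \<in> (\<lambda>t. complex_of_real t * \<i>) ` {0..}" by (rule image_eqI[of _ _ 0]) auto
  qed (use True lift_loop(3)[OF assms] in simp)
  then show ?thesis unfolding lift_loop(3)[OF assms] by (auto simp: mult.commute)
next
  case False
  then show ?thesis using lift_not_enclosing[OF assms] by blast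
qed

lemma imaginary_abs_unique:
  assumes "imag t \<in> K" "imag t' \<in> K" "t\<^sup>2 < b \<longleftrightarrow> t'\<^sup>2 < b"
  shows "\<bar>t\<bar> = \<bar>t'\<bar>"
proof (rule K_imaginary_unique)
  have "imag \<bar>x\<bar> \<in> K" if "imag x \<in> K" for x
    using that cnj_K[OF that] by (cases "x \<ge> 0") auto
  then show "imag \<bar>t\<bar> \<in> K" "imag \<bar>t'\<bar> \<in> K" using assms by auto
  show "\<bar>t\<bar> > 0" "\<bar>t'\<bar> > 0" using K_imaginary(1) assms by auto
  show "\<bar>t\<bar>\<^sup>2 < b \<longleftrightarrow> \<bar>t'\<bar>\<^sup>2 < b" using assms(3) by simp
qed

text \<open>With |t| below \<open>sqrt b\<close>, and likewise above, K has at most one conjugate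
  pair of imaginary points, and a component with a real base point contains with each point its
  conjugate.\<close>

lemma lift_meets_real_lift:
  assumes "cc.lift \<Gamma>" "real_lift \<Delta>"
    and "imag t \<in> range \<Gamma>" "imag t' \<in> range \<Delta>" "t\<^sup>2 < b \<longleftrightarrow> t'\<^sup>2 < b"
  shows "range \<Gamma> = range \<Delta>"
proof -
  have l: "cc.lift \<Delta>" using assms by (simp add: real_lift_def)
  have "imag t \<in> K" "imag t' \<in> K"
    using assms(3,4) lift_loop(4)[OF assms(1)] lift_loop(4)[OF l] by blast+
  then have "\<bar>t\<bar> = \<bar>t'\<bar>" using assms(5) by (rule imaginary_abs_unique)
  then have "t = t' \<or> t = - t'" by linarith
  then have "imag t \<in> range \<Delta>"
    using assms(4) real_lift_range_cnj[OF assms(2,4)] by auto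
  then show ?thesis using assms(3) cc.lift_ranges[OF assms(1) l] by blast
qed

text \<open>A component that does not enclose 0 uses the imaginary points on both sides of the pole
  and leaves none for the other component, which has to cross the axis as well.\<close>

lemma real_lift_encloses:
  assumes "real_lift \<Gamma>" "real_lift \<Delta>" "range \<Gamma> \<noteq> range \<Delta>"
  shows "0 \<in> inside (range \<Gamma>)"
proof (rule ccontr)
  assume "0 \<notin> inside (range \<Gamma>)"
  moreover have l: "cc.lift \<Gamma>" "cc.lift \<Delta>" using assms by (auto simp: real_lift_def)
  ultimately obtain t t' where t: "imag t \<in> range \<Gamma>" "imag t' \<in> range \<Gamma>" "t\<^sup>2 < b" "b < t'\<^sup>2"
    using lift_not_enclosing by blast
  obtain x where x: "imag x \<in> range \<Delta>" using lift_meets_imaginary[OF l(2)] by blast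
  show False
  proof (cases "x\<^sup>2 < b")
    case True
    then show False using lift_meets_real_lift[OF l(1) assms(2) t(1) x] t(3) assms(3) by blast
  next
    case False
    then show False using lift_meets_real_lift[OF l(1) assms(2) t(2) x] t(4) assms(3) by auto
  qed
qed

text \<open>Three real points lie over the base point, and each is the start of a lift, but one
  component has at most two real points.\<close>

lemma two_real_lifts: "\<exists>\<Gamma> \<Delta>. real_lift \<Gamma> \<and> real_lift \<Delta> \<and> range \<Gamma> \<noteq> range \<Delta>"
proof (rule ccontr)
  assume "\<not> ?thesis"
  then have same: "\<And>\<Gamma> \<Delta>. real_lift \<Gamma> \<Longrightarrow> real_lift \<Delta> \<Longrightarrow> range \<Gamma> = range \<Delta>" by blast
  have ex: "\<exists>\<Gamma>. real_lift \<Gamma> \<and> \<Gamma> 0 = complex_of_real (e * x)" if "Fr x = -1/2" for x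
  proof -
    have "Fr (e * x) = - e / 2" using e that Fr_minus[of x] by auto
    then have F: "F (complex_of_real (e * x)) = cc.beta 0" by (simp only: F_of_real beta_0)
    have "complex_of_real (- e / 2) \<in> B" using of_real_in_B_iff[of "- e / 2"] by blast
    then have "complex_of_real (e * x) \<in> K"
      using F real_not_pole[of "complex_of_real (e * x)"] by (simp only: K_def mem_Collect_eq beta_0) simp
    from cc.lift_exists[OF this F] obtain \<Gamma> where "cc.lift \<Gamma>" "\<Gamma> 0 = complex_of_real (e * x)" by blast
    then show ?thesis by (intro exI[of _ \<Gamma>]) (simp add: real_lift_def)
  qed
  obtain x1 x2 x3 where x: "Fr x1 = -1/2" "Fr x2 = -1/2" "Fr x3 = -1/2" "x1 < x2" "x2 < x3"
    using Fr_three_solutions by blast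
  obtain \<Gamma>1 \<Gamma>2 \<Gamma>3 where \<Gamma>: "real_lift \<Gamma>1" "\<Gamma>1 0 = complex_of_real (e * x1)"
    "real_lift \<Gamma>2" "\<Gamma>2 0 = complex_of_real (e * x2)" "real_lift \<Gamma>3" "\<Gamma>3 0 = complex_of_real (e * x3)"
    using ex[OF x(1)] ex[OF x(2)] ex[OF x(3)] by blast
  have "complex_of_real (e * x2) \<in> range \<Gamma>1" "complex_of_real (e * x3) \<in> range \<Gamma>1"
    using same[OF \<Gamma>(1,3)] same[OF \<Gamma>(1,5)] \<Gamma>(4,6) rangeI by metis+
  then have "complex_of_real (e * x2) = \<Gamma>1 0 \<or> complex_of_real (e * x2) = \<Gamma>1 (pi * cc.period \<Gamma>1)"
    "complex_of_real (e * x3) = \<Gamma>1 0 \<or> complex_of_real (e * x3) = \<Gamma>1 (pi * cc.period \<Gamma>1)"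
    using real_lift_real_points[OF \<Gamma>(1)] Im_complex_of_real by blast+
  then have "e * x2 = e * x1 \<or> e * x3 = e * x1 \<or> e * x2 = e * x3"
    unfolding \<Gamma>(2) by (metis of_real_eq_iff)
  then show False using x(4,5) e_square(3) by simp
qed

text \<open>Two components with real points occupy one side of the pole each, so no third component
  can cross the imaginary axis. Their periods are even, positive and add up to 6, hence are 4 and 2
  in some order.\<close>

lemma two_components:
  "\<exists>\<Gamma> \<Delta>. cc.lift \<Gamma> \<and> cc.lift \<Delta> \<and> range \<Gamma> \<noteq> range \<Delta> \<and> range ` {\<Gamma>. cc.lift \<Gamma>} = {range \<Gamma>, range \<Delta>} \<and>
     0 \<in> inside (range \<Gamma>) \<and> 0 \<in> inside (range \<Delta>) \<and> cc.period \<Gamma> = 4 \<and> cc.period \<Delta> = 2"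
proof -
  obtain \<Gamma> \<Delta> where gd: "real_lift \<Gamma>" "real_lift \<Delta>" "range \<Gamma> \<noteq> range \<Delta>" using two_real_lifts by blast
  have l: "cc.lift \<Gamma>" "cc.lift \<Delta>" using gd by (auto simp: real_lift_def)
  have disj: "range \<Gamma> \<inter> range \<Delta> = {}" using cc.lift_ranges[OF l] gd(3) by blast
  obtain t where t: "imag t \<in> range \<Gamma>" using lift_meets_imaginary[OF l(1)] by blast
  obtain t' where t': "imag t' \<in> range \<Delta>" using lift_meets_imaginary[OF l(2)] by blast
  have sides: "t\<^sup>2 < b \<longleftrightarrow> \<not> t'\<^sup>2 < b"
    using lift_meets_real_lift[OF l(1) gd(2) t t'] gd(3) by blast
  have other: "range \<Theta> = range \<Gamma> \<or> range \<Theta> = range \<Delta>" if \<Theta>: "cc.lift \<Theta>" for \<Theta>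
  proof -
    obtain x where x: "imag x \<in> range \<Theta>" using lift_meets_imaginary[OF \<Theta>] by blast
    show ?thesis
      using lift_meets_real_lift[OF \<Theta> gd(1) x t] lift_meets_real_lift[OF \<Theta> gd(2) x t'] sides by blast
  qed
  have all: "range ` {\<Gamma>. cc.lift \<Gamma>} = {range \<Gamma>, range \<Delta>}"
  proof (intro equalityI subsetI)
    fix U assume "U \<in> range ` {\<Gamma>. cc.lift \<Gamma>}"
    then obtain \<Theta> where "cc.lift \<Theta>" "U = range \<Theta>" by blast
    then show "U \<in> {range \<Gamma>, range \<Delta>}" using other[of \<Theta>] by blast
  qed (use l in blast)
  let ?base = "complex_of_real e / 2 + - complex_of_real e"
  have "K = range \<Gamma> \<union> range \<Delta>" using cc.Union_ranges unfolding all by simp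
  then have "{x \<in> K. F x = ?base} = {x \<in> range \<Gamma>. F x = ?base} \<union> {x \<in> range \<Delta>. F x = ?base}" by blast
  moreover have "finite {x \<in> range \<Gamma>. F x = ?base}" "finite {x \<in> range \<Delta>. F x = ?base}"
    unfolding cc.fibre_in_range(1)[OF l(1)] cc.fibre_in_range(1)[OF l(2)] by simp_all
  moreover have "{x \<in> range \<Gamma>. F x = ?base} \<inter> {x \<in> range \<Delta>. F x = ?base} = {}" using disj by blast
  ultimately have "card {x \<in> K. F x = ?base} = card {x \<in> range \<Gamma>. F x = ?base} + card {x \<in> range \<Delta>. F x = ?base}"
    by (simp only: card_Un_disjoint)
  then have sum: "cc.period \<Gamma> + cc.period \<Delta> = 6"
    unfolding cc.fibre_in_range(2)[OF l(1)] cc.fibre_in_range(2)[OF l(2)] base_fibre by simp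
  obtain j k where jk: "cc.period \<Gamma> = 2 * j" "cc.period \<Delta> = 2 * k"
    using real_lift_period_even[OF gd(1)] real_lift_period_even[OF gd(2)] by (elim evenE)
  moreover have "cc.period \<Gamma> > 0" "cc.period \<Delta> > 0" using cc.period(1) l by auto
  ultimately have per: "cc.period \<Gamma> = 4 \<and> cc.period \<Delta> = 2 \<or> cc.period \<Delta> = 4 \<and> cc.period \<Gamma> = 2"
    using sum by presburger
  have i: "0 \<in> inside (range \<Gamma>)" "0 \<in> inside (range \<Delta>)"
    by (rule real_lift_encloses[OF gd]) (rule real_lift_encloses[OF gd(2,1) gd(3)[symmetric]])
  have all': "range ` {\<Gamma>. cc.lift \<Gamma>} = {range \<Delta>, range \<Gamma>}" unfolding all by blast
  from per show ?thesis
  proof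
    assume "cc.period \<Gamma> = 4 \<and> cc.period \<Delta> = 2"
    then show ?thesis using l gd(3) all i by (intro exI[of _ \<Gamma>] exI[of _ \<Delta>] conjI) simp_all
  next
    assume "cc.period \<Delta> = 4 \<and> cc.period \<Gamma> = 2"
    then show ?thesis using l gd(3)[symmetric] all' i by (intro exI[of _ \<Delta>] exI[of _ \<Gamma>] conjI) simp_all
  qed
qed

end

section \<open>Homotopy classes of the curves\<close>

context pcf_curve
begin

definition "annulus = - slits"

text \<open>Radial projection to the curve of polar radius 1 + (e / 2) cos(theta). It crosses the
  real line at 3 e / 2 and - e / 2, that is, in the two gaps left by the slits.\<close>

definition retract :: "complex \<Rightarrow> complex" where
  "retract z = complex_of_real ((1 + e * Re z / (2 * norm z)) / norm z) * z"

lemma retract_factor_pos: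
  assumes "z \<noteq> 0"
  shows "1 + e * Re z / (2 * norm z) > 0"
proof -
  have "\<bar>e * Re z\<bar> \<le> norm z" using e_square abs_Re_le_cmod[of z] by (simp add: abs_mult)
  then have "\<bar>e * Re z / (2 * norm z)\<bar> \<le> 1 / 2"
    using assms by (simp add: abs_divide divide_le_eq)
  then show ?thesis by linarith
qed

lemma continuous_on_retract: "continuous_on (- {0}) retract"
  unfolding retract_def[abs_def] by (intro continuous_intros) auto

lemma scaled_in_annulus:
  assumes z: "z \<noteq> 0" and k: "k > 0"
    and right: "Im z = 0 \<Longrightarrow> e * Re z > 0 \<Longrightarrow> k * (e * Re z) > 1"
    and left: "Im z = 0 \<Longrightarrow> e * Re z < 0 \<Longrightarrow> k * (e * Re z) > -1"
  shows "complex_of_real k * z \<in> annulus"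
proof (rule ccontr)
  assume "complex_of_real k * z \<notin> annulus"
  then have im: "k * Im z = 0" and re: "k * (e * Re z) \<le> -1 \<or> 0 \<le> k * (e * Re z) \<and> k * (e * Re z) \<le> 1"
    by (auto simp: annulus_def slits_def mult_ac)
  have im0: "Im z = 0" using im k by simp
  then have "e * Re z \<noteq> 0" using z e_square by (simp add: complex_eq_iff)
  then consider "e * Re z > 0" | "e * Re z < 0" by linarith
  then show False
  proof cases
    case 1
    then have "k * (e * Re z) > 0" using k by simp
    then show False using right[OF im0 1] re by linarith
  next
    case 2
    then have "k * (e * Re z) < 0" using k by (simp add: mult_pos_neg)
    then show False using left[OF im0 2] re by linarith
  qed
qed

lemma real_norm:
  assumes "Im z = 0"
  shows "e * Re z > 0 \<Longrightarrow> norm z = e * Re z" "e * Re z < 0 \<Longrightarrow> norm z = - (e * Re z)"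
proof -
  have "norm z = \<bar>e * Re z\<bar>" using assms e_square by (simp add: cmod_eq_Re abs_mult)
  then show "e * Re z > 0 \<Longrightarrow> norm z = e * Re z" "e * Re z < 0 \<Longrightarrow> norm z = - (e * Re z)" by auto
qed

lemma retract_real:
  assumes "Im z = 0"
  shows "e * Re z > 0 \<Longrightarrow> (1 + e * Re z / (2 * norm z)) / norm z * (e * Re z) = 3 / 2"
    "e * Re z < 0 \<Longrightarrow> (1 + e * Re z / (2 * norm z)) / norm z * (e * Re z) = - 1 / 2"
proof -
  assume a: "e * Re z > 0"
  define x where "x = e * Re z"
  show "(1 + e * Re z / (2 * norm z)) / norm z * (e * Re z) = 3 / 2"
    using a unfolding real_norm(1)[OF assms a] x_def[symmetric] by (simp add: field_simps)
next
  assume a: "e * Re z < 0"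
  define x where "x = e * Re z"
  show "(1 + e * Re z / (2 * norm z)) / norm z * (e * Re z) = - 1 / 2"
    using a unfolding real_norm(2)[OF assms a] x_def[symmetric] by (simp add: field_simps)
qed

lemma retract_in_annulus: "z \<noteq> 0 \<Longrightarrow> retract z \<in> annulus"
  unfolding retract_def
proof (rule scaled_in_annulus)
  assume z: "z \<noteq> 0"
  then show "0 < (1 + e * Re z / (2 * norm z)) / norm z" using retract_factor_pos by simp
  show "1 < (1 + e * Re z / (2 * norm z)) / norm z * (e * Re z)" if "Im z = 0" "0 < e * Re z"
    unfolding retract_real(1)[OF that] by simp
  show "-1 < (1 + e * Re z / (2 * norm z)) / norm z * (e * Re z)" if "Im z = 0" "e * Re z < 0"
    unfolding retract_real(2)[OF that] by simp
qed

lemma zero_not_annulus: "0 \<notin> annulus"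
  by (simp add: annulus_def slits_def)

lemma convex_gt:
  fixes t x y c :: real
  assumes "0 \<le> t" "t \<le> 1" "x > c" "y > c"
  shows "(1 - t) * x + t * y > c"
  using convex_bound_lt[of "- x" "- c" "- y" "1 - t" t] assms by simp

text \<open>The segment is radial and the slits are real, so only real z matter. There z and its
  projection lie in the same gap, and the gaps are convex.\<close>

lemma segment_retract:
  assumes "z \<in> annulus"
  shows "closed_segment z (retract z) \<subseteq> annulus"
proof
  have z: "z \<noteq> 0" using assms zero_not_annulus by auto
  define m where "m = (1 + e * Re z / (2 * norm z)) / norm z"
  have m: "m > 0" using retract_factor_pos[OF z] z by (simp add: m_def)
  fix w assume "w \<in> closed_segment z (retract z)"
  then obtain t where t: "0 \<le> t" "t \<le> 1" "w = (1 - t) *\<^sub>R z + t *\<^sub>R retract z"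
    by (auto simp: in_segment)
  have w: "w = complex_of_real (1 - t + t * m) * z"
    unfolding t(3) retract_def m_def[symmetric] by (simp add: scaleR_conv_of_real algebra_simps)
  have not: "\<not> (Im z = 0 \<and> (e * Re z \<le> -1 \<or> 0 \<le> e * Re z \<and> e * Re z \<le> 1))"
    using assms by (simp add: annulus_def slits_def)
  show "w \<in> annulus"
    unfolding w
  proof (rule scaled_in_annulus[OF z])
    have expand: "(1 - t + t * m) * y = (1 - t) * y + t * (m * y)" for y
      by (simp add: algebra_simps)
    show "1 - t + t * m > 0"
      using convex_gt[OF t(1,2), of 0 1 m] m by simp
    show "(1 - t + t * m) * (e * Re z) > 1" if a: "Im z = 0" "e * Re z > 0"
    proof -
      have "m * (e * Re z) = 3 / 2" unfolding m_def by (rule retract_real(1)[OF a])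
      moreover have "e * Re z > 1" using not a by linarith
      ultimately show ?thesis unfolding expand by (intro convex_gt[OF t(1,2)]) simp_all
    qed
    show "(1 - t + t * m) * (e * Re z) > -1" if a: "Im z = 0" "e * Re z < 0"
    proof -
      have "m * (e * Re z) = - 1 / 2" unfolding m_def by (rule retract_real(2)[OF a])
      moreover have "e * Re z > -1" using not a by linarith
      ultimately show ?thesis unfolding expand by (intro convex_gt[OF t(1,2)]) simp_all
    qed
  qed
qed

lemma homotopic_loops_retract:
  assumes g: "path g" "pathfinish g = pathstart g" "path_image g \<subseteq> annulus"
  shows "homotopic_loops annulus g (retract \<circ> g)"
proof (rule homotopic_loops_linear)
  have "path_image g \<subseteq> - {0}" using g(3) zero_not_annulus by blast
  then show "path (retract \<circ> g)"
    by (intro path_continuous_image g(1) continuous_on_subset[OF continuous_on_retract])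
  show "pathfinish (retract \<circ> g) = pathstart (retract \<circ> g)"
    using g(2) by (simp add: pathfinish_compose pathstart_compose)
  fix t :: real assume "t \<in> {0..1}"
  then have "g t \<in> annulus" using g(3) by (auto simp: path_image_def)
  then show "closed_segment (g t) ((retract \<circ> g) t) \<subseteq> annulus" using segment_retract by simp
qed (use g in auto)

text \<open>In the punctured plane loops are classified by the winding number about 0. The
  projection carries the resulting homotopy into the annulus, where each loop is homotopic to its
  own projection.\<close>

lemma homotopic_loops_annulus:
  assumes g: "path g" "pathfinish g = pathstart g" "path_image g \<subseteq> annulus"
    and h: "path h" "pathfinish h = pathstart h" "path_image h \<subseteq> annulus"
    and w: "winding_number g 0 = winding_number h 0"
  shows "homotopic_loops annulus g h"
proof -
  have "0 \<notin> path_image g" "0 \<notin> path_image h" using g(3) h(3) zero_not_annulus by auto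
  then have "homotopic_loops (- {0}) g h"
    using winding_number_homotopic_loops_eq[OF g(1) _ h(1) _ g(2) h(2), of 0] w by blast
  moreover have "retract \<in> - {0} \<rightarrow> annulus" using retract_in_annulus by auto
  ultimately have "homotopic_loops annulus (retract \<circ> g) (retract \<circ> h)"
    by (rule homotopic_loops_continuous_image[OF _ continuous_on_retract])
  then show ?thesis
    using homotopic_loops_retract[OF g] homotopic_loops_retract[OF h] homotopic_loops_sym homotopic_loops_trans by blast
qed

text \<open>A simple loop winds once in one of the two directions, and reversal does not change its
  image, which is all that an unoriented curve records.\<close>

lemma good_loop_normalized:
  assumes "good_loop g"
  obtains h where "good_loop h" "path_image h = path_image g" "winding_number h 0 = 1"
proof -
  have g: "simple_path g" "pathfinish g = pathstart g" "path_image g \<inter> slits = {}" "0 \<in> inside (path_image g)"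
    using assms by (auto simp: good_loop_def)
  have 0: "0 \<notin> path_image g" using g(4) inside_no_overlap by blast
  from simple_closed_path_winding_number_inside[OF g(1)] g(4)
  have "winding_number g 0 = 1 \<or> winding_number g 0 = -1" by metis
  then show ?thesis
  proof
    assume "winding_number g 0 = 1"
    then show ?thesis using that assms by blast
  next
    assume "winding_number g 0 = -1"
    then have "winding_number (reversepath g) 0 = 1"
      using winding_number_reversepath[OF simple_path_imp_path[OF g(1)] 0] by simp
    moreover have "good_loop (reversepath g)"
      using g by (simp add: good_loop_def simple_path_reversepath)
    ultimately show ?thesis using that[of "reversepath g"] by simp
  qed
qed

lemma P_eq: "P = insert None (Some ` {0, complex_of_real e, - complex_of_real e})"
  using e by (auto simp: P_def)

lemma P_slits: "{0, complex_of_real e, - complex_of_real e} \<subseteq> slits"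
  using e_square by (auto simp: slits_def)

lemma homotopic_rel_good_loops:
  assumes "good_loop g" "good_loop h"
  shows "homotopic_rel P (Some ` path_image g) (Some ` path_image h)"
proof -
  obtain g' where g': "good_loop g'" "path_image g' = path_image g" "winding_number g' 0 = 1"
    using good_loop_normalized[OF assms(1)] by blast
  obtain h' where h': "good_loop h'" "path_image h' = path_image h" "winding_number h' 0 = 1"
    using good_loop_normalized[OF assms(2)] by blast
  have g: "simple_path g'" "pathfinish g' = pathstart g'" "path_image g' \<subseteq> annulus"
    using g'(1) by (auto simp: good_loop_def annulus_def)
  have h: "simple_path h'" "pathfinish h' = pathstart h'" "path_image h' \<subseteq> annulus"
    using h'(1) by (auto simp: good_loop_def annulus_def)
  have "homotopic_loops annulus g' h'"
    by (rule homotopic_loops_annulus)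
       (use g h g'(3) h'(3) simple_path_imp_path in auto)
  moreover have "Some ` annulus \<inter> P = {}"
    unfolding P_eq annulus_def using P_slits by auto
  ultimately have "homotopic_rel P (Some ` path_image g') (Some ` path_image h')"
    by (rule homotopic_rel_loops[OF g(1,2) h(1,2)])
  then show ?thesis using g'(2) h'(2) by simp
qed

lemma good_loop_components:
  assumes "good_loop g"
  obtains U V where "components_in_sphere (- (Some ` path_image g)) = {U, V}" "U \<noteq> V"
    "{Some 0, Some (complex_of_real e)} \<subseteq> U" "{Some (- complex_of_real e), None} \<subseteq> V"
proof -
  have g: "simple_path g" "pathfinish g = pathstart g" "path_image g \<inter> slits = {}" "0 \<in> inside (path_image g)"
    using assms by (auto simp: good_loop_def)
  let ?U = "Some ` inside (path_image g)" and ?V = "insert None (Some ` outside (path_image g))"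
  have "components_in_sphere (- (Some ` path_image g)) = {?U, ?V}"
    by (rule components_in_sphere_compl[OF g(1,2)])
  moreover have "?U \<noteq> ?V" by auto
  moreover have "{Some 0, Some (complex_of_real e)} \<subseteq> ?U"
    using g(4) inner_slit_same_side[OF g(1,2,3)] by auto
  moreover have "{Some (- complex_of_real e), None} \<subseteq> ?V"
    using outer_slit_outside[OF g(1,2,3)] by auto
  ultimately show ?thesis by (rule that)
qed

lemma good_loop_separates:
  assumes "good_loop g"
  shows "separates (Some ` path_image g) {Some 0, Some (complex_of_real e)} {Some (- complex_of_real e), None}"
  using good_loop_components[OF assms] unfolding separates_def by (metis insertI1 insertI2)

lemma good_loop_essential:
  assumes "good_loop g"
  shows "essential_curve f (Some ` path_image g)"
  unfolding essential_curve_def postcritical_set_f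
proof (intro conjI ballI)
  show "jordan_curve (Some ` path_image g)"
    using jordan_param_circle_param assms unfolding jordan_curve_def good_loop_def by blast
  show "Some ` path_image g \<inter> P = {}"
    using assms P_slits unfolding P_eq good_loop_def by auto
  obtain U V where UV: "components_in_sphere (- (Some ` path_image g)) = {U, V}"
    "{Some 0, Some (complex_of_real e)} \<subseteq> U" "{Some (- complex_of_real e), None} \<subseteq> V"
    using good_loop_components[OF assms] by metis
  fix W assume "W \<in> components_in_sphere (- (Some ` path_image g))"
  then consider "W = U" | "W = V" using UV(1) by blast
  then show "\<exists>a b. a \<noteq> b \<and> {a, b} \<subseteq> W \<inter> P"
  proof cases
    case 1
    then show ?thesis using UV(2) e_square
      by (intro exI[of _ "Some 0"] exI[of _ "Some (complex_of_real e)"]) (auto simp: P_eq)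
  next
    case 2
    then show ?thesis using UV(3)
      by (intro exI[of _ "Some (- complex_of_real e)"] exI[of _ None]) (auto simp: P_eq)
  qed
qed

lemma good_loop_circle: "good_loop (circlepath (complex_of_real e / 2) 1)"
proof -
  have "path_image (circlepath (complex_of_real e / 2) 1) = B" by simp
  moreover have "B \<inter> slits = {}"
  proof (rule ccontr)
    assume "B \<inter> slits \<noteq> {}"
    then obtain z where z: "z \<in> B" "z \<in> slits" by blast
    have "z = complex_of_real (Re z)" using z(2) by (simp add: slits_def complex_eq_iff)
    then have "Re z = - e / 2 \<or> Re z = 3 * e / 2" using z(1) of_real_in_B_iff[of "Re z"] by simp
    then show False using z(2) e by (auto simp: slits_def)
  qed
  moreover have "0 \<in> inside B"
  proof -
    have "inside B = ball (complex_of_real e / 2) 1"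
      using inside_frontier_eq_interior[of "cball (complex_of_real e / 2) 1"] by simp
    then show ?thesis using e_square by (simp add: norm_divide)
  qed
  ultimately show ?thesis
    unfolding good_loop_def by (simp add: simple_path_circlepath)
qed

definition curve :: "csphere set" where "curve = Some ` B"

lemma preimage_curve: "f -` curve = Some ` K"
proof -
  have "z \<in> f -` curve \<longleftrightarrow> z \<in> Some ` K" for z
  proof (cases z)
    case None
    have "0 \<notin> B" by (rule B_avoids(1))
    then show ?thesis using None by (auto simp: f_None curve_def)
  next
    case (Some w)
    then show ?thesis by (auto simp: f_Some curve_def K_def)
  qed
  then show ?thesis by blast
qed

lemma curve_properties:
  "characteristic_curve f curve \<and>
   (\<exists>\<gamma>\<^sub>1 \<gamma>\<^sub>2. \<gamma>\<^sub>1 \<noteq> \<gamma>\<^sub>2 \<and> components_in_sphere (f -` curve) = {\<gamma>\<^sub>1, \<gamma>\<^sub>2} \<and>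
      essential_curve f \<gamma>\<^sub>1 \<and> homotopic_rel (postcritical_set f) \<gamma>\<^sub>1 curve \<and>
      essential_curve f \<gamma>\<^sub>2 \<and> homotopic_rel (postcritical_set f) \<gamma>\<^sub>2 curve \<and>
      maps_onto_with_degree f \<gamma>\<^sub>1 curve 4 \<and> maps_onto_with_degree f \<gamma>\<^sub>2 curve 2)"
proof -
  obtain \<Gamma> \<Delta> where l: "cc.lift \<Gamma>" "cc.lift \<Delta>" and ne: "range \<Gamma> \<noteq> range \<Delta>"
    and all: "range ` {\<Gamma>. cc.lift \<Gamma>} = {range \<Gamma>, range \<Delta>}"
    and i: "0 \<in> inside (range \<Gamma>)" "0 \<in> inside (range \<Delta>)" and per: "cc.period \<Gamma> = 4" "cc.period \<Delta> = 2"
    using two_components by (elim exE conjE)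
  have good: "good_loop (cc.loop \<Theta>)" if "cc.lift \<Theta>" "0 \<in> inside (range \<Theta>)" for \<Theta>
    using lift_loop[OF that(1)] that(2) by (simp add: good_loop_def)
  have circ: "path_image (circlepath (complex_of_real e / 2) 1) = B" by simp
  have hom: "homotopic_rel P (Some ` range \<Theta>) curve" "essential_curve f (Some ` range \<Theta>)"
    if "cc.lift \<Theta>" "0 \<in> inside (range \<Theta>)" for \<Theta>
    using homotopic_rel_good_loops[OF good[OF that] good_loop_circle] good_loop_essential[OF good[OF that]]
    unfolding lift_loop(3)[OF that(1)] circ curve_def by auto
  have fK: "f (Some z) = Some (F z)" if "z \<in> K" for z
    using K_D(1)[OF that] by (simp add: f_Some)
  have nu: "norm (- complex_of_real e) = 1" using e_square by simp
  have cov: "maps_onto_with_degree f (Some ` range \<Theta>) curve (cc.period \<Theta>)" if "cc.lift \<Theta>" for \<Theta>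
    using cc.maps_onto_with_degree_range[OF that fK] unfolding nu curve_def .
  have comps: "components_in_sphere (f -` curve) = {Some ` range \<Gamma>, Some ` range \<Delta>}"
    unfolding preimage_curve cc.components_in_sphere_K all by simp
  have ne': "Some ` range \<Gamma> \<noteq> Some ` range \<Delta>" using ne by (simp add: inj_image_eq_iff)
  have ess: "essential_curve f curve"
    using good_loop_essential[OF good_loop_circle] unfolding circ curve_def .
  have "characteristic_curve f curve"
    unfolding characteristic_curve_def comps postcritical_set_f
  proof (intro conjI ess ballI)
    fix \<gamma> assume "\<gamma> \<in> {Some ` range \<Gamma>, Some ` range \<Delta>}"
    then show "homotopic_rel P \<gamma> curve" using hom(1)[OF l(1) i(1)] hom(1)[OF l(2) i(2)] by blast
  next
    show "\<exists>\<gamma>\<in>{Some ` range \<Gamma>, Some ` range \<Delta>}. \<exists>\<delta>\<in>{Some ` range \<Gamma>, Some ` range \<Delta>}. \<gamma> \<noteq> \<delta>"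
      by (rule bexI[of _ "Some ` range \<Gamma>"], rule bexI[of _ "Some ` range \<Delta>"], rule ne') simp_all
  qed
  moreover have "maps_onto_with_degree f (Some ` range \<Gamma>) curve 4" "maps_onto_with_degree f (Some ` range \<Delta>) curve 2"
    using cov[OF l(1)] cov[OF l(2)] per by simp_all
  ultimately show ?thesis
    unfolding postcritical_set_f
    using comps ne' hom[OF l(1) i(1)] hom[OF l(2) i(2)]
    by (intro conjI exI[of _ "Some ` range \<Gamma>"] exI[of _ "Some ` range \<Delta>"])
qed

lemma curve_separates:
  "separates curve {Some 0, Some (complex_of_real e)} {Some (- complex_of_real e), None}"
  using good_loop_separates[OF good_loop_circle] by (simp add: curve_def)

end

lemma (in pcf_map) curves_not_homotopic:
  "\<not> homotopic_rel P (Some ` sphere (1 / 2 :: complex) 1) (Some ` sphere (- 1 / 2 :: complex) 1)"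
proof
  have P: "P = insert None (Some ` {0, 1, -1})" by (auto simp: P_def)
  assume "homotopic_rel P (Some ` sphere (1 / 2 :: complex) 1) (Some ` sphere (- 1 / 2 :: complex) 1)"
  then obtain g h where g: "simple_path g" "pathfinish g = pathstart g" "path_image g = sphere (1 / 2 :: complex) 1"
    and h: "simple_path h" "pathfinish h = pathstart h" "path_image h = sphere (- 1 / 2 :: complex) 1"
    and hom: "homotopic_loops (- {0, 1, -1}) g h"
    unfolding P by (rule homotopic_rel_imp_loops)
  \<comment> \<open>Of the finite punctures only 1 is kept: it is enclosed by the first circle and
    lies outside the second.\<close>
  have "homotopic_loops (- {1}) g h"
    by (rule homotopic_loops_subset[OF hom]) auto
  then have "winding_number g 1 = winding_number h 1"
    by (rule winding_number_homotopic_loops)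
  moreover have "1 \<in> inside (path_image g)"
    unfolding g(3) using inside_frontier_eq_interior[of "cball (1 / 2 :: complex) 1"] by (simp add: dist_norm)
  then have "winding_number g 1 = 1 \<or> winding_number g 1 = -1"
    using simple_closed_path_winding_number_inside[OF g(1)] by metis
  moreover have "winding_number h 1 = 0"
  proof (rule winding_number_zero_outside[where s = "cball (- 1 / 2 :: complex) 1"])
    show "1 \<notin> cball (- 1 / 2 :: complex) 1" by (simp add: dist_norm)
    show "path_image h \<subseteq> cball (- 1 / 2 :: complex) 1" using h(3) by auto
  qed (use h simple_path_imp_path in auto)
  ultimately show False by auto
qed

section \<open>Lattes maps\<close>

lemma countable_lattice:
  assumes "complex_lattice \<Lambda>"
  shows "countable \<Lambda>" "0 \<in> \<Lambda>"
proof -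
  obtain w1 w2 where L: "\<Lambda> = {of_int m * w1 + of_int n * w2 |m n. True}"
    using assms unfolding complex_lattice_def by blast
  have "\<Lambda> = (\<lambda>(m, n). of_int m * w1 + of_int n * w2) ` (UNIV :: (int \<times> int) set)"
    unfolding L by auto
  then show "countable \<Lambda>" by (metis countable_image countableI_type)
  show "0 \<in> \<Lambda>" unfolding L by (rule CollectI, rule exI[of _ 0], rule exI[of _ 0]) simp
qed

text \<open>The order of a zero as a relation, parallel to \<open>has_local_degree\<close>; it
  includes that the map has finite values near z.\<close>

definition vanishing_order :: "(complex \<Rightarrow> csphere) \<Rightarrow> complex \<Rightarrow> nat \<Rightarrow> bool" where
  "vanishing_order \<Theta> z m \<longleftrightarrow>
     (\<exists>h. h analytic_on {0} \<and> h 0 \<noteq> 0 \<and> (\<forall>\<^sub>F t in nhds 0. \<Theta> (z + t) = Some (t ^ m * h t)))"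

lemma vanishing_order_unique:
  assumes "vanishing_order \<Theta> z m" "vanishing_order \<Theta> z n"
  shows "m = n"
proof -
  obtain h where h: "h analytic_on {0}" "h 0 \<noteq> 0" "\<forall>\<^sub>F t in nhds 0. \<Theta> (z + t) = Some (t ^ m * h t)"
    using assms(1) unfolding vanishing_order_def by blast
  obtain k where k: "k analytic_on {0}" "k 0 \<noteq> 0" "\<forall>\<^sub>F t in nhds 0. \<Theta> (z + t) = Some (t ^ n * k t)"
    using assms(2) unfolding vanishing_order_def by blast
  have "zorder (\<lambda>t. the (\<Theta> (z + t))) 0 = int m"
    by (rule zorder_power_mult[OF h(1,2)]) (use h(3) in eventually_elim, simp)
  moreover have "zorder (\<lambda>t. the (\<Theta> (z + t))) 0 = int n"
    by (rule zorder_power_mult[OF k(1,2)]) (use k(3) in eventually_elim, simp)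
  ultimately show ?thesis by simp
qed

lemma vanishing_order_periodic:
  assumes "\<And>z. \<Theta> (z + w) = \<Theta> z"
  shows "vanishing_order \<Theta> (z + w) m \<longleftrightarrow> vanishing_order \<Theta> z m"
proof -
  have "\<Theta> (z + w + t) = \<Theta> (z + t)" for t
    using assms[of "z + t"] by (simp add: add_ac)
  then show ?thesis by (simp add: vanishing_order_def)
qed

text \<open>A map equal to 0 near z would have an uncountable fibre over 0, so the zero has finite
  order.\<close>

lemma vanishing_order_exists:
  assumes hol: "holomorphic_to_sphere \<Theta>" and z: "\<Theta> z = Some 0" and cnt: "countable (\<Theta> -` {Some 0})"
  shows "\<exists>m>0. vanishing_order \<Theta> z m"
proof -
  let ?g = "\<lambda>w. sphere_coord (Some 0) (\<Theta> w)"
  have an: "?g analytic_on {z}"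
    using hol z unfolding holomorphic_to_sphere_def by metis
  have cont: "continuous_map euclidean riemann_sphere \<Theta>"
    using hol unfolding holomorphic_to_sphere_def by blast
  \<comment> \<open>\<open>sphere_coord (Some 0) None\<close> is 0, so the value infinity would look
    like a zero. Restricting to the open set of points with finite value rules this out.\<close>
  have "open {w. \<Theta> w \<in> range Some}"
    using openin_continuous_map_preimage[OF cont, of "range Some"] openin_riemann_sphere_Some[of UNIV] by simp
  moreover obtain S where S: "open S" "z \<in> S" "?g holomorphic_on S" using an analytic_at by blast
  ultimately have "open (S \<inter> {w. \<Theta> w \<in> range Some})" "z \<in> S \<inter> {w. \<Theta> w \<in> range Some}"
    using z by auto
  then obtain \<rho> where "\<rho> > 0" "ball z \<rho> \<subseteq> S \<inter> {w. \<Theta> w \<in> range Some}" using openE by blast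
  then have \<rho>: "\<rho> > 0" "ball z \<rho> \<subseteq> S" "\<And>w. w \<in> ball z \<rho> \<Longrightarrow> \<Theta> w \<in> range Some"
    by auto
  have gval: "\<Theta> w = Some (?g w)" if "w \<in> ball z \<rho>" for w
    using \<rho>(3)[OF that] by auto
  have holb: "?g holomorphic_on ball z \<rho>" by (rule holomorphic_on_subset[OF S(3) \<rho>(2)])
  have nz: "\<exists>w\<in>ball z \<rho>. ?g w \<noteq> 0"
  proof (rule ccontr)
    assume "\<not> ?thesis"
    then have "ball z \<rho> \<subseteq> \<Theta> -` {Some 0}" using gval by force
    then have "countable (ball z \<rho>)" using cnt countable_subset by blast
    then show False using uncountable_ball[OF \<rho>(1)] by blast
  qed
  have const: "\<not> ?g constant_on ball z \<rho>"
  proof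
    assume "?g constant_on ball z \<rho>"
    then obtain c where c: "\<And>w. w \<in> ball z \<rho> \<Longrightarrow> ?g w = c" unfolding constant_on_def by blast
    then have "c = 0" using c[of z] \<rho>(1) z by simp
    then show False using nz c by auto
  qed
  have gz: "?g z = 0" using z by simp
  obtain g r n where gr: "0 < n" "0 < r" "ball z r \<subseteq> ball z \<rho>" "g holomorphic_on ball z r"
    "\<And>w. w \<in> ball z r \<Longrightarrow> ?g w = (w - z) ^ n * g w" "\<And>w. w \<in> ball z r \<Longrightarrow> g w \<noteq> 0"
    using holomorphic_factor_zero_nonconstant[OF holb open_ball connected_ball _ gz const] \<rho>(1)
    by (metis centre_in_ball)
  have "g analytic_on {z}"
    using gr(2,4) unfolding analytic_at by (metis centre_in_ball open_ball)
  then have an0: "(\<lambda>t. g (z + t)) analytic_on {0}" by (rule analytic_shift)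
  have "\<forall>\<^sub>F w in nhds z. w \<in> ball z r" using gr(2) by (intro eventually_nhds_in_open) auto
  then have "\<forall>\<^sub>F w in nhds z. \<Theta> w = Some ((w - z) ^ n * g w)"
  proof eventually_elim
    case (elim w)
    have "\<Theta> w = Some (?g w)" using gval elim gr(3) by blast
    then show ?case unfolding gr(5)[OF elim] .
  qed
  from eventually_nhds_shift[OF this]
  have "\<forall>\<^sub>F t in nhds 0. \<Theta> (z + t) = Some (t ^ n * g (z + t))" by simp
  moreover have "g (z + 0) \<noteq> 0" using gr(2,6) by simp
  ultimately have "vanishing_order \<Theta> z n"
    unfolding vanishing_order_def using an0 by (intro exI[of _ "\<lambda>t. g (z + t)"] conjI)
  then show ?thesis using gr(1) by blast
qed

text \<open>Both sides of the semiconjugacy are expanded at z: f after \<Theta> vanishes to order k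
  m, while t -> \<Theta>(a (z + t) + c) vanishes to order n, as the nonzero slope a only changes the
  unit factor.\<close>

lemma vanishing_order_step:
  assumes f: "has_local_degree f (Some 0) k" "f (Some 0) = Some 0"
    and semi: "\<And>z. f (\<Theta> z) = \<Theta> (a * z + c)" and a: "a \<noteq> 0"
    and m: "vanishing_order \<Theta> z m" "m > 0" and n: "vanishing_order \<Theta> (a * z + c) n"
  shows "n = k * m"
proof -
  obtain h where h: "h analytic_on {0}" "h 0 \<noteq> 0" "\<forall>\<^sub>F t in nhds 0. \<Theta> (z + t) = Some (t ^ m * h t)"
    using m(1) unfolding vanishing_order_def by blast
  obtain l where l: "l analytic_on {0}" "l 0 \<noteq> 0" "\<forall>\<^sub>F t in nhds 0. f (Some t) = Some (t ^ k * l t)"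
    using f unfolding has_local_degree_def by auto
  obtain j where j: "j analytic_on {0}" "j 0 \<noteq> 0" "\<forall>\<^sub>F t in nhds 0. \<Theta> (a * z + c + t) = Some (t ^ n * j t)"
    using n unfolding vanishing_order_def by blast
  let ?\<Phi> = "\<lambda>t. \<Theta> (a * z + c + a * t)"
  obtain g where g: "g analytic_on {0}" "g 0 \<noteq> 0" "\<And>t. (t ^ m * h t) ^ k * l (t ^ m * h t) = t ^ (k * m) * g t"
    "filterlim (\<lambda>t. t ^ m * h t) (nhds 0) (nhds 0)"
    using power_form_compose[OF h(1,2) l(1,2) m(2), of k] by metis
  have "\<forall>\<^sub>F t in nhds 0. ?\<Phi> (0 + t) = Some (t ^ (k * m) * g t)"
    using h(3) eventually_compose_filterlim[OF l(3) g(4)]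
  proof eventually_elim
    case (elim t)
    have "?\<Phi> (0 + t) = f (\<Theta> (z + t))" by (simp add: semi algebra_simps)
    then show ?case using elim by (simp add: g(3))
  qed
  then have v1: "vanishing_order ?\<Phi> 0 (k * m)"
    unfolding vanishing_order_def using g(1,2) by blast
  obtain i where i: "i analytic_on {0}" "i 0 \<noteq> 0" "\<And>t. (t ^ 1 * a) ^ n * j (t ^ 1 * a) = t ^ (n * 1) * i t"
    "filterlim (\<lambda>t. t ^ 1 * a) (nhds 0) (nhds 0)"
    using power_form_compose[OF analytic_on_const a j(1,2) zero_less_one, of n] by metis
  have "\<forall>\<^sub>F t in nhds 0. ?\<Phi> (0 + t) = Some (t ^ n * i t)"
    using eventually_compose_filterlim[OF j(3) i(4)]
    unfolding i(3) by eventually_elim (simp add: mult.commute)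
  then have v2: "vanishing_order ?\<Phi> 0 n"
    unfolding vanishing_order_def using i(1,2) by blast
  show ?thesis using vanishing_order_unique[OF v2 v1] .
qed

text \<open>Along the orbit of a zero of \<Theta> under z -> a z + c the vanishing order is
  multiplied by k at each step. The fibre over 0 is finite modulo the lattice, so two orbit points
  are congruent, and periodicity makes their orders equal although k >= 2 makes them
  different.\<close>

lemma superattracting_not_lattes:
  assumes deg: "has_local_degree f (Some 0) k" "k \<ge> 2" and fix0: "f (Some 0) = Some 0" and nonconst: "f w \<noteq> Some 0"
  shows "\<not> lattes_map f"
proof
  assume "lattes_map f"
  then obtain \<Lambda> a c \<Theta> where L: "complex_lattice \<Lambda>" and hol: "holomorphic_to_sphere \<Theta>"
    and per: "\<And>z \<omega>. \<omega> \<in> \<Lambda> \<Longrightarrow> \<Theta> (z + \<omega>) = \<Theta> z" and surj: "surj \<Theta>"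
    and fin: "\<And>w. finite ((\<lambda>z. (+) z ` \<Lambda>) ` (\<Theta> -` {w}))" and semi: "\<And>z. f (\<Theta> z) = \<Theta> (a * z + c)"
    unfolding lattes_map_def by blast
  note \<Lambda> = countable_lattice[OF L]
  have cnt: "countable (\<Theta> -` {Some 0})"
  proof (rule countable_subset)
    show "\<Theta> -` {Some 0} \<subseteq> \<Union>((\<lambda>z. (+) z ` \<Lambda>) ` (\<Theta> -` {Some 0}))"
      using \<Lambda>(2) by force
    have "countable ((\<lambda>z. (+) z ` \<Lambda>) ` (\<Theta> -` {Some 0}))" using fin countable_finite by blast
    then show "countable (\<Union>((\<lambda>z. (+) z ` \<Lambda>) ` (\<Theta> -` {Some 0})))"
      using \<Lambda>(1) by (intro countable_UN[of _ id, simplified]) auto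
  qed
  \<comment> \<open>For a = 0 the surjectivity of \<Theta> would make f constant with value 0,
    against the point w.\<close>
  have a: "a \<noteq> 0"
  proof
    assume "a = 0"
    then have const: "f (\<Theta> z) = \<Theta> c" for z using semi by simp
    obtain x y where "\<Theta> x = Some 0" "\<Theta> y = w" using surj by (metis surjD)
    then have "f w = f (Some 0)" using const[of x] const[of y] by simp
    then show False using fix0 nonconst by simp
  qed
  obtain z0 where z0: "\<Theta> z0 = Some 0" using surj by (metis surjD)
  define Z where "Z n = ((\<lambda>z. a * z + c) ^^ n) z0" for n
  have Z: "\<Theta> (Z n) = Some 0" for n
    by (induction n) (simp_all add: Z_def z0 fix0 flip: semi)
  obtain m where m: "m > 0" "vanishing_order \<Theta> z0 m" using vanishing_order_exists[OF hol z0 cnt] by blast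
  have ord: "vanishing_order \<Theta> (Z n) (k ^ n * m)" for n
  proof (induction n)
    case 0 then show ?case using m by (simp add: Z_def)
  next
    case (Suc n)
    have S: "Z (Suc n) = a * Z n + c" by (simp add: Z_def)
    obtain m' where m': "vanishing_order \<Theta> (a * Z n + c) m'"
      using vanishing_order_exists[OF hol Z[of "Suc n"] cnt] S by auto
    have "m' = k * (k ^ n * m)"
      by (rule vanishing_order_step[OF deg(1) fix0 semi a Suc.IH _ m']) (use deg(2) m(1) in simp)
    then show ?case using m' S by (simp add: mult.assoc)
  qed
  have "range (\<lambda>n. (+) (Z n) ` \<Lambda>) \<subseteq> (\<lambda>z. (+) z ` \<Lambda>) ` (\<Theta> -` {Some 0})"
    using Z by auto
  then have "finite (range (\<lambda>n. (+) (Z n) ` \<Lambda>))" by (rule finite_subset[OF _ fin])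
  then have "\<not> inj (\<lambda>n. (+) (Z n) ` \<Lambda>)"
    using finite_imageD[of "\<lambda>n. (+) (Z n) ` \<Lambda>" UNIV] infinite_UNIV_nat by argo
  then obtain i' j' where "i' \<noteq> j'" "(+) (Z i') ` \<Lambda> = (+) (Z j') ` \<Lambda>"
    unfolding inj_def by blast
  then obtain i j where ij: "i < j" "(+) (Z i) ` \<Lambda> = (+) (Z j) ` \<Lambda>"
    by (cases i' j' rule: linorder_cases) auto
  have "Z i + 0 \<in> (+) (Z i) ` \<Lambda>" using \<Lambda>(2) by (rule imageI)
  then obtain \<omega> where \<omega>: "\<omega> \<in> \<Lambda>" "Z i = Z j + \<omega>" unfolding ij(2) by auto
  have "vanishing_order \<Theta> (Z j) (k ^ i * m)"
    using ord[of i] vanishing_order_periodic[of \<Theta> \<omega> "Z j", OF per[OF \<omega>(1)]] unfolding \<omega>(2) by simp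
  then have "k ^ i * m = k ^ j * m" by (rule vanishing_order_unique[OF _ ord])
  then have "k ^ i = k ^ j" using m(1) by simp
  then show False using ij(1) deg(2) by simp
qed

theorem theorem1:
  "\<exists>(f :: csphere \<Rightarrow> csphere) v\<^sub>0 v\<^sub>1 v\<^sub>2 \<beta> \<beta>'.
     real_rational_map 6 f \<and>
     postcritically_finite f \<and>
     postcritical_set f = {Some 0, v\<^sub>0, v\<^sub>1, v\<^sub>2} \<and> card (postcritical_set f) = 4 \<and>
     superattracting_fixed_point f (Some 0) \<and> local_degree f (Some 0) = 3 \<and>
     f -` {Some 0} = postcritical_set f \<and>
     (\<forall>\<gamma> \<in> {\<beta>, \<beta>'}.
        characteristic_curve f \<gamma> \<and>
        (\<exists>\<gamma>\<^sub>1 \<gamma>\<^sub>2. \<gamma>\<^sub>1 \<noteq> \<gamma>\<^sub>2 \<and> components_in_sphere (f -` \<gamma>) = {\<gamma>\<^sub>1, \<gamma>\<^sub>2} \<and>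
           essential_curve f \<gamma>\<^sub>1 \<and> homotopic_rel (postcritical_set f) \<gamma>\<^sub>1 \<gamma> \<and>
           essential_curve f \<gamma>\<^sub>2 \<and> homotopic_rel (postcritical_set f) \<gamma>\<^sub>2 \<gamma> \<and>
           maps_onto_with_degree f \<gamma>\<^sub>1 \<gamma> 4 \<and> maps_onto_with_degree f \<gamma>\<^sub>2 \<gamma> 2)) \<and>
     \<not> homotopic_rel (postcritical_set f) \<beta> \<beta>' \<and>
     separates \<beta> {Some 0, v\<^sub>0} {v\<^sub>1, v\<^sub>2} \<and>
     separates \<beta>' {Some 0, v\<^sub>1} {v\<^sub>0, v\<^sub>2} \<and>
     orbifold_signature f = {#2, 2, 3, \<infinity>#} \<and>
     \<not> lattes_map f"
proof -
  obtain b C p q r s where "pcf_map b C p q r s"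
    using pcf_map_exists by blast
  then interpret pcf_map b C p q r s .
  interpret R: pcf_curve b C p q r s 1 by unfold_locales simp
  interpret L: pcf_curve b C p q r s "-1" by unfold_locales simp
  have deg0: "local_degree f (Some 0) = 3"
    by (rule local_degree_eqI[OF local_degree_zero])
  have fix0: "f (Some 0) = Some 0" using f_eq_0_iff[of "Some 0"] by (simp add: P_def)
  \<comment> \<open>A pole serves as the point that f does not send to 0.\<close>
  obtain z :: complex where "z\<^sup>2 + complex_of_real b = 0" using exists_pole by blast
  then have "f (Some z) \<noteq> Some 0" by (simp add: f_Some)
  then have "\<not> lattes_map f"
    by (rule superattracting_not_lattes[OF local_degree_zero _ fix0, rotated]) simp
  moreover have "postcritically_finite f"
    by (simp add: postcritically_finite_def postcritical_set_f P_def)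
  moreover have "card (postcritical_set f) = 4"
    by (simp add: postcritical_set_f P_def)
  moreover have "superattracting_fixed_point f (Some 0)"
    using fix0 deg0 by (simp add: superattracting_fixed_point_def Crit_def)
  moreover have "f -` {Some 0} = postcritical_set f"
    using f_eq_0_iff by (auto simp: postcritical_set_f)
  moreover have "\<not> homotopic_rel (postcritical_set f) R.curve L.curve"
    using curves_not_homotopic by (simp add: postcritical_set_f R.curve_def L.curve_def)
  moreover have "separates R.curve {Some 0, Some 1} {Some (-1), None}"
    using R.curve_separates by simp
  moreover have "separates L.curve {Some 0, Some (-1)} {Some 1, None}"
    using L.curve_separates by simp
  ultimately show ?thesis
    using real_rational_map_f postcritical_set_f[unfolded P_def] deg0 orbifold_signature_f
      R.curve_properties L.curve_properties
    by (intro exI[of _ f] exI[of _ "Some 1"] exI[of _ "Some (-1)"] exI[of _ None]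
        exI[of _ R.curve] exI[of _ L.curve] conjI) (assumption | simp only: ball_simps)+
qed

end
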